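(* There is a linear-time algorithm that, given a maximal outer-1-plane graph $G$, computes a bar 1-visibility drawing of $G$. In particular, every maximal outer-1-plane graph is bar 1-visible.
   Context: An outer-1-plane graph is a graph together with a drawing in the plane in which all vertices lie on the outer face and each edge is crossed at most once. An outer-1-plane graph $G=(V,E)$ is maximal if for every pair of non-adjacent vertices $u,v$, the graph $(V,E\cup\{(u,v)\})$ is not outer-1-plane for any drawing of the new edge $(u,v)$. A bar 1-visibility drawing of a graph $G$ draws each vertex as a horizontal line segment (a bar), pairwise disjoint, and each edge $(u,v)$ as a vertical line segment whose two endpoints lie on the bars of $u$ and $v$, such that the vertical segment of each edge intersects at most one bar other than the bars of its two end vertices. Linear time means time linear in the number of vertices of $G$. *)

theory Defs
  imports "HOL-Analysis.Analysis"
begin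

section \<open>Topological drawings of graphs\<close>

text \<open>A graph is a vertex set \<open>V\<close> with a set \<open>E\<close> of two-element subsets of \<open>V\<close>. A drawing places the
  vertices by \<open>pos\<close> and draws the edge \<open>e\<close> as the simple arc \<open>\<gamma> e\<close>, in either direction.\<close>

definition simple_graph :: "'a set \<Rightarrow> 'a set set \<Rightarrow> bool" where
  "simple_graph V E \<longleftrightarrow> finite V \<and> (\<forall>e\<in>E. e \<subseteq> V \<and> card e = 2)"

definition along :: "(real \<Rightarrow> complex) \<Rightarrow> complex \<Rightarrow> complex \<Rightarrow> real \<Rightarrow> complex" where
  "along g p q = subpath (inv_into {0..1} g p) (inv_into {0..1} g q) g"

definition first_hit :: "complex \<Rightarrow> real \<Rightarrow> (real \<Rightarrow> complex) \<Rightarrow> complex" where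
  "first_hit p r g = g (Inf {t \<in> {0..1}. dist p (g t) = r})"

text \<open>Arcs \<open>gs\<close> that start at \<open>p\<close> and are otherwise disjoint near \<open>p\<close> leave \<open>p\<close> in this
  counterclockwise cyclic order. The arcs may be wild, so the order is read off from the points where
  they first reach a small circle around \<open>p\<close>; the angles are measured from the first arc of the
  list.\<close>

definition ccw_at :: "complex \<Rightarrow> (real \<Rightarrow> complex) list \<Rightarrow> bool" where
  "ccw_at p gs \<longleftrightarrow>
     (\<forall>\<^sub>F r in at_right 0.
        sorted_wrt (<)
          (map (\<lambda>g. Arg2pi ((first_hit p r g - p) / (first_hit p r (hd gs) - p))) gs))"

text \<open>The edges \<open>{a, c}\<close> and \<open>{b, d}\<close> meet at \<open>p\<close>, and the four parts into which \<open>p\<close> cuts them lead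
  counterclockwise to \<open>a\<close>, \<open>b\<close>, \<open>c\<close>, \<open>d\<close>. So the edges do cross at \<open>p\<close> and do not merely touch.\<close>

definition crossing_ccw ::
  "('a \<Rightarrow> complex) \<Rightarrow> ('a set \<Rightarrow> real \<Rightarrow> complex) \<Rightarrow> complex \<Rightarrow> 'a \<Rightarrow> 'a \<Rightarrow> 'a \<Rightarrow> 'a \<Rightarrow> bool" where
  "crossing_ccw pos \<gamma> p a b c d \<longleftrightarrow>
     p \<in> path_image (\<gamma> {a, c}) \<inter> path_image (\<gamma> {b, d}) \<and>
     ccw_at p [along (\<gamma> {a, c}) p (pos a), along (\<gamma> {b, d}) p (pos b),
               along (\<gamma> {a, c}) p (pos c), along (\<gamma> {b, d}) p (pos d)]"

text \<open>The usual conventions for drawings apply: an edge contains no vertex other than its ends, adjacent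
  edges meet only at their common end, and non-adjacent edges meet only in proper crossings.\<close>

definition drawing ::
  "'a set \<Rightarrow> 'a set set \<Rightarrow> ('a \<Rightarrow> complex) \<Rightarrow> ('a set \<Rightarrow> real \<Rightarrow> complex) \<Rightarrow> bool" where
  "drawing V E pos \<gamma> \<longleftrightarrow>
     simple_graph V E \<and> inj_on pos V \<and>
     (\<forall>e\<in>E. arc (\<gamma> e) \<and> {pathstart (\<gamma> e), pathfinish (\<gamma> e)} = pos ` e \<and>
            (\<forall>v\<in>V. pos v \<in> path_image (\<gamma> e) \<longrightarrow> v \<in> e)) \<and>
     (\<forall>e\<in>E. \<forall>f\<in>E. e \<noteq> f \<longrightarrow> (\<forall>p \<in> path_image (\<gamma> e) \<inter> path_image (\<gamma> f).
        p \<in> pos ` (e \<inter> f) \<or>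
        (e \<inter> f = {} \<and> (\<exists>a b c d. e = {a, c} \<and> f = {b, d} \<and> crossing_ccw pos \<gamma> p a b c d))))"

definition drawn_set ::
  "'a set \<Rightarrow> 'a set set \<Rightarrow> ('a \<Rightarrow> complex) \<Rightarrow> ('a set \<Rightarrow> real \<Rightarrow> complex) \<Rightarrow> complex set" where
  "drawn_set V E pos \<gamma> = pos ` V \<union> (\<Union>e\<in>E. path_image (\<gamma> e))"

definition crossings ::
  "'a set \<Rightarrow> 'a set set \<Rightarrow> ('a \<Rightarrow> complex) \<Rightarrow> ('a set \<Rightarrow> real \<Rightarrow> complex) \<Rightarrow> 'a set
     \<Rightarrow> ('a set \<times> complex) set" where
  "crossings V E pos \<gamma> e =
     {(f, p). f \<in> E \<and> f \<noteq> e \<and> p \<in> path_image (\<gamma> e) \<inter> path_image (\<gamma> f) - pos ` V}"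

text \<open>The outer face is \<open>outside\<close> of the drawn set: the unbounded part of its complement.\<close>

definition outer_1_plane ::
  "'a set \<Rightarrow> 'a set set \<Rightarrow> ('a \<Rightarrow> complex) \<Rightarrow> ('a set \<Rightarrow> real \<Rightarrow> complex) \<Rightarrow> bool" where
  "outer_1_plane V E pos \<gamma> \<longleftrightarrow>
     drawing V E pos \<gamma> \<and>
     (\<forall>v\<in>V. pos v \<in> frontier (outside (drawn_set V E pos \<gamma>))) \<and>
     (\<forall>e\<in>E. \<exists>\<^sub>\<le>\<^sub>1x. x \<in> crossings V E pos \<gamma> e)"

definition maximal_outer_1_plane ::
  "'a set \<Rightarrow> 'a set set \<Rightarrow> ('a \<Rightarrow> complex) \<Rightarrow> ('a set \<Rightarrow> real \<Rightarrow> complex) \<Rightarrow> bool" where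
  "maximal_outer_1_plane V E pos \<gamma> \<longleftrightarrow>
     outer_1_plane V E pos \<gamma> \<and>
     (\<forall>u\<in>V. \<forall>v\<in>V. u \<noteq> v \<and> {u, v} \<notin> E \<longrightarrow>
        \<not> (\<exists>g. outer_1_plane V (insert {u, v} E) pos (\<gamma>({u, v} := g))))"

section \<open>Bar 1-visibility drawings\<close>

definition bar :: "('a \<Rightarrow> real) \<Rightarrow> ('a \<Rightarrow> real) \<Rightarrow> ('a \<Rightarrow> real) \<Rightarrow> 'a \<Rightarrow> complex set" where
  "bar y l r v = closed_segment (Complex (l v) (y v)) (Complex (r v) (y v))"

text \<open>A vertical segment with one end on the bar of \<open>u\<close> and the other on the bar of \<open>v\<close> is determined by
  its abscissa \<open>x {u, v}\<close>.\<close>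

definition bar_1_visibility_drawing ::
  "'a set \<Rightarrow> 'a set set \<Rightarrow> ('a \<Rightarrow> real) \<Rightarrow> ('a \<Rightarrow> real) \<Rightarrow> ('a \<Rightarrow> real) \<Rightarrow> ('a set \<Rightarrow> real) \<Rightarrow> bool" where
  "bar_1_visibility_drawing V E y l r x \<longleftrightarrow>
     (\<forall>v\<in>V. l v < r v) \<and>
     (\<forall>u\<in>V. \<forall>v\<in>V. u \<noteq> v \<longrightarrow> bar y l r u \<inter> bar y l r v = {}) \<and>
     (\<forall>u v. {u, v} \<in> E \<longrightarrow>
        Complex (x {u, v}) (y u) \<in> bar y l r u \<and>
        Complex (x {u, v}) (y v) \<in> bar y l r v \<and>
        (\<exists>\<^sub>\<le>\<^sub>1w. w \<in> V - {u, v} \<and>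
           closed_segment (Complex (x {u, v}) (y u)) (Complex (x {u, v}) (y v)) \<inter> bar y l r w \<noteq> {}))"

definition bar_1_visible :: "'a set \<Rightarrow> 'a set set \<Rightarrow> bool" where
  "bar_1_visible V E \<longleftrightarrow> (\<exists>y l r x. bar_1_visibility_drawing V E y l r x)"

section \<open>Random access machine programs and their running time\<close>

text \<open>A state consists of registers and of a random access memory, both holding natural numbers. Every
  assignment, store and test costs one unit; an expression in a fixed program has bounded size, so this
  is the unit-cost measure up to a constant factor. \<open>B\<close> is the largest storable number: an execution
  that would store a larger number, or store at a larger address, gets stuck. There is no
  multiplication.\<close>

type_synonym state = "(nat \<Rightarrow> nat) \<times> (nat \<Rightarrow> nat)"

datatype aexp = Const nat | Reg nat | Load aexp | Add aexp aexp | Sub aexp aexp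

datatype bexp = Less aexp aexp | Neg bexp | Conj bexp bexp

datatype com = Skip | Assign nat aexp | Store aexp aexp | Seq com com | Cond bexp com com | While bexp com

fun aval :: "aexp \<Rightarrow> state \<Rightarrow> nat" where
  "aval (Const n) s = n"
| "aval (Reg i) s = fst s i"
| "aval (Load a) s = snd s (aval a s)"
| "aval (Add a b) s = aval a s + aval b s"
| "aval (Sub a b) s = aval a s - aval b s"

fun bval :: "bexp \<Rightarrow> state \<Rightarrow> bool" where
  "bval (Less a b) s \<longleftrightarrow> aval a s < aval b s"
| "bval (Neg b) s \<longleftrightarrow> \<not> bval b s"
| "bval (Conj b c) s \<longleftrightarrow> bval b s \<and> bval c s"

text \<open>\<open>exec B c s t s'\<close>: started in \<open>s\<close>, the program \<open>c\<close> terminates in \<open>s'\<close> after \<open>t\<close> steps.\<close>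

inductive exec :: "nat \<Rightarrow> com \<Rightarrow> state \<Rightarrow> nat \<Rightarrow> state \<Rightarrow> bool" for B :: nat where
  Skip: "exec B Skip s 1 s"
| Assign: "aval a s \<le> B \<Longrightarrow> exec B (Assign i a) s 1 ((fst s)(i := aval a s), snd s)"
| Store: "aval p s \<le> B \<Longrightarrow> aval a s \<le> B \<Longrightarrow>
    exec B (Store p a) s 1 (fst s, (snd s)(aval p s := aval a s))"
| Seq: "exec B c\<^sub>1 s t\<^sub>1 s' \<Longrightarrow> exec B c\<^sub>2 s' t\<^sub>2 s'' \<Longrightarrow> exec B (Seq c\<^sub>1 c\<^sub>2) s (t\<^sub>1 + t\<^sub>2) s''"
| Cond_True: "bval b s \<Longrightarrow> exec B c\<^sub>1 s t s' \<Longrightarrow> exec B (Cond b c\<^sub>1 c\<^sub>2) s (1 + t) s'"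
| Cond_False: "\<not> bval b s \<Longrightarrow> exec B c\<^sub>2 s t s' \<Longrightarrow> exec B (Cond b c\<^sub>1 c\<^sub>2) s (1 + t) s'"
| While_False: "\<not> bval b s \<Longrightarrow> exec B (While b c) s 1 s"
| While_True: "bval b s \<Longrightarrow> exec B c s t\<^sub>1 s' \<Longrightarrow> exec B (While b c) s' t\<^sub>2 s'' \<Longrightarrow>
    exec B (While b c) s (1 + t\<^sub>1 + t\<^sub>2) s''"

definition initial_state :: "nat list \<Rightarrow> state" where
  "initial_state xs = (\<lambda>_. 0, \<lambda>i. if i < length xs then xs ! i else 0)"

definition stored_at :: "state \<Rightarrow> nat \<Rightarrow> nat list \<Rightarrow> bool" where
  "stored_at s a xs \<longleftrightarrow> (\<forall>i<length xs. snd s (a + i) = xs ! i)"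

section \<open>Input and output of the algorithm\<close>

text \<open>The combinatorial description of a plane graph with vertices \<open>0, \<dots>, n - 1\<close>. The neighbours of each
  vertex are listed counterclockwise, beginning at the outer face: the list starts after an auxiliary
  arc \<open>\<delta>\<close> that leaves the vertex into the outer face. Each crossing is listed once, by the four ends
  of the two edges in counterclockwise order around the crossing point.\<close>

definition describes ::
  "nat list list \<Rightarrow> (nat \<times> nat \<times> nat \<times> nat) list \<Rightarrow> nat \<Rightarrow> nat set set
     \<Rightarrow> (nat \<Rightarrow> complex) \<Rightarrow> (nat set \<Rightarrow> real \<Rightarrow> complex) \<Rightarrow> bool" where
  "describes adj cr n E pos \<gamma> \<longleftrightarrow>
     length adj = n \<and>
     (\<forall>v<n. distinct (adj ! v) \<and> set (adj ! v) = {w. {v, w} \<in> E} \<and>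
        (\<exists>\<delta>. arc \<delta> \<and> pathstart \<delta> = pos v \<and>
             path_image \<delta> - {pos v} \<subseteq> outside (drawn_set {..<n} E pos \<gamma>) \<and>
             ccw_at (pos v) (\<delta> # map (\<lambda>w. along (\<gamma> {v, w}) (pos v) (pos w)) (adj ! v)))) \<and>
     (\<forall>(a, b, c, d) \<in> set cr.
        {a, c} \<in> E \<and> {b, d} \<in> E \<and> {a, c} \<noteq> {b, d} \<and> (\<exists>p. crossing_ccw pos \<gamma> p a b c d)) \<and>
     (\<forall>e\<in>E. \<forall>(f, p) \<in> crossings {..<n} E pos \<gamma> e.
        \<exists>!i. i < length cr \<and> (case cr ! i of (a, b, c, d) \<Rightarrow> {{a, c}, {b, d}} = {e, f}))"

definition encode_input :: "nat list list \<Rightarrow> (nat \<times> nat \<times> nat \<times> nat) list \<Rightarrow> nat list" where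
  "encode_input adj cr =
     length adj # length cr # concat (map (\<lambda>ws. length ws # ws) adj) @
     concat (map (\<lambda>(a, b, c, d). [a, b, c, d]) cr)"

text \<open>The output consists of the bars, as ordinate and left and right abscissa, and of the edges, as
  triples of two ends and an abscissa.\<close>

definition encode_output ::
  "nat \<Rightarrow> (nat \<Rightarrow> nat) \<Rightarrow> (nat \<Rightarrow> nat) \<Rightarrow> (nat \<Rightarrow> nat) \<Rightarrow> (nat \<times> nat \<times> nat) list \<Rightarrow> nat list" where
  "encode_output n y l r es =
     concat (map (\<lambda>v. [y v, l v, r v]) [0..<n]) @
     length es # concat (map (\<lambda>(u, v, x). [u, v, x]) es)"

text \<open>The final state holds a bar 1-visibility drawing of the graph on \<open>0, \<dots>, n - 1\<close>, at the address given
  by register 0.\<close>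

definition outputs_bar_1_visibility_drawing :: "state \<Rightarrow> nat \<Rightarrow> nat set set \<Rightarrow> bool" where
  "outputs_bar_1_visibility_drawing s n E \<longleftrightarrow>
     (\<exists>y l r es x.
        stored_at s (fst s 0) (encode_output n y l r es) \<and>
        distinct (map (\<lambda>(u, v, _). {u, v}) es) \<and> (\<lambda>(u, v, _). {u, v}) ` set es = E \<and>
        (\<forall>(u, v, k) \<in> set es. x {u, v} = real k) \<and>
        bar_1_visibility_drawing {..<n} E (\<lambda>v. real (y v)) (\<lambda>v. real (l v)) (\<lambda>v. real (r v)) x)"

text \<open>Linear time in the number \<open>n\<close> of vertices, on numbers of \<open>O(log n)\<close> bits.\<close>

definition linear_time_bar_1_visibility_algorithm :: "com \<Rightarrow> bool" where
  "linear_time_bar_1_visibility_algorithm prog \<longleftrightarrow>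
     (\<exists>c k. \<forall>n E pos \<gamma> adj cr.
        maximal_outer_1_plane {..<n} E pos \<gamma> \<and> describes adj cr n E pos \<gamma> \<longrightarrow>
        (\<exists>t s. exec ((n + 2) ^ k) prog (initial_state (encode_input adj cr)) t s \<and>
               t \<le> c * (n + 1) \<and> outputs_bar_1_visibility_drawing s n E))"

end

theory Submission
  imports Defs
begin

text \<open>In an outer-1-plane drawing every vertex can be joined by disjoint arcs, outside the drawing, to a
  circle around it. Two edges whose ends are interleaved on the circle must cross by Fashoda's theorem,
  so in the order of the vertices along the circle every edge is interleaved with at most one other.
  Given such an order, let the bar of the vertex of rank \<open>\<rho> v\<close> be the segment from \<open>0\<close> to the largest
  rank difference along an edge at \<open>v\<close>, at ordinate \<open>\<rho> v\<close>, and draw each edge at the abscissa that is the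
  rank difference of its ends. An edge can only meet the bar of a vertex strictly between its ends
  that has an interleaved edge, hence at most one bar.

  If the graph is maximal, vertices that are consecutive on the circle are adjacent, since otherwise an
  edge could be drawn along the circle. By a comparison of the cyclic order at a vertex with that on
  the circle, the successor of a vertex is the first in its list of neighbours. So the order is found
  by following first neighbours, in linear time, as there are at most \<open>3 n\<close> edges.\<close>

section \<open>Paths in half planes, strips and discs\<close>

text \<open>Edges are arbitrary arcs, possibly spiralling, so there are no tangent directions to
  compare. Every order argument rests on one fact, that paths with interlaced ends meet; an
  exponential and a Cayley transform carry it over to strips and discs. Two kinds of access are
  distinguished. For the drawing alone, an access arc may cross edges at its own vertex, since
  interleaved edges have no common end; a short segment can start it. For the algorithm the arc must
  stay in the outer face, and it keeps the germ of the arc \<delta> of the description, so that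
  \<open>ccw_at\<close> speaks of it as well. The cyclic order at a vertex is read on circles around
  that vertex, the boundary order on one circle around the origin. The curves are therefore
  prolonged by rays to a large circle around the vertex, and the viewpoint is then moved to the
  origin. With rank differences as abscissas, an edge reaches the bar of a vertex between its ends
  only if that vertex has an edge spanning at least as many ranks; the other end of that edge then
  lies beyond, and this is the interleaving.\<close>

lemma paths_interlaced_on_real_axis_meet:
  fixes f g :: "real \<Rightarrow> complex"
  assumes "path f" "path g"
    and "\<And>z. z \<in> path_image f \<Longrightarrow> 0 \<le> Im z" "\<And>z. z \<in> path_image g \<Longrightarrow> 0 \<le> Im z"
    and "Im (pathstart f) = 0" "Im (pathfinish f) = 0" "Im (pathstart g) = 0" "Im (pathfinish g) = 0"
    and "Re (pathstart f) < Re (pathstart g)" "Re (pathstart g) < Re (pathfinish f)"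
      "Re (pathfinish f) < Re (pathfinish g)"
  shows "path_image f \<inter> path_image g \<noteq> {}"
proof -
  define v :: "complex \<Rightarrow> real^2" where "v z = (\<chi> i. if i = 1 then Re z else Im z)" for z
  have v1[simp]: "v z $ 1 = Re z" and v2[simp]: "v z $ 2 = Im z" for z
    by (auto simp: v_def)
  have cv: "continuous_on A v" for A
    unfolding v_def
    by (intro continuous_on_vec_lambda) (case_tac "i = 1"; simp add: continuous_on_Re continuous_on_Im)
  have inj: "v z = v w \<longleftrightarrow> z = w" for z w
    by (auto simp: vec_eq_iff forall_2 complex_eq_iff)
  have "bounded (path_image f \<union> path_image g)"
    using assms(1,2) by (simp add: bounded_path_image)
  then obtain M where M: "\<And>z. z \<in> path_image f \<union> path_image g \<Longrightarrow> norm z \<le> M"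
    unfolding bounded_iff by blast
  \<comment> \<open>The box has corners (-M, 0) and (M, M): its bottom side lies on the real axis
    and carries all four ends, which is the setting of \<open>fashoda_interlace\<close>.\<close>
  define a b :: "real^2" where "a = (\<chi> i. if i = 1 then -M else 0)" and "b = (\<chi> i. M)"
  have box: "v z \<in> cbox a b" if "norm z \<le> M" "0 \<le> Im z" for z
    using that abs_Re_le_cmod[of z] abs_Im_le_cmod[of z]
    by (auto simp: mem_box_cart forall_2 a_def b_def)
  obtain z where "z \<in> path_image (v \<circ> f)" "z \<in> path_image (v \<circ> g)"
  proof (rule fashoda_interlace[of "v \<circ> f" "v \<circ> g" a b])
    show "path (v \<circ> f)" "path (v \<circ> g)"
      using assms(1,2) cv by (auto intro: path_continuous_image)
    show "path_image (v \<circ> f) \<subseteq> cbox a b" "path_image (v \<circ> g) \<subseteq> cbox a b"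
      using M assms(3,4) box by (auto simp: path_image_compose)
  qed (use assms in \<open>auto simp: pathstart_compose pathfinish_compose a_def\<close>)
  then show ?thesis
    by (auto simp: path_image_compose inj)
qed

text \<open>The map z to exp (i k (z - a)) with k = pi / (b - a) sends the strip injectively into
  the upper half plane, its left side to the positive and its right side to the negative real axis.
  Greater height means smaller modulus, so the images of the ends are, from left to right, the
  finish of \<open>g\<close>, the finish of \<open>f\<close>, the start of \<open>g\<close>, the
  start of \<open>f\<close>. This is why both paths are reversed.\<close>

lemma paths_across_strip_meet:
  fixes f g :: "real \<Rightarrow> complex"
  assumes f: "path f" and g: "path g" and ab: "a < b"
    and fab: "\<And>z. z \<in> path_image f \<Longrightarrow> a \<le> Re z \<and> Re z \<le> b"
    and gab: "\<And>z. z \<in> path_image g \<Longrightarrow> a \<le> Re z \<and> Re z \<le> b"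
    and ends: "Re (pathstart f) = a" "Re (pathfinish f) = b" "Re (pathstart g) = a" "Re (pathfinish g) = b"
    and less: "Im (pathstart f) < Im (pathstart g)" "Im (pathfinish g) < Im (pathfinish f)"
  shows "path_image f \<inter> path_image g \<noteq> {}"
proof -
  define k where "k = pi / (b - a)"
  have k: "k > 0" "k * (b - a) = pi" using ab by (auto simp: k_def)
  define e where "e z = exp (\<i> * of_real k * (z - of_real a))" for z :: complex
  have Im_e: "Im (\<i> * of_real k * (z - of_real a)) = k * (Re z - a)" for z
    by simp
  have Re_e: "Re (\<i> * of_real k * (z - of_real a)) = - k * Im z" for z
    by simp
  have rng: "0 \<le> k * (Re z - a) \<and> k * (Re z - a) \<le> pi" if "a \<le> Re z \<and> Re z \<le> b" for z
  proof
    show "0 \<le> k * (Re z - a)" using that k(1) by simp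
    have "k * (Re z - a) \<le> k * (b - a)" using that k(1) by simp
    then show "k * (Re z - a) \<le> pi" using k(2) by simp
  qed
  have Arg2pi_e: "Arg2pi (e z) = k * (Re z - a)" if "a \<le> Re z \<and> Re z \<le> b" for z
    unfolding e_def using Arg2pi_exp[of "\<i> * of_real k * (z - of_real a)"] rng[OF that] pi_gt_zero
    unfolding Im_e by linarith
  have inj: "z = w" if "e z = e w" "a \<le> Re z \<and> Re z \<le> b" "a \<le> Re w \<and> Re w \<le> b" for z w
  proof -
    have "\<i> * of_real k * (z - of_real a) = \<i> * of_real k * (w - of_real a)"
    proof (rule complex_eqI)
      have "norm (e z) = norm (e w)" using that by simp
      then show "Re (\<i> * of_real k * (z - of_real a)) = Re (\<i> * of_real k * (w - of_real a))"
        unfolding e_def norm_exp_eq_Re by simp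
      have "Arg2pi (e z) = Arg2pi (e w)" using that by simp
      then show "Im (\<i> * of_real k * (z - of_real a)) = Im (\<i> * of_real k * (w - of_real a))"
        using Arg2pi_e[OF that(2)] Arg2pi_e[OF that(3)] unfolding Im_e by simp
    qed
    then show ?thesis using k by simp
  qed
  have ce: "continuous_on A e" for A
    unfolding e_def by (intro continuous_intros)
  have Re_a: "Re (e z) = exp (- k * Im z)" "Im (e z) = 0" if "Re z = a" for z
    using that by (auto simp: e_def Re_exp Im_exp)
  have Re_b: "Re (e z) = - exp (- k * Im z)" "Im (e z) = 0" if "Re z = b" for z
    using that k(2) by (auto simp: e_def Re_exp Im_exp)
  have Im_pos: "0 \<le> Im (e z)" if "a \<le> Re z \<and> Re z \<le> b" for z
    using rng[OF that] by (simp add: e_def Im_exp sin_ge_zero)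
  have "path_image (reversepath (e \<circ> g)) \<inter> path_image (reversepath (e \<circ> f)) \<noteq> {}"
  proof (rule paths_interlaced_on_real_axis_meet)
    show "path (reversepath (e \<circ> g))" "path (reversepath (e \<circ> f))"
      using f g ce by (auto intro: path_continuous_image)
    show "Re (pathstart (reversepath (e \<circ> g))) < Re (pathstart (reversepath (e \<circ> f)))"
      using less k(1) by (simp add: pathstart_compose pathfinish_compose Re_b ends)
    show "Re (pathfinish (reversepath (e \<circ> g))) < Re (pathfinish (reversepath (e \<circ> f)))"
      using less k(1) by (simp add: pathstart_compose pathfinish_compose Re_a ends)
    have "- exp x < exp y" for x y :: real by (meson exp_gt_zero less_trans neg_less_0_iff_less)
    then show "Re (pathstart (reversepath (e \<circ> f))) < Re (pathfinish (reversepath (e \<circ> g)))"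
      by (simp add: pathstart_compose pathfinish_compose Re_a Re_b ends)
    show "0 \<le> Im z" if "z \<in> path_image (reversepath (e \<circ> f))" for z
      using that fab Im_pos unfolding path_image_reversepath path_image_compose by blast
    show "0 \<le> Im z" if "z \<in> path_image (reversepath (e \<circ> g))" for z
      using that gab Im_pos unfolding path_image_reversepath path_image_compose by blast
  qed (simp_all add: pathstart_compose pathfinish_compose Re_a Re_b ends)
  then obtain p where "p \<in> path_image (e \<circ> f)" "p \<in> path_image (e \<circ> g)"
    by auto
  then obtain z w where "z \<in> path_image f" "w \<in> path_image g" "e z = e w"
    unfolding path_image_compose by (metis imageE)
  then show ?thesis using inj fab gab by blast
qed

text \<open>\<open>- cot (t / 2)\<close> is the place on the real axis to which the Cayley transform
  below sends the point of the circle at angle t from the point sent to infinity. It increases by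
  the addition formula for the sine.\<close>

lemma minus_cot_half_less:
  "0 < s \<Longrightarrow> s < t \<Longrightarrow> t < 2 * pi \<Longrightarrow> - cot (s / 2) < - cot (t / 2)"
proof -
  assume st: "0 < s" "s < t" "t < 2 * pi"
  have "sin (t / 2 - s / 2) > 0" using st by (intro sin_gt_zero) auto
  moreover have "sin (s/2) > 0" "sin (t/2) > 0" using st by (auto intro!: sin_gt_zero)
  ultimately show ?thesis
    unfolding sin_diff by (simp add: cot_def field_simps)
qed

text \<open>The Cayley transform that sends \<open>c\<close> to infinity turns the disc into a half plane.\<close>

lemma chords_interlaced_meet:
  fixes f g :: "real \<Rightarrow> complex"
  assumes f: "path f" and g: "path g" and c: "norm c = R" "R > 0"
    and fR: "path_image f \<subseteq> cball 0 R - {c}" and gR: "path_image g \<subseteq> cball 0 R - {c}"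
    and ends: "pathstart f = c * cis s1" "pathstart g = c * cis s2"
      "pathfinish f = c * cis s3" "pathfinish g = c * cis s4"
    and less: "0 < s1" "s1 < s2" "s2 < s3" "s3 < s4" "s4 < 2 * pi"
  shows "path_image f \<inter> path_image g \<noteq> {}"
proof -
  define C where "C z = \<i> * (c + z) / (c - z)" for z
  have inj: "z = w" if "C z = C w" "z \<noteq> c" "w \<noteq> c" for z w
  proof -
    have "(c + z) * (c - w) = (c + w) * (c - z)"
      using that by (simp add: C_def divide_eq_eq eq_divide_eq)
    then have "2 * c * (z - w) = 0" by (simp add: algebra_simps)
    then show ?thesis using c by auto
  qed
  have Im_pos: "0 \<le> Im (C z)" if "z \<in> cball 0 R - {c}" for z
  proof -
    \<comment> \<open>The result is Im (C z) = (|c|^2 - |z|^2) / |c - z|^2, so the disc goes to the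
      upper half plane.\<close>
    have "Im (\<i> * (c + z)) * Re (c - z) - Re (\<i> * (c + z)) * Im (c - z) = Re ((c + z) * cnj (c - z))"
      by (simp add: algebra_simps)
    then have "Im (C z) = Re ((c + z) * cnj (c - z)) / (norm (c - z))\<^sup>2"
      by (simp only: C_def Im_divide cmod_power2)
    moreover have "Re ((c + z) * cnj (c - z)) = (norm c)\<^sup>2 - (norm z)\<^sup>2"
      unfolding cmod_power2 by (simp add: power2_eq_square algebra_simps)
    moreover have "(norm z)\<^sup>2 \<le> (norm c)\<^sup>2" using that c by (simp add: power_mono)
    ultimately show ?thesis by simp
  qed
  have C_cis: "C (c * cis t) = of_real (- cot (t / 2))" if "0 < t" "t < 2 * pi" for t
  proof -
    have s: "sin (t/2) \<noteq> 0" using that sin_gt_zero[of "t/2"] by simp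
    \<comment> \<open>With cis (t/2) cancelled, the quotient is i times 2 cos (t/2) over -2 i sin
      (t/2).\<close>
    have ct: "cis t = cis (t/2) * cis (t/2)" by (simp add: cis_mult)
    have cc: "1 = cis (t/2) * cis (-(t/2))" by (simp add: cis_mult)
    have "C (c * cis t) = \<i> * (1 + cis t) / (1 - cis t)"
    proof -
      have "C (c * cis t) = (c * (\<i> * (1 + cis t))) / (c * (1 - cis t))"
        by (simp add: C_def algebra_simps)
      then show ?thesis using c by auto
    qed
    also have "\<dots> = \<i> * (cis (t/2) * (cis (-(t/2)) + cis (t/2))) / (cis (t/2) * (cis (-(t/2)) - cis (t/2)))"
      by (subst (1 2) ct, subst (1 2) cc) (simp only: algebra_simps)
    also have "\<dots> = \<i> * (cis (-(t/2)) + cis (t/2)) / (cis (-(t/2)) - cis (t/2))"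
      by simp
    also have "\<dots> = of_real (- cot (t / 2))"
      using s by (auto simp: complex_eq_iff cot_def Re_divide Im_divide power2_eq_square field_simps)
    finally show ?thesis .
  qed
  have cC: "continuous_on (cball 0 R - {c}) C"
    unfolding C_def by (intro continuous_intros) auto
  have "path_image (C \<circ> f) \<inter> path_image (C \<circ> g) \<noteq> {}"
  proof (rule paths_interlaced_on_real_axis_meet)
    show "path (C \<circ> f)" "path (C \<circ> g)"
      using f g cC fR gR by (auto intro!: path_continuous_image intro: continuous_on_subset)
    show "Re (pathstart (C \<circ> f)) < Re (pathstart (C \<circ> g))"
      "Re (pathstart (C \<circ> g)) < Re (pathfinish (C \<circ> f))"
      "Re (pathfinish (C \<circ> f)) < Re (pathfinish (C \<circ> g))"
      using less minus_cot_half_less[of s1 s2] minus_cot_half_less[of s2 s3] minus_cot_half_less[of s3 s4]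
      by (simp_all add: pathstart_compose pathfinish_compose ends C_cis)
    show "0 \<le> Im z" if "z \<in> path_image (C \<circ> f)" for z
      using that fR Im_pos unfolding path_image_compose by blast
    show "0 \<le> Im z" if "z \<in> path_image (C \<circ> g)" for z
      using that gR Im_pos unfolding path_image_compose by blast
  qed (use less in \<open>simp_all add: pathstart_compose pathfinish_compose ends C_cis\<close>)
  then obtain p where "p \<in> path_image (C \<circ> f)" "p \<in> path_image (C \<circ> g)"
    by auto
  then obtain z w where "z \<in> path_image f" "w \<in> path_image g" "C z = C w"
    unfolding path_image_compose by (metis imageE)
  then show ?thesis using inj[of z w] fR gR by blast
qed

section \<open>The cyclic order of arcs at a common end\<close>

text \<open>A time \<open>t1\<close> near 0 with \<open>f t1 < s\<close> gives a compact interval,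
  as nothing is known about \<open>f\<close> at 0 itself; the largest time there with value at most
  \<open>s\<close> is the last crossing. It serves to cut off the wild initial piece of a lifted
  arc.\<close>

lemma last_crossing_of_level:
  fixes f :: "real \<Rightarrow> real"
  assumes f: "continuous_on {0<..1} f" and lim: "filterlim f at_bot (at_right 0)"
    and t0: "0 < t0" "t0 \<le> 1" and above: "\<And>t. t \<in> {t0..1} \<Longrightarrow> s < f t"
  obtains \<tau> where "0 < \<tau>" "\<tau> < t0" "f \<tau> = s" "\<And>t. t \<in> {\<tau>..1} \<Longrightarrow> s \<le> f t"
proof -
  have "eventually (\<lambda>t. f t < s) (at_right 0)"
    using lim by (simp add: filterlim_at_bot_dense)
  moreover have "eventually (\<lambda>t. t \<in> {0<..<t0}) (at_right 0)"
    using t0(1) by (rule eventually_at_right_real)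
  ultimately have "eventually (\<lambda>t. f t < s \<and> t \<in> {0<..<t0}) (at_right 0)"
    by (rule eventually_conj)
  then obtain t1 where t1: "f t1 < s" "0 < t1" "t1 < t0"
    using eventually_happens'[OF trivial_limit_at_right_real] by fastforce
  have c1: "continuous_on {t1..1} f"
    using f t1 by (auto intro: continuous_on_subset)
  have "closed ({t1..1} \<inter> f -` {..s})"
    using c1 by (intro continuous_closed_preimage) auto
  then have "compact ({t1..1} \<inter> f -` {..s})"
    by (metis Int_lower1 bounded_closed_interval bounded_subset compact_eq_bounded_closed)
  moreover have "{t1..1} \<inter> f -` {..s} = {t \<in> {t1..1}. f t \<le> s}" by auto
  ultimately have "compact {t \<in> {t1..1}. f t \<le> s}" by simp
  moreover have "t1 \<in> {t \<in> {t1..1}. f t \<le> s}" using t1 t0 by auto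
  ultimately obtain \<tau> where \<tau>: "\<tau> \<in> {t \<in> {t1..1}. f t \<le> s}"
    and max: "\<And>t. t \<in> {t \<in> {t1..1}. f t \<le> s} \<Longrightarrow> t \<le> \<tau>"
    using compact_attains_sup[of "{t \<in> {t1..1}. f t \<le> s}"] by blast
  have lt: "\<tau> < t0"
    using \<tau> above[of \<tau>] by (cases "\<tau> < t0") auto
  obtain x where x: "\<tau> \<le> x" "x \<le> t0" "f x = s"
    using IVT'[of f \<tau> s t0] \<tau> lt above[of t0] t0 c1 continuous_on_subset[OF c1, of "{\<tau>..t0}"] by auto
  then have "x = \<tau>" using max[of x] \<tau> t0 by auto
  have "s \<le> f t" if "t \<in> {\<tau>..1}" for t
    using max[of t] that \<tau> x \<open>x = \<tau>\<close> by (cases "f t \<le> s") auto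
  then show ?thesis using that[of \<tau>] \<tau> t1 lt x \<open>x = \<tau>\<close> by auto
qed

text \<open>A change of order would force a common point by \<open>paths_across_strip_meet\<close>.
  The parameter intervals are arbitrary because pieces of lifts are compared;
  \<open>linepath\<close> rescales them.\<close>

lemma order_across_strip:
  fixes L M :: "real \<Rightarrow> complex"
  assumes L: "continuous_on {a1..b1} L" and M: "continuous_on {a2..b2} M"
    and le: "a1 \<le> b1" "a2 \<le> b2" and ab: "a < b"
    and La: "\<And>t. t \<in> {a1..b1} \<Longrightarrow> a \<le> Re (L t) \<and> Re (L t) \<le> b"
    and Ma: "\<And>t. t \<in> {a2..b2} \<Longrightarrow> a \<le> Re (M t) \<and> Re (M t) \<le> b"
    and ends: "Re (L a1) = a" "Re (L b1) = b" "Re (M a2) = a" "Re (M b2) = b"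
    and disj: "\<And>s t. s \<in> {a1..b1} \<Longrightarrow> t \<in> {a2..b2} \<Longrightarrow> L s \<noteq> M t"
  shows "Im (L a1) < Im (M a2) \<longleftrightarrow> Im (L b1) < Im (M b2)"
proof -
  define f where "f = L \<circ> linepath a1 b1"
  define g where "g = M \<circ> linepath a2 b2"
  have im: "path_image (linepath a1 b1) = {a1..b1}" "path_image (linepath a2 b2) = {a2..b2}"
    using le by (auto simp: closed_segment_eq_real_ivl)
  have fg: "path f" "path g"
    unfolding f_def g_def using L M im by (auto intro!: path_continuous_image simp del: path_image_linepath)
  have imf: "path_image f = L ` {a1..b1}" and img: "path_image g = M ` {a2..b2}"
    unfolding f_def g_def by (simp_all only: path_image_compose im)
  have e: "pathstart f = L a1" "pathfinish f = L b1" "pathstart g = M a2" "pathfinish g = M b2"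
    by (auto simp: f_def g_def pathstart_compose pathfinish_compose)
  have ne: "path_image f \<inter> path_image g = {}"
  proof (rule ccontr)
    assume "path_image f \<inter> path_image g \<noteq> {}"
    then obtain z where "z \<in> L ` {a1..b1}" "z \<in> M ` {a2..b2}" unfolding imf img by auto
    then show False using disj by (metis imageE)
  qed
  have "L a1 \<noteq> M a2" "L b1 \<noteq> M b2" using disj[of a1 a2] disj[of b1 b2] le by simp_all
  then have "Im (L a1) \<noteq> Im (M a2)" "Im (L b1) \<noteq> Im (M b2)"
    using ends by (auto simp: complex_eq_iff)
  moreover have "\<not> (Im (L a1) < Im (M a2) \<and> Im (M b2) < Im (L b1))"
    using paths_across_strip_meet[OF fg ab] ne La Ma ends unfolding imf img e by (metis imageE)
  moreover have "\<not> (Im (M a2) < Im (L a1) \<and> Im (L b1) < Im (M b2))"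
    using paths_across_strip_meet[OF fg(2,1) ab] ne La Ma ends unfolding imf img e by (metis imageE Int_commute)
  ultimately show ?thesis by linarith
qed

text \<open>After its first hit of level \<open>r\<close> a lift may turn back to the left, so it
  need not stay in the strip from \<open>r\<close> to \<open>b\<close>. Both orders are therefore
  compared with the order at the last crossings of a level \<open>s\<close> further left: from there
  a lift stays between \<open>s\<close> and \<open>r\<close> up to the first hit, and between
  \<open>s\<close> and \<open>b\<close> up to the end.\<close>

lemma order_from_first_hit_to_end:
  fixes L M :: "real \<Rightarrow> complex"
  assumes L: "continuous_on {0<..1} L" and M: "continuous_on {0<..1} M"
    and limL: "filterlim (\<lambda>t. Re (L t)) at_bot (at_right 0)"
    and limM: "filterlim (\<lambda>t. Re (M t)) at_bot (at_right 0)"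
    and Lb: "\<And>t. t \<in> {0<..1} \<Longrightarrow> Re (L t) \<le> b" "Re (L 1) = b"
    and Mb: "\<And>t. t \<in> {0<..1} \<Longrightarrow> Re (M t) \<le> b" "Re (M 1) = b"
    and disj: "\<And>s t. s \<in> {0<..1} \<Longrightarrow> t \<in> {0<..1} \<Longrightarrow> L s \<noteq> M t"
    and tL: "tL \<in> {0<..1}" "Re (L tL) = r" "\<And>t. t \<in> {0<..tL} \<Longrightarrow> Re (L t) \<le> r"
    and tM: "tM \<in> {0<..1}" "Re (M tM) = r" "\<And>t. t \<in> {0<..tM} \<Longrightarrow> Re (M t) \<le> r"
    and rb: "r < b" and less: "Im (L tL) < Im (M tM)"
  shows "Im (L 1) < Im (M 1)"
proof -
  have cL: "continuous_on {tL..1} (\<lambda>t. Re (L t))" and cM: "continuous_on {tM..1} (\<lambda>t. Re (M t))"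
    using L M tL tM by (auto intro!: continuous_on_Re intro: continuous_on_subset)
  obtain mL where mL: "\<And>t. t \<in> {tL..1} \<Longrightarrow> mL \<le> Re (L t)"
    using continuous_attains_inf[OF compact_Icc _ cL] tL by fastforce
  obtain mM where mM: "\<And>t. t \<in> {tM..1} \<Longrightarrow> mM \<le> Re (M t)"
    using continuous_attains_inf[OF compact_Icc _ cM] tM by fastforce
  \<comment> \<open>This level is to the left of \<open>r\<close> and of everything that either lift
    reaches after its first hit.\<close>
  define s where "s = min r (min mL mM) - 1"
  have s: "s < r" "s < mL" "s < mM" by (auto simp: s_def)
  obtain \<tau>L where \<tau>L: "0 < \<tau>L" "\<tau>L < tL" "Re (L \<tau>L) = s" "\<And>t. t \<in> {\<tau>L..1} \<Longrightarrow> s \<le> Re (L t)"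
  proof (rule last_crossing_of_level[of "\<lambda>t. Re (L t)" tL s])
    show "s < Re (L t)" if "t \<in> {tL..1}" for t using mL[OF that] s by simp
  qed (use L limL tL in \<open>auto intro!: continuous_on_Re\<close>)
  obtain \<tau>M where \<tau>M: "0 < \<tau>M" "\<tau>M < tM" "Re (M \<tau>M) = s" "\<And>t. t \<in> {\<tau>M..1} \<Longrightarrow> s \<le> Re (M t)"
  proof (rule last_crossing_of_level[of "\<lambda>t. Re (M t)" tM s])
    show "s < Re (M t)" if "t \<in> {tM..1}" for t using mM[OF that] s by simp
  qed (use M limM tM in \<open>auto intro!: continuous_on_Re\<close>)
  have "Im (L \<tau>L) < Im (M \<tau>M) \<longleftrightarrow> Im (L tL) < Im (M tM)"
    using \<tau>L \<tau>M tL tM s disj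
    by (intro order_across_strip[of \<tau>L tL L \<tau>M tM M s r])
       (auto intro: continuous_on_subset[OF L] continuous_on_subset[OF M])
  moreover have "Im (L \<tau>L) < Im (M \<tau>M) \<longleftrightarrow> Im (L 1) < Im (M 1)"
    using \<tau>L \<tau>M tL tM s rb disj Lb Mb
    by (intro order_across_strip[of \<tau>L 1 L \<tau>M 1 M s b])
       (auto intro: continuous_on_subset[OF L] continuous_on_subset[OF M])
  ultimately show ?thesis using less by simp
qed

text \<open>The hitting times form a closed set, so the infimum in \<open>first_hit\<close> is
  attained. By the intermediate value theorem a hit precedes or equals every time at distance at
  least \<open>r\<close>; hence the first one is at most \<open>t1\<close> and all earlier points
  are closer.\<close>

lemma first_hitE:
  assumes g: "path g" and r: "0 < r" "r \<le> dist (g 0) (g t1)" "t1 \<in> {0..1}"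
  obtains t where "t \<in> {0<..t1}" "first_hit (g 0) r g = g t" "dist (g 0) (g t) = r"
    "\<And>s. s \<in> {0..<t} \<Longrightarrow> dist (g 0) (g s) < r"
proof -
  define A where "A = {t \<in> {0..1}. dist (g 0) (g t) = r}"
  have c: "continuous_on {0..1} (\<lambda>t. dist (g 0) (g t))"
    using g unfolding path_def by (intro continuous_intros)
  have "closed A"
    unfolding A_def using continuous_closed_preimage_constant[OF c] by simp
  moreover have "bounded A" unfolding A_def by (rule bounded_subset[of "{0..1}"]) auto
  ultimately have "compact A" by (simp add: compact_eq_bounded_closed)
  have hit: "\<exists>x\<in>A. x \<le> t" if "t \<in> {0..1}" "r \<le> dist (g 0) (g t)" for t
    using IVT'[of "\<lambda>t. dist (g 0) (g t)" 0 r t] that r continuous_on_subset[OF c, of "{0..t}"]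
    by (force simp: A_def)
  then have "A \<noteq> {}" using r(2,3) by blast
  define t where "t = Inf A"
  have bdd: "bdd_below A" by (rule bdd_belowI[of _ 0]) (auto simp: A_def)
  have tA: "t \<in> A"
    unfolding t_def using \<open>closed A\<close> \<open>A \<noteq> {}\<close> bdd by (simp add: closed_contains_Inf)
  have min: "t \<le> x" if "x \<in> A" for x unfolding t_def using bdd that by (rule cInf_lower[rotated])
  show ?thesis
  proof
    show "t \<in> {0<..t1}"
      using tA r(1) hit[OF r(3,2)] min by (force simp: A_def order_less_le)
    show "first_hit (g 0) r g = g t"
      unfolding first_hit_def t_def A_def ..
    show "dist (g 0) (g t) = r" using tA by (auto simp: A_def)
    show "dist (g 0) (g s) < r" if "s \<in> {0..<t}" for s
      using hit[of s] min that tA by (force simp: A_def)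
  qed
qed

text \<open>The half-open interval is contractible, so a logarithm exists along it; a multiple of 2
  pi i adjusts the imaginary part at \<open>t0\<close> to the given angle. The lift turns circles
  around \<open>P 0\<close> into vertical lines and pushes \<open>P 0\<close> itself to minus
  infinity.\<close>

lemma logarithm_along_path:
  fixes P :: "real \<Rightarrow> complex"
  assumes P: "path P" "\<And>t. t \<in> {0<..1} \<Longrightarrow> P t \<noteq> P 0" and t0: "t0 \<in> {0<..1}"
    and \<theta>: "P t0 - P 0 = rcis (dist (P 0) (P t0)) \<theta>"
  obtains L where "continuous_on {0<..1} L" "\<And>t. t \<in> {0<..1} \<Longrightarrow> P t - P 0 = exp (L t)"
    "\<And>t. t \<in> {0<..1} \<Longrightarrow> Re (L t) = ln (dist (P 0) (P t))"
    "filterlim (\<lambda>t. Re (L t)) at_bot (at_right 0)" "Im (L t0) = \<theta>"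
proof -
  have cP: "continuous_on {0..1} P" using P(1) by (simp add: path_def)
  have "continuous_on {0<..1} (\<lambda>t. P t - P 0)"
    by (intro continuous_intros continuous_on_subset[OF cP]) auto
  moreover have "contractible {0<..1::real}" by (simp add: convex_imp_contractible)
  ultimately obtain K where K: "continuous_on {0<..1} K" "\<And>t. t \<in> {0<..1} \<Longrightarrow> P t - P 0 = exp (K t)"
  proof (rule continuous_logarithm_on_contractible)
    show "P t - P 0 \<noteq> 0" if "t \<in> {0<..1}" for t using P(2)[OF that] by simp
  qed (blast intro: that)
  have "exp (K t0) = exp (Complex (ln (dist (P 0) (P t0))) \<theta>)"
    using K(2)[OF t0] \<theta> P(2)[OF t0] by (simp add: exp_eq_polar rcis_def)
  then obtain n :: int where n: "Complex (ln (dist (P 0) (P t0))) \<theta> = K t0 + (of_int (2 * n) * pi) * \<i>"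
    by (metis exp_eq)
  define L where "L t = K t + (of_int (2 * n) * pi) * \<i>" for t
  have "exp ((of_int (2 * n) * pi) * \<i>) = 1"
    by (metis add_0 exp_eq exp_zero)
  then have expL: "exp (L t) = exp (K t)" for t by (simp add: L_def exp_add)
  have ReL: "Re (L t) = ln (dist (P 0) (P t))" if "t \<in> {0<..1}" for t
  proof -
    have "dist (P 0) (P t) = norm (P t - P 0)" by (simp add: dist_norm norm_minus_commute)
    also have "\<dots> = exp (Re (L t))" using K(2)[OF that] expL[of t] by (metis norm_exp_eq_Re)
    finally show ?thesis by simp
  qed
  have "continuous (at 0 within {0..1}) (\<lambda>t. dist (P 0) (P t))"
    using cP by (intro continuous_intros) (auto simp: continuous_on_eq_continuous_within)
  then have "((\<lambda>t. dist (P 0) (P t)) \<longlongrightarrow> 0) (at 0 within {0..1})"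
    by (simp add: continuous_within)
  then have "((\<lambda>t. dist (P 0) (P t)) \<longlongrightarrow> 0) (at_right 0)"
    by (simp add: at_within_Icc_at_right)
  have ev: "eventually (\<lambda>t::real. t \<in> {0<..<1}) (at_right 0)"
    by (rule eventually_at_right_real) simp
  then have "eventually (\<lambda>t. 0 < dist (P 0) (P t)) (at_right 0)"
    by (rule eventually_mono) (use P(2) in fastforce)
  with \<open>((\<lambda>t. dist (P 0) (P t)) \<longlongrightarrow> 0) (at_right 0)\<close>
  have "filterlim (\<lambda>t. dist (P 0) (P t)) (at_right 0) (at_right 0)"
    by (rule tendsto_imp_filterlim_at_right)
  then have "filterlim (\<lambda>t. ln (dist (P 0) (P t))) at_bot (at_right 0)"
    by (rule filterlim_compose[OF ln_at_0])
  then have lim: "filterlim (\<lambda>t. Re (L t)) at_bot (at_right 0)"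
    by (rule filterlim_cong[THEN iffD1, rotated -1, OF _ refl refl])
       (use ev in eventually_elim, simp add: ReL)
  show ?thesis
  proof (rule that[of L])
    show "continuous_on {0<..1} L" unfolding L_def by (intro continuous_intros K)
    show "Im (L t0) = \<theta>" using n by (simp add: L_def complex_eq_iff)
  qed (use K(2) expL ReL lim in auto)
qed

text \<open>Three arcs from \<open>u\<close> are lifted along the logarithm centred at \<open>u\<close>. The order of the lifts at the
  first hits of a small circle is the order at their last hits of an even smaller circle, and this is
  the order at their ends, both times by Fashoda's theorem in a strip.\<close>

lemma cyclic_order_at_centre_eq_at_ends:
  fixes P Q W :: "real \<Rightarrow> complex"
  assumes path: "path P" "path Q" "path W" and start: "P 0 = u" "Q 0 = u" "W 0 = u"
    and ne: "\<And>t. t \<in> {0<..1} \<Longrightarrow> P t \<noteq> u \<and> Q t \<noteq> u \<and> W t \<noteq> u"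
    and le: "\<And>t. t \<in> {0<..1} \<Longrightarrow> dist u (P t) \<le> \<rho> \<and> dist u (Q t) \<le> \<rho> \<and> dist u (W t) \<le> \<rho>"
    and ends: "dist u (P 1) = \<rho>" "dist u (Q 1) = \<rho>" "dist u (W 1) = \<rho>"
    and disj: "\<And>s t. s \<in> {0<..1} \<Longrightarrow> t \<in> {0<..1} \<Longrightarrow> P s \<noteq> Q t \<and> P s \<noteq> W t \<and> Q s \<noteq> W t"
    and r: "0 < r" "r < \<rho>"
    and ccw: "0 < Arg2pi ((first_hit u r Q - u) / (first_hit u r P - u))"
      "Arg2pi ((first_hit u r Q - u) / (first_hit u r P - u))
        < Arg2pi ((first_hit u r W - u) / (first_hit u r P - u))"
  shows "Arg2pi ((Q 1 - u) / (P 1 - u)) < Arg2pi ((W 1 - u) / (P 1 - u))"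
proof -
  have hit: "\<exists>t. t \<in> {0<..1} \<and> first_hit u r X = X t \<and> dist u (X t) = r \<and>
      (\<forall>s\<in>{0<..t}. dist u (X s) \<le> r)" if X: "path X" "X 0 = u" "dist u (X 1) = \<rho>" for X
  proof -
    obtain t where "t \<in> {0<..1}" "first_hit u r X = X t" "dist u (X t) = r"
      "\<And>s. s \<in> {0..<t} \<Longrightarrow> dist u (X s) < r"
      using first_hitE[of X r 1] X r by auto
    then show ?thesis by (intro exI[of _ t]) (force simp: order_le_less)
  qed
  obtain tP where tP: "tP \<in> {0<..1}" "first_hit u r P = P tP" "dist u (P tP) = r"
      "\<And>s. s \<in> {0<..tP} \<Longrightarrow> dist u (P s) \<le> r" using hit[of P] path start ends by blast
  obtain tQ where tQ: "tQ \<in> {0<..1}" "first_hit u r Q = Q tQ" "dist u (Q tQ) = r"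
      "\<And>s. s \<in> {0<..tQ} \<Longrightarrow> dist u (Q s) \<le> r" using hit[of Q] path start ends by blast
  obtain tW where tW: "tW \<in> {0<..1}" "first_hit u r W = W tW" "dist u (W tW) = r"
      "\<And>s. s \<in> {0<..tW} \<Longrightarrow> dist u (W s) \<le> r" using hit[of W] path start ends by blast
  define a where "a = Arg2pi (P tP - u)"
  define b where "b = Arg2pi ((Q tQ - u) / (P tP - u))"
  define c where "c = Arg2pi ((W tW - u) / (P tP - u))"
  have bc: "0 < b" "b < c" "c < 2 * pi"
    using ccw unfolding b_def c_def tP(2) tQ(2) tW(2) by (auto simp: Arg2pi_lt_2pi)
  have pol: "z = rcis (norm z) (Arg2pi z)" for z
    using Arg2pi_eq[of z] by (simp add: rcis_def cis_conv_exp)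
  have dn: "dist u x = norm (x - u)" for x by (simp add: dist_norm norm_minus_commute)
  have P0: "P tP - u \<noteq> 0" using tP ne by auto
  have eP: "P tP - u = rcis (dist u (P tP)) a"
    unfolding a_def dn by (rule pol)
  have mult: "X - u = rcis (dist u X) (a + Arg2pi ((X - u) / (P tP - u)))" for X
  proof -
    have "X - u = (P tP - u) * ((X - u) / (P tP - u))" using P0 by simp
    also have "\<dots> = rcis (dist u (P tP)) a * rcis (norm ((X - u) / (P tP - u))) (Arg2pi ((X - u) / (P tP - u)))"
      using eP pol by metis
    also have "\<dots> = rcis (dist u (P tP) * norm ((X - u) / (P tP - u))) (a + Arg2pi ((X - u) / (P tP - u)))"
      by (simp add: rcis_mult)
    also have "dist u (P tP) * norm ((X - u) / (P tP - u)) = dist u X"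
      using P0 by (simp add: dn norm_divide)
    finally show ?thesis .
  qed
  obtain L where L: "continuous_on {0<..1} L" "\<And>t. t \<in> {0<..1} \<Longrightarrow> P t - u = exp (L t)"
    "\<And>t. t \<in> {0<..1} \<Longrightarrow> Re (L t) = ln (dist u (P t))"
    "filterlim (\<lambda>t. Re (L t)) at_bot (at_right 0)" "Im (L tP) = a"
    using logarithm_along_path[of P tP a] path start ne tP eP by metis
  obtain M where M: "continuous_on {0<..1} M" "\<And>t. t \<in> {0<..1} \<Longrightarrow> Q t - u = exp (M t)"
    "\<And>t. t \<in> {0<..1} \<Longrightarrow> Re (M t) = ln (dist u (Q t))"
    "filterlim (\<lambda>t. Re (M t)) at_bot (at_right 0)" "Im (M tQ) = a + b"
    using logarithm_along_path[of Q tQ "a + b"] path start ne tQ mult[of "Q tQ"] unfolding b_def by metis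
  obtain N where N: "continuous_on {0<..1} N" "\<And>t. t \<in> {0<..1} \<Longrightarrow> W t - u = exp (N t)"
    "\<And>t. t \<in> {0<..1} \<Longrightarrow> Re (N t) = ln (dist u (W t))"
    "filterlim (\<lambda>t. Re (N t)) at_bot (at_right 0)" "Im (N tW) = a + c"
    using logarithm_along_path[of W tW "a + c"] path start ne tW mult[of "W tW"] unfolding c_def by metis
  \<comment> \<open>This is the first lift one turn higher. Keeping the third lift below it confines
    the ends to a single turn, so that the height differences there are the values of
    \<open>Arg2pi\<close>.\<close>
  define L' where "L' t = L t + 2 * pi * \<i>" for t
  have L': "continuous_on {0<..1} L'" "\<And>t. t \<in> {0<..1} \<Longrightarrow> P t - u = exp (L' t)"
    "\<And>t. t \<in> {0<..1} \<Longrightarrow> Re (L' t) = ln (dist u (P t))"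
    "filterlim (\<lambda>t. Re (L' t)) at_bot (at_right 0)" "Im (L' tP) = a + 2 * pi"
    using L by (auto simp: L'_def exp_add intro!: continuous_intros)
  have pos: "0 < dist u (P t)" "0 < dist u (Q t)" "0 < dist u (W t)" if "t \<in> {0<..1}" for t
    using ne[OF that] by auto
  have lnle: "ln (dist u (P t)) \<le> ln \<rho>" "ln (dist u (Q t)) \<le> ln \<rho>" "ln (dist u (W t)) \<le> ln \<rho>"
    if "t \<in> {0<..1}" for t using le[OF that] pos[OF that] r by auto
  have lnP: "ln (dist u (P s)) \<le> ln r" if "s \<in> {0<..tP}" for s
    using tP(1) tP(4)[OF that] pos[of s] that r by auto
  have lnQ: "ln (dist u (Q s)) \<le> ln r" if "s \<in> {0<..tQ}" for s
    using tQ(1) tQ(4)[OF that] pos[of s] that r by auto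
  have lnW: "ln (dist u (W s)) \<le> ln r" if "s \<in> {0<..tW}" for s
    using tW(1) tW(4)[OF that] pos[of s] that r by auto
  have "Im (L 1) < Im (M 1)"
  proof (rule order_from_first_hit_to_end[OF L(1) M(1) L(4) M(4), of "ln \<rho>" tP "ln r" tQ])
    show "L s \<noteq> M t" if "s \<in> {0<..1}" "t \<in> {0<..1}" for s t
      using disj[OF that] L(2)[OF that(1)] M(2)[OF that(2)] by (metis diff_add_cancel)
  qed (use L M tP tQ lnle lnP lnQ ends bc r in auto)
  moreover have "Im (M 1) < Im (N 1)"
  proof (rule order_from_first_hit_to_end[OF M(1) N(1) M(4) N(4), of "ln \<rho>" tQ "ln r" tW])
    show "M s \<noteq> N t" if "s \<in> {0<..1}" "t \<in> {0<..1}" for s t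
      using disj[OF that] M(2)[OF that(1)] N(2)[OF that(2)] by (metis diff_add_cancel)
  qed (use M N tQ tW lnle lnQ lnW ends bc r in auto)
  moreover have "Im (N 1) < Im (L' 1)"
  proof (rule order_from_first_hit_to_end[OF N(1) L'(1) N(4) L'(4), of "ln \<rho>" tW "ln r" tP])
    show "N s \<noteq> L' t" if "s \<in> {0<..1}" "t \<in> {0<..1}" for s t
      using disj[OF that(2,1)] N(2)[OF that(1)] L'(2)[OF that(2)] by (metis diff_add_cancel)
  qed (use N L' tW tP lnle lnW lnP ends bc r in auto)
  moreover have "(Q 1 - u) / (P 1 - u) = exp (M 1 - L 1)" "(W 1 - u) / (P 1 - u) = exp (N 1 - L 1)"
    using L(2)[of 1] M(2)[of 1] N(2)[of 1] by (simp_all add: exp_diff)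
  ultimately show ?thesis
    by (simp add: Arg2pi_exp L'_def)
qed

section \<open>Access arcs to a surrounding circle\<close>

text \<open>Needed for a homeomorphism whose support keeps a positive distance from the drawing; the
  open set \<open>U\<close> itself may come arbitrarily close to it.\<close>

lemma finite_subset_compact_connected:
  fixes U :: "'b::real_normed_vector set"
  assumes "finite Q" "open U" "connected U" "Q \<subseteq> U"
  obtains C where "compact C" "connected C" "Q \<subseteq> C" "C \<subseteq> U"
  using assms(1,4)
proof (induction arbitrary: thesis)
  case empty
  then show ?case by (meson compact_empty connected_empty empty_subsetI)
next
  case (insert q Q)
  then obtain C where C: "compact C" "connected C" "Q \<subseteq> C" "C \<subseteq> U" by blast
  show ?case
  proof (cases "C = {}")
    case True
    then show ?thesis using insert.prems C by (intro insert.prems(1)[of "{q}"]) auto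
  next
    case False
    then obtain c where "c \<in> C" by auto
    then obtain p where p: "path p" "path_image p \<subseteq> U" "pathstart p = c" "pathfinish p = q"
      using assms(2,3) C insert.prems(2) by (metis connected_open_path_connected insert_subset path_connected_def subsetD)
    show ?thesis
    proof (rule insert.prems(1)[of "C \<union> path_image p"])
      show "connected (C \<union> path_image p)"
        using C p \<open>c \<in> C\<close> pathstart_in_path_image[of p] by (intro connected_Un) auto
      show "insert q Q \<subseteq> C \<union> path_image p"
        using C p pathfinish_in_path_image[of p] by auto
    qed (use C p in \<open>auto simp: compact_Un\<close>)
  qed
qed

text \<open>Agreement near the start up to a linear change of time. Cutting by
  \<open>subpath\<close> and prolonging by \<open>+++\<close> change an arc in no other way near its
  start, and the change keeps the order of times.\<close>

definition same_germ :: "(real \<Rightarrow> complex) \<Rightarrow> (real \<Rightarrow> complex) \<Rightarrow> bool" where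
  "same_germ g h \<longleftrightarrow> (\<exists>c \<tau>. 0 < c \<and> 0 < \<tau> \<and> \<tau> \<le> 1 \<and> c * \<tau> \<le> 1 \<and> (\<forall>t\<in>{0..\<tau>}. h t = g (c * t)))"

lemma same_germ_trans:
  assumes "same_germ f g" "same_germ g h" shows "same_germ f h"
proof -
  obtain c \<tau> where 1: "0 < c" "0 < \<tau>" "\<tau> \<le> 1" "c * \<tau> \<le> 1" "\<And>t. t\<in>{0..\<tau>} \<Longrightarrow> g t = f (c * t)"
    using assms(1) unfolding same_germ_def by auto
  obtain d \<sigma> where 2: "0 < d" "0 < \<sigma>" "\<sigma> \<le> 1" "d * \<sigma> \<le> 1" "\<And>t. t\<in>{0..\<sigma>} \<Longrightarrow> h t = g (d * t)"
    using assms(2) unfolding same_germ_def by auto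
  define \<rho> where "\<rho> = min \<sigma> (\<tau> / d)"
  have \<rho>: "0 < \<rho>" "\<rho> \<le> \<sigma>" "d * \<rho> \<le> \<tau>" using 1 2 by (auto simp: \<rho>_def min_def field_simps)
  have dt: "d * t \<in> {0..\<tau>}" if "t \<in> {0..\<rho>}" for t
  proof -
    have "d * t \<le> d * \<rho>" using that 2(1) by (intro mult_left_mono) auto
    then have "d * t \<le> \<tau>" using \<rho>(3) by (rule order_trans)
    then show ?thesis using that 2(1) by auto
  qed
  have "c * (d * \<rho>) \<le> c * \<tau>" using 1(1) \<rho>(3) by simp
  then have "c * d * \<rho> \<le> 1" using 1(4) by (simp only: mult.assoc)
  moreover have "h t = f (c * d * t)" if "t \<in> {0..\<rho>}" for t
    using 1(5)[OF dt[OF that]] 2(5)[of t] that \<rho>(2) by (simp add: mult.assoc)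
  ultimately show ?thesis
    unfolding same_germ_def using 1(1) 2 \<rho>
    by (rule_tac exI[of _ "c * d"], rule_tac exI[of _ \<rho>]) auto
qed

lemma same_germ_subpath: "0 < u \<Longrightarrow> u \<le> 1 \<Longrightarrow> same_germ g (subpath 0 u g)"
  unfolding same_germ_def by (intro exI[of _ u] exI[of _ 1]) (auto simp: subpath_def)

lemma same_germ_join: "same_germ g (g +++ h)"
  unfolding same_germ_def by (intro exI[of _ 2] exI[of _ "1/2"]) (auto simp: joinpaths_def)

text \<open>For radii below the distance reached at the end of the common piece, both first hits
  fall on that piece, where the change of time is increasing. So \<open>ccw_at\<close> cannot
  distinguish arcs with the same germ.\<close>

lemma first_hit_same_germ:
  assumes g: "arc g" and h: "path h" and same: "same_germ g h"
  shows "eventually (\<lambda>r. first_hit (g 0) r h = first_hit (g 0) r g) (at_right 0)"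
proof -
  obtain c \<tau> where c: "0 < c" "0 < \<tau>" "\<tau> \<le> 1" "c * \<tau> \<le> 1" "\<And>t. t\<in>{0..\<tau>} \<Longrightarrow> h t = g (c * t)"
    using same unfolding same_germ_def by auto
  have h0: "h 0 = g 0" using c by auto
  define \<rho> where "\<rho> = dist (g 0) (g (c * \<tau>))"
  have "g 0 \<noteq> g (c * \<tau>)"
    using g c unfolding arc_def by (auto dest!: inj_onD[of g _ 0 "c * \<tau>"])
  then have "\<rho> > 0" by (simp add: \<rho>_def)
  have "first_hit (g 0) r h = first_hit (g 0) r g" if r: "r \<in> {0<..<\<rho>}" for r
  proof -
    obtain t where t: "t \<in> {0<..c * \<tau>}" "first_hit (g 0) r g = g t" "dist (g 0) (g t) = r"
      "\<And>s. s \<in> {0..<t} \<Longrightarrow> dist (g 0) (g s) < r"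
      using first_hitE[of g r "c * \<tau>"] g r c by (auto simp: \<rho>_def arc_imp_path)
    obtain t' where t': "t' \<in> {0<..\<tau>}" "first_hit (h 0) r h = h t'" "dist (h 0) (h t') = r"
      "\<And>s. s \<in> {0..<t'} \<Longrightarrow> dist (h 0) (h s) < r"
      using first_hitE[of h r \<tau>] h r c h0 by (auto simp: \<rho>_def)
    have "\<not> c * t' < t"
    proof
      assume "c * t' < t"
      then have "dist (g 0) (g (c * t')) < r" using t(4)[of "c * t'"] t'(1) c by auto
      then show False using t' c h0 by auto
    qed
    moreover have "\<not> t / c < t'"
    proof
      assume "t / c < t'"
      moreover have "h (t / c) = g t" using t c by (auto simp: field_simps)
      ultimately show False using t'(4)[of "t / c"] t c h0 by auto
    qed
    ultimately have "c * t' = t" using c by (simp add: field_simps)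
    then show ?thesis using t t' c h0 by auto
  qed
  moreover have "eventually (\<lambda>r. r \<in> {0<..<\<rho>}) (at_right 0)"
    using \<open>\<rho> > 0\<close> by (rule eventually_at_right_real)
  ultimately show ?thesis by (auto elim: eventually_mono)
qed

lemma first_entry_time:
  assumes s: "path s" and F: "closed F" and "s 0 \<notin> F" "s 1 \<in> F"
  obtains \<tau> where "0 < \<tau>" "\<tau> \<le> (1::real)" "s \<tau> \<in> F" "\<And>t. t \<in> {0..<\<tau>} \<Longrightarrow> s t \<notin> F"
proof -
  have "closed ({0..1} \<inter> s -` F)"
    using s F unfolding path_def by (intro continuous_closed_preimage) auto
  then have "compact ({0..1} \<inter> s -` F)"
    by (metis Int_lower1 bounded_closed_interval bounded_subset compact_eq_bounded_closed)
  moreover have "1 \<in> {0..1} \<inter> s -` F" using assms by auto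
  ultimately obtain \<tau> where \<tau>: "\<tau> \<in> {0..1} \<inter> s -` F"
    and min: "\<And>t. t \<in> {0..1} \<inter> s -` F \<Longrightarrow> \<tau> \<le> t"
    using compact_attains_inf[of "{0..1} \<inter> s -` F"] by blast
  show ?thesis
  proof (rule that[of \<tau>])
    show "0 < \<tau>" using \<tau> assms(3) by (cases "\<tau> = 0") auto
    show "s t \<notin> F" if "t \<in> {0..<\<tau>}" for t using min[of t] that \<tau> by auto
  qed (use \<tau> in auto)
qed

text \<open>A homeomorphism supported in the outer face and away from \<open>D\<close> moves the outside of a large disc so
  that it touches all access arcs; cutting the arcs there and moving everything back yields disjoint
  arcs to the boundary circle.\<close>

lemma access_arcs_to_circle:
  fixes s :: "'v \<Rightarrow> real \<Rightarrow> complex" and D :: "complex set"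
  assumes V: "finite V" and D: "compact D"
    and s: "\<And>v. v \<in> V \<Longrightarrow> arc (s v)" "\<And>v. v \<in> V \<Longrightarrow> pathstart (s v) \<in> D"
      "\<And>v. v \<in> V \<Longrightarrow> pathfinish (s v) \<in> outside D"
    and disj: "\<And>v w. v \<in> V \<Longrightarrow> w \<in> V \<Longrightarrow> v \<noteq> w \<Longrightarrow> path_image (s v) \<inter> path_image (s w) = {}"
  obtains R k where "R > 0" "D \<subseteq> ball 0 R"
    "\<And>v. v \<in> V \<Longrightarrow> arc (k v)" "\<And>v. v \<in> V \<Longrightarrow> pathstart (k v) = pathstart (s v)"
    "\<And>v. v \<in> V \<Longrightarrow> norm (pathfinish (k v)) = R"
    "\<And>v t. v \<in> V \<Longrightarrow> t \<in> {0..<1} \<Longrightarrow> norm (k v t) < R"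
    "\<And>v. v \<in> V \<Longrightarrow> path_image (k v) \<inter> D \<subseteq> path_image (s v)"
    "\<And>v. v \<in> V \<Longrightarrow> same_germ (s v) (k v)"
    "\<And>v w. v \<in> V \<Longrightarrow> w \<in> V \<Longrightarrow> v \<noteq> w \<Longrightarrow> path_image (k v) \<inter> path_image (k w) = {}"
proof -
  obtain R where R: "R > 0" "D \<subseteq> ball 0 R"
    using D by (meson bounded_subset_ballD compact_imp_bounded)
  define far where "far = {z::complex. R \<le> norm z}"
  have far_out: "far \<subseteq> outside D"
    using outside_subset_convex[OF convex_ball R(2)] by (auto simp: far_def)
  have "infinite (sphere (0::complex) R)"
  proof
    assume "finite (sphere (0::complex) R)"
    then have "finite ((\<lambda>t. of_real R * cis t) ` {0..1})"
      by (rule finite_subset[rotated]) (use R(1) in \<open>auto simp: norm_mult\<close>)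
    moreover have "inj_on (\<lambda>t. of_real R * cis t) {0..1}"
    proof (rule inj_onI)
      fix x y :: real assume xy: "x \<in> {0..1}" "y \<in> {0..1}" "of_real R * cis x = of_real R * cis y"
      then have "Arg2pi (cis x) = Arg2pi (cis y)" using R(1) by simp
      moreover have "Arg2pi (cis z) = z" if "z \<in> {0..1}" for z
        using that pi_gt3 by (intro Arg2pi_unique[of 1]) (auto simp: cis_conv_exp)
      ultimately show "x = y" using xy by auto
    qed
    ultimately show False using finite_imageD[of _ "{0..1::real}"] infinite_Icc[of 0 "1::real"] by auto
  qed
  then obtain T where T: "T \<subseteq> sphere (0::complex) R" "card T = card V" "finite T"
    using infinite_arbitrarily_large by metis
  then obtain y where y: "bij_betw y V T"
    using V by (metis finite_same_card_bij)
  define q where "q v = pathfinish (s v)" for v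
  have y_far: "y v \<in> far" if "v \<in> V" for v
    using y T(1) that by (auto simp: bij_betw_def far_def)
  have oU: "open (outside D)" "connected (outside D)"
    using D by (auto intro: open_outside compact_imp_closed connected_outside compact_imp_bounded)
  \<comment> \<open>The additional point keeps the connected set \<open>C\<close> non-empty when
    there are no vertices.\<close>
  have Q: "insert (of_real R) (q ` V \<union> y ` V) \<subseteq> outside D"
    using s(3) y_far far_out R(1) by (auto simp: q_def far_def)
  obtain C where C: "compact C" "connected C" "insert (of_real R) (q ` V \<union> y ` V) \<subseteq> C" "C \<subseteq> outside D"
    using finite_subset_compact_connected[OF _ oU Q] V by auto
  have "C \<inter> D = {}" using C(4) outside_no_overlap by blast
  then obtain \<eta> where \<eta>: "\<eta> > 0" "\<And>x z. x \<in> C \<Longrightarrow> z \<in> D \<Longrightarrow> \<eta> \<le> dist x z"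
    using separate_compact_closed[OF C(1) compact_imp_closed[OF D]] by auto
  \<comment> \<open>The thickening of \<open>C\<close> by half its distance bound to
    \<open>D\<close>. A homeomorphism supported here is the identity near every point of
    \<open>D\<close>.\<close>
  define S where "S = {x + z |x z. x \<in> C \<and> z \<in> ball 0 (\<eta>/2)}"
  have S: "open S" "connected S" "C \<subseteq> S"
  proof -
    have "S = (\<Union>x\<in>C. \<Union>z\<in>ball 0 (\<eta>/2). {x + z})" unfolding S_def by blast
    then show "open S" using open_sums[of C "ball 0 (\<eta>/2)"] by simp
    have "S = (\<lambda>p. fst p + snd p) ` (C \<times> ball 0 (\<eta>/2))" unfolding S_def by force
    then show "connected S"
      using C(2) by (auto intro!: connected_continuous_image continuous_intros connected_Times)
    show "C \<subseteq> S" unfolding S_def using \<eta>(1) by force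
  qed
  have S_away: "x \<notin> S" if "z \<in> D" "dist x z < \<eta>/2" for x z
  proof
    assume "x \<in> S"
    then obtain c w where cw: "c \<in> C" "norm w < \<eta>/2" "x = c + w" by (auto simp: S_def)
    have "\<eta> \<le> dist c z" using \<eta>(2) cw that by blast
    also have "\<dots> \<le> dist c x + dist x z" by (rule dist_triangle)
    also have "dist c x = norm w" using cw by (simp add: dist_norm)
    finally show False using cw that by simp
  qed
  have aff: "affine hull S = UNIV"
    using S C(3) by (intro affine_hull_open) auto
  have pw: "pairwise (\<lambda>v w. y v \<noteq> y w \<and> q v \<noteq> q w) V"
  proof (rule pairwiseI)
    fix v w assume vw: "v \<in> V" "w \<in> V" "v \<noteq> w"
    have "q v \<noteq> q w"
      using disj[OF vw] pathfinish_in_path_image[of "s v"] pathfinish_in_path_image[of "s w"]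
      by (auto simp: q_def)
    then show "y v \<noteq> y w \<and> q v \<noteq> q w"
      using y vw by (auto simp: bij_betw_def inj_on_def)
  qed
  have ys: "\<And>v. v \<in> V \<Longrightarrow> y v \<in> S \<and> q v \<in> S" using C(3) S(3) by auto
  \<comment> \<open>\<open>f\<close> moves the circle points \<open>y v\<close> to the ends
    \<open>q v\<close> of the access arcs, so the image of \<open>far\<close> under \<open>f\<close>
    touches every arc. Its inverse \<open>g\<close> then brings the arcs, cut at their first entry,
    to the circle.\<close>
  obtain f g where fg: "homeomorphism UNIV UNIV f g" "\<And>v. v \<in> V \<Longrightarrow> f (y v) = q v"
      "{x. \<not> (f x = x \<and> g x = x)} \<subseteq> S"
    by (rule homeomorphism_moving_points_exists[OF _ S(1,2) subset_UNIV V ys pw subset_UNIV _ S(2)])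
      (use aff in auto)
  have gf: "g (f x) = x" "f (g x) = x" and cg: "continuous_on A g" for x A
    using fg(1) by (auto simp: homeomorphism_def intro: continuous_on_subset)
  have g_inj: "g a = g b \<longleftrightarrow> a = b" for a b using gf by metis
  have fix_: "f x = x" "g x = x" if "x \<notin> S" for x using fg(3) that by auto
  have D_S: "x \<notin> S" if "x \<in> D" for x using S_away[of x x] that \<eta>(1) by simp
  have "isCont g x" for x using cg[of UNIV] by (simp add: continuous_on_eq_continuous_at)
  moreover have "closed far" unfolding far_def by (intro closed_Collect_le continuous_intros)
  ultimately have F: "closed (g -` far)" by (intro continuous_closed_vimage) auto
  have "\<exists>\<tau>. 0 < \<tau> \<and> \<tau> \<le> 1 \<and> s v \<tau> \<in> g -` far \<and> (\<forall>t\<in>{0..<\<tau>}. s v t \<notin> g -` far)"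
    if v: "v \<in> V" for v
  proof -
    have "s v 0 \<notin> g -` far"
      using s(2)[OF v] fix_(2)[OF D_S] R(2) by (fastforce simp: pathstart_def far_def)
    moreover have "s v 1 \<in> g -` far"
      using fg(2)[OF v] gf y_far[OF v] by (metis pathfinish_def q_def vimage_eq)
    ultimately show ?thesis
      using first_entry_time[OF arc_imp_path[OF s(1)[OF v]] F] by metis
  qed
  then obtain \<tau> where \<tau>: "\<And>v. v \<in> V \<Longrightarrow> 0 < \<tau> v" "\<And>v. v \<in> V \<Longrightarrow> \<tau> v \<le> 1"
      "\<And>v. v \<in> V \<Longrightarrow> g (s v (\<tau> v)) \<in> far" "\<And>v t. v \<in> V \<Longrightarrow> t \<in> {0..<\<tau> v} \<Longrightarrow> g (s v t) \<notin> far"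
    by (metis vimage_eq)
  define k where "k v = g \<circ> subpath 0 (\<tau> v) (s v)" for v
  have k: "k v t = g (s v (\<tau> v * t))" for v t by (simp add: k_def subpath_def)
  have im: "path_image (k v) \<subseteq> g ` path_image (s v)" if v: "v \<in> V" for v
    unfolding k_def path_image_compose using \<tau>(1,2)[OF v]
    by (intro image_mono path_image_subpath_subset) auto
  have arck: "arc (k v)" if v: "v \<in> V" for v
  proof -
    have "arc (subpath 0 (\<tau> v) (s v))"
      using s(1)[OF v] \<tau>(1,2)[OF v] by (intro arc_subpath_arc) auto
    then show ?thesis
      unfolding k_def arc_def using cg by (auto simp: inj_on_def g_inj intro: path_continuous_image)
  qed
  have less: "norm (k v t) < R" if "v \<in> V" "t \<in> {0..<1}" for v t
    using \<tau>(4)[OF that(1), of "\<tau> v * t"] \<tau>(1)[OF that(1)] that(2) by (auto simp: k far_def not_le)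
  have start: "pathstart (k v) = pathstart (s v)" if "v \<in> V" for v
    using fix_(2)[OF D_S[OF s(2)[OF that]]] by (simp add: pathstart_def k)
  show ?thesis
  proof (rule that[of R k])
    fix v assume v: "v \<in> V"
    show "arc (k v)" by (rule arck[OF v])
    show "pathstart (k v) = pathstart (s v)" by (rule start[OF v])
    show "norm (k v t) < R" if "t \<in> {0..<1}" for t by (rule less[OF v that])
    show "norm (pathfinish (k v)) = R"
    proof (rule antisym)
      show "R \<le> norm (pathfinish (k v))" using \<tau>(3)[OF v] by (simp add: pathfinish_def k far_def)
      have "continuous_on {0..1} (\<lambda>t. norm (k v t))"
        using arck[OF v] by (intro continuous_intros) (auto simp: arc_def path_def)
      moreover have "closure {0..<1::real} = {0..1}" by simp
      ultimately show "norm (pathfinish (k v)) \<le> R"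
        using continuous_le_on_closure[of "{0..<1}" "\<lambda>t. norm (k v t)" 1 R] less[OF v]
        by (auto simp: pathfinish_def less_imp_le)
    qed
    show "path_image (k v) \<inter> D \<subseteq> path_image (s v)"
    proof
      fix x assume x: "x \<in> path_image (k v) \<inter> D"
      then obtain z where z: "z \<in> path_image (s v)" "x = g z" using im[OF v] by auto
      have "g x = x" using fix_ D_S x by auto
      then show "x \<in> path_image (s v)" using z g_inj by metis
    qed
    have "same_germ (subpath 0 (\<tau> v) (s v)) (k v)"
    proof -
      have "continuous (at 0 within {0..1}) (k v)" and "continuous (at 0 within {0..1}) (subpath 0 (\<tau> v) (s v))"
      proof -
        show "continuous (at 0 within {0..1}) (k v)"
          using arck[OF v] by (auto simp: arc_def path_def continuous_on_eq_continuous_within)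
        have "path (subpath 0 (\<tau> v) (s v))" 
          using s(1)[OF v] \<tau>(1,2)[OF v] by (intro path_subpath) (auto simp: arc_imp_path)
        then show "continuous (at 0 within {0..1}) (subpath 0 (\<tau> v) (s v))"
          by (auto simp: path_def continuous_on_eq_continuous_within)
      qed
      \<comment> \<open>For short times the arc is within \<eta>/2 of its start in \<open>D\<close>,
        hence off the support, and \<open>g\<close> does not move it.\<close>
      then obtain d where d: "d > 0" 
        "\<And>t. t \<in> {0..1} \<Longrightarrow> dist t 0 < d \<Longrightarrow> 
            dist (subpath 0 (\<tau> v) (s v) t) (subpath 0 (\<tau> v) (s v) 0) < \<eta>/2"
        using \<eta>(1) unfolding continuous_within_eps_delta by (metis half_gt_zero)
      define e where "e = min 1 (d/2)"
      have "k v t = subpath 0 (\<tau> v) (s v) t" if "t \<in> {0..e}" for t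
      proof -
        have "dist (subpath 0 (\<tau> v) (s v) t) (pathstart (s v)) < \<eta>/2"
          using d(2)[of t] that d(1) by (auto simp: e_def subpath_def pathstart_def dist_real_def)
        then have "subpath 0 (\<tau> v) (s v) t \<notin> S" using S_away s(2)[OF v] by blast
        then show ?thesis using fix_ by (simp add: k_def)
      qed
      then show ?thesis unfolding same_germ_def using d(1)
        by (intro exI[of _ 1] exI[of _ e]) (auto simp: e_def)
    qed
    then show "same_germ (s v) (k v)"
      using same_germ_trans[OF same_germ_subpath] \<tau>(1,2)[OF v] by blast
  next
    fix v w assume vw: "v \<in> V" "w \<in> V" "v \<noteq> w"
    have "g ` path_image (s v) \<inter> g ` path_image (s w) = {}"
      using disj[OF vw] g_inj by auto
    then show "path_image (k v) \<inter> path_image (k w) = {}" using im[OF vw(1)] im[OF vw(2)] by auto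
  qed (use R in auto)
qed

section \<open>The order of the vertices on the circle\<close>

text \<open>Removing a small open piece around an interior point of the arc leaves two arcs that hang on \<open>D\<close>,
  which do not separate by Janiszewski's theorem; so the point was on the boundary of the outer face.\<close>

lemma arc_in_outside_accessible:
  fixes g :: "real \<Rightarrow> complex"
  assumes D: "compact D" and g: "arc g" and ends: "g 0 \<in> D" "g 1 \<in> D"
    and inner: "\<And>t. t \<in> {0<..<1} \<Longrightarrow> g t \<in> outside D"
  shows "path_image g \<subseteq> closure (outside (D \<union> path_image g))"
proof -
  let ?O = "outside (D \<union> path_image g)"
  have cg: "continuous_on {0..1} g" and inj: "inj_on g {0..1}"
    using g by (auto simp: arc_def path_def)
  have cpt: "compact (D \<union> path_image g)"
    using D g by (simp add: compact_Un compact_arc_image)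
  have mid: "g t \<in> closure ?O" if t: "t \<in> {0<..<1}" for t
  proof (rule ccontr)
    assume "g t \<notin> closure ?O"
    then obtain e where e: "e > 0" "ball (g t) e \<inter> ?O = {}"
      unfolding closure_approachable by (fastforce simp: dist_commute)
    have "continuous (at t within {0..1}) g"
      using cg t by (auto simp: continuous_on_eq_continuous_within)
    then obtain d where d: "d > 0" "\<And>s. s \<in> {0..1} \<Longrightarrow> dist s t < d \<Longrightarrow> dist (g s) (g t) < e"
      using e(1) unfolding continuous_within_eps_delta by metis
    \<comment> \<open>The piece of times within \<open>m\<close> of \<open>t\<close> maps into the
      ball, and what remains on either side is still an arc.\<close>
    define m where "m = min (d/2) (min (t/2) ((1-t)/2))"
    have m: "0 < m" "m < d" "m < t" "t + m < 1" using d(1) t by (auto simp: m_def min_def field_simps)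
    have near: "g s \<in> ball (g t) e" if "s \<in> {t-m..t+m}" for s
      using d(2)[of s] that m by (auto simp: dist_commute dist_real_def)
    define A1 where "A1 = g ` {0..t-m}"
    define A2 where "A2 = g ` {t+m..1}"
    have arcs: "arc (subpath 0 (t-m) g)" "arc (subpath (t+m) 1 g)"
      using g m t by (auto intro!: arc_subpath_arc)
    have A1: "A1 = path_image (subpath 0 (t-m) g)" and A2: "A2 = path_image (subpath (t+m) 1 g)"
      using m t by (auto simp: A1_def A2_def path_image_subpath)
    have cA: "compact A1" "compact A2"
      unfolding A1 A2 using arcs by (auto intro: compact_arc_image)
    have conn: "connected (- A1)" "connected (- A2)"
      unfolding A1 A2 using arcs by (auto intro: connected_arc_complement)
    have D_inner: "g s \<notin> D" if "s \<in> {0<..<1}" for s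
      using inner[OF that] outside_no_overlap[of D] by blast
    have D1: "D \<inter> A1 = {g 0}"
    proof -
      have "s = 0" if "g s \<in> D" "s \<in> {0..t-m}" for s
        using D_inner[of s] that m t by (cases "s = 0") auto
      then show ?thesis using ends m t by (fastforce simp: A1_def)
    qed
    have D2: "(D \<union> A1) \<inter> A2 = {g 1}"
    proof -
      have "s = 1" if "g s \<in> D" "s \<in> {t+m..1}" for s
        using D_inner[of s] that m t by (cases "s = 1") auto
      moreover have "A1 \<inter> A2 = {}"
      proof (rule ccontr)
        assume "A1 \<inter> A2 \<noteq> {}"
        then obtain a b where "a \<in> {0..t-m}" "b \<in> {t+m..1}" "g a = g b"
          unfolding A1_def A2_def by auto metis
        then show False using inj_onD[OF inj, of a b] m t by auto
      qed
      ultimately show ?thesis using ends m t by (fastforce simp: A2_def)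
    qed
    obtain b where b: "b \<in> ?O"
      using unbounded_outside[OF compact_imp_bounded[OF cpt]] by (metis bounded_empty equals0I)
    have bD: "b \<in> outside D" using b outside_mono[of D "D \<union> path_image g"] by blast
    have nb: "b \<notin> A1" "b \<notin> A2"
    proof -
      have "A1 \<subseteq> path_image g" "A2 \<subseteq> path_image g" using m t by (auto simp: A1_def A2_def path_image_def)
      then show "b \<notin> A1" "b \<notin> A2" using b outside_no_overlap[of "D \<union> path_image g"] by blast+
    qed
    have nt: "g t \<notin> A1" "g t \<notin> A2"
    proof -
      have "s = t" if "s \<in> {0..1}" "g t = g s" for s
        using inj_onD[OF inj, of t s] that t by auto
      then have "s \<notin> {0..t-m} \<union> {t+m..1}" if "g t = g s" for s
        using m t that by (cases "s \<in> {0..1}") fastforce+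
      then show "g t \<notin> A1" "g t \<notin> A2" unfolding A1_def A2_def by blast+
    qed
    \<comment> \<open>Janiszewski's theorem asks for connected intersections. Here they are single
      points: \<open>g 0\<close> for \<open>D\<close> and \<open>A1\<close>, and \<open>g 1\<close>
      for their union and \<open>A2\<close>.\<close>
    have "connected_component (- D) (g t) b"
    proof -
      have "connected (outside D)" using D by (auto intro: connected_outside compact_imp_bounded)
      moreover have "outside D \<subseteq> - D" using outside_no_overlap by blast
      ultimately show ?thesis using inner[OF t] bD unfolding connected_component_def by blast
    qed
    moreover have "connected_component (- A1) (g t) b"
      using conn nb nt unfolding connected_component_def by blast
    ultimately have "connected_component (- (D \<union> A1)) (g t) b"
      using Janiszewski[OF D compact_imp_closed[OF cA(1)]] D1 by simp
    moreover have "connected_component (- A2) (g t) b"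
      using conn nb nt unfolding connected_component_def by blast
    ultimately have "connected_component (- (D \<union> A1 \<union> A2)) (g t) b"
      using Janiszewski[of "D \<union> A1" A2] D cA D2 by (simp add: compact_Un compact_imp_closed)
    then obtain Q where Q: "connected Q" "Q \<subseteq> - (D \<union> A1 \<union> A2)" "g t \<in> Q" "b \<in> Q"
      unfolding connected_component_def by blast
    have "g t \<in> D \<union> path_image g" using t by (auto simp: path_image_def)
    then have "g t \<notin> ?O" using outside_no_overlap[of "D \<union> path_image g"] by blast
    \<comment> \<open>\<open>Q\<close> joins \<open>g t\<close> to a point of the outer face and
      meets its frontier on the drawing or the arc. As it avoids \<open>D\<close>, \<open>A1\<close>
      and \<open>A2\<close>, this happens on the removed piece, inside the ball that was assumed
      free of the outer face.\<close>
    then have "Q \<inter> frontier ?O \<noteq> {}"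
      using connected_Int_frontier[OF Q(1), of ?O] Q b by blast
    then obtain z where z: "z \<in> Q" "z \<in> frontier ?O" by blast
    have "z \<in> D \<union> path_image g"
      using frontier_outside_subset[OF compact_imp_closed[OF cpt]] z by blast
    then obtain s where s: "z = g s" "s \<in> {0..1}" using z Q by (auto simp: path_image_def)
    have "z \<notin> A1" "z \<notin> A2" using z Q by auto
    then have "s \<in> {t-m..t+m}" using s by (auto simp: A1_def A2_def)
    then have "z \<in> ball (g t) e" using near s by auto
    then have "ball (g t) e \<inter> ?O \<noteq> {}"
      using z(2) open_Int_closure_eq_empty[of "ball (g t) e" ?O] by (auto simp: frontier_def)
    then show False using e by blast
  qed
  have "path_image g = g ` closure {0<..<1}" by (simp add: path_image_def)
  also have "\<dots> \<subseteq> closure ?O"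
  proof (rule image_closure_subset)
    show "continuous_on (closure {0<..<1}) g" using cg by simp
    show "g ` {0<..<1} \<subseteq> closure ?O" using mid by auto
  qed simp
  finally show ?thesis .
qed

text \<open>The ends of an arc have the unique times 0 and 1, so \<open>along\<close> between them
  is the arc or its reversal.\<close>

lemma along_arc:
  assumes g: "arc g" and "{pathstart g, pathfinish g} = {p, q}" "p \<noteq> q"
  shows "arc (along g p q)" "pathstart (along g p q) = p" "pathfinish (along g p q) = q"
    "path_image (along g p q) = path_image g"
proof -
  have inj: "inj_on g {0..1}" using g by (simp add: arc_def)
  have "inv_into {0..1} g (g 0) = 0" "inv_into {0..1} g (g 1) = 1"
    using inj by (auto intro!: inv_into_f_f)
  moreover consider "p = g 0" "q = g 1" | "p = g 1" "q = g 0"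
    using assms(2,3) by (auto simp: pathstart_def pathfinish_def doubleton_eq_iff)
  ultimately consider "along g p q = g" "p = g 0" "q = g 1"
    | "along g p q = reversepath g" "p = g 1" "q = g 0"
    by (cases) (auto simp: along_def subpath_reversepath)
  then have "arc (along g p q) \<and> pathstart (along g p q) = p \<and> pathfinish (along g p q) = q \<and>
    path_image (along g p q) = path_image g"
    using g arc_reversepath[OF g] pathstart_reversepath[of g] pathfinish_reversepath[of g]
    unfolding pathstart_def[of g] pathfinish_def[of g] by cases (auto simp: pathstart_def pathfinish_def)
  then show "arc (along g p q)" "pathstart (along g p q) = p" "pathfinish (along g p q) = q"
    "path_image (along g p q) = path_image g" by auto
qed

definition interleaved :: "('a \<Rightarrow> 'b::linorder) \<Rightarrow> 'a set \<Rightarrow> 'a set \<Rightarrow> bool" where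
  "interleaved \<rho> e f \<longleftrightarrow> (\<exists>a b c d. \<rho> a < \<rho> b \<and> \<rho> b < \<rho> c \<and> \<rho> c < \<rho> d \<and>
     (e = {a, c} \<and> f = {b, d} \<or> e = {b, d} \<and> f = {a, c}))"

lemma drawn_set_compact:
  assumes "drawing V E pos \<gamma>"
  shows "compact (drawn_set V E pos \<gamma>)"
proof -
  have "finite V" "E \<subseteq> Pow V" using assms by (auto simp: drawing_def simple_graph_def)
  then have "finite E" using finite_subset by auto
  then show ?thesis
    unfolding drawn_set_def using assms \<open>finite V\<close>
    by (intro compact_Un compact_UN) (auto simp: drawing_def intro: compact_arc_image finite_imp_compact)
qed

text \<open>An arm may meet edges at its own vertex. Interleaved edges have disjoint ends, so only
  the edges at other vertices have to be avoided, and this makes the arms easy to obtain.\<close>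

locale circle_access =
  fixes V :: "'a set" and E pos \<gamma> and R :: real and k :: "'a \<Rightarrow> real \<Rightarrow> complex"
  assumes drawing: "drawing V E pos \<gamma>"
    and R: "R > 0" "drawn_set V E pos \<gamma> \<subseteq> ball 0 R"
    and arc_k: "v \<in> V \<Longrightarrow> arc (k v)" and start_k: "v \<in> V \<Longrightarrow> pathstart (k v) = pos v"
    and finish_k: "v \<in> V \<Longrightarrow> norm (pathfinish (k v)) = R"
    and inside_k: "v \<in> V \<Longrightarrow> t \<in> {0..<1} \<Longrightarrow> norm (k v t) < R"
    and disjoint_k: "v \<in> V \<Longrightarrow> w \<in> V \<Longrightarrow> v \<noteq> w \<Longrightarrow> path_image (k v) \<inter> path_image (k w) = {}"
    and avoid_k: "v \<in> V \<Longrightarrow> e \<in> E \<Longrightarrow> v \<notin> e \<Longrightarrow> path_image (k v) \<inter> path_image (\<gamma> e) = {}"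
begin

abbreviation y :: "'a \<Rightarrow> complex" where "y v \<equiv> pathfinish (k v)"
abbreviation arm :: "'a \<Rightarrow> complex set" where "arm v \<equiv> path_image (k v)"
abbreviation line :: "'a set \<Rightarrow> complex set" where "line e \<equiv> path_image (\<gamma> e)"

text \<open>The circle is cut open at \<open>y u\<close>: the cyclic order becomes a linear one that
  starts with \<open>u\<close> at 0.\<close>

definition angle :: "'a \<Rightarrow> 'a \<Rightarrow> real" where "angle u v = Arg2pi (y v / y u)"

lemma edge_subset: "e \<in> E \<Longrightarrow> e \<subseteq> V"
  using drawing by (auto simp: drawing_def simple_graph_def)

lemma edge_ends: assumes "{u, w} \<in> E" shows "u \<in> V" "w \<in> V" "u \<noteq> w"
proof -
  have "card {u, w} = 2" "{u, w} \<subseteq> V" using drawing assms by (auto simp: drawing_def simple_graph_def)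
  then show "u \<in> V" "w \<in> V" "u \<noteq> w" by (auto simp: card_2_iff' split: if_splits)
qed

lemma y_inj: "v \<in> V \<Longrightarrow> w \<in> V \<Longrightarrow> y v = y w \<longleftrightarrow> v = w"
  using disjoint_k[of v w] pathfinish_in_path_image[of "k v"] pathfinish_in_path_image[of "k w"] by fastforce

lemma pos_inj: "v \<in> V \<Longrightarrow> w \<in> V \<Longrightarrow> pos v = pos w \<longleftrightarrow> v = w"
  using drawing by (auto simp: drawing_def inj_on_def)

lemma y_nonzero: "v \<in> V \<Longrightarrow> y v \<noteq> 0"
  using finish_k[of v] R(1) by auto

lemma path_image_k: "v \<in> V \<Longrightarrow> z \<in> arm v \<Longrightarrow> norm z \<le> R \<and> (norm z = R \<longrightarrow> z = y v)"
proof -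
  assume v: "v \<in> V" and "z \<in> arm v"
  then obtain t where t: "t \<in> {0..1}" "z = k v t" by (auto simp: path_image_def)
  show ?thesis
    using inside_k[OF v, of t] finish_k[OF v] t by (cases "t = 1") (auto simp: pathfinish_def)
qed

lemma y_angle: assumes "u \<in> V" "v \<in> V" shows "y v = y u * cis (angle u v)"
proof -
  have "norm (y v / y u) = 1" using assms finish_k R(1) by (simp add: norm_divide)
  then have "y v / y u = cis (angle u v)"
    unfolding angle_def using complex_norm_eq_1_exp[of "y v / y u"] by (simp add: cis_conv_exp)
  then show ?thesis using y_nonzero[OF assms(1)] by (simp add: field_simps)
qed

lemma angle_bounds: "0 \<le> angle u v" "angle u v < 2 * pi"
  by (auto simp: angle_def Arg2pi_ge_0 Arg2pi_lt_2pi)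

lemma angle_inj: "u \<in> V \<Longrightarrow> v \<in> V \<Longrightarrow> w \<in> V \<Longrightarrow> angle u v = angle u w \<longleftrightarrow> v = w"
  using y_angle y_inj by metis

lemma angle_self: "u \<in> V \<Longrightarrow> angle u u = 0"
  using y_nonzero by (simp add: angle_def Arg2pi_eq_0)

lemma edge_arc:
  assumes "{u, w} \<in> E"
  defines "a \<equiv> along (\<gamma> {u, w}) (pos u) (pos w)"
  shows "arc a" "pathstart a = pos u" "pathfinish a = pos w" "path_image a = line {u, w}"
proof -
  have 1: "arc (\<gamma> {u, w})" "{pathstart (\<gamma> {u, w}), pathfinish (\<gamma> {u, w})} = {pos u, pos w}"
    using drawing assms(1) by (auto simp: drawing_def)
  have 2: "pos u \<noteq> pos w" using edge_ends[OF assms(1)] pos_inj by blast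
  show "arc a" "pathstart a = pos u" "pathfinish a = pos w" "path_image a = line {u, w}"
    unfolding a_def using along_arc[OF 1 2] by auto
qed

lemma edge_in_ball: "e \<in> E \<Longrightarrow> line e \<subseteq> ball 0 R"
  using R(2) by (auto simp: drawn_set_def)

lemma pos_on_edge: "v \<in> V \<Longrightarrow> e \<in> E \<Longrightarrow> pos v \<in> line e \<Longrightarrow> v \<in> e"
  using drawing unfolding drawing_def by blast

text \<open>The path runs along the arm of \<open>u\<close> inwards, the edge, and the arm of
  \<open>w\<close> outwards. It need not be simple, since only its continuity and its ends on the
  circle matter.\<close>

lemma chord:
  assumes "{u, w} \<in> E"
  obtains f where "path f" "pathstart f = y u" "pathfinish f = y w"
    "path_image f = arm u \<union> line {u, w} \<union> arm w"
proof
  let ?a = "along (\<gamma> {u, w}) (pos u) (pos w)"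
  let ?f = "reversepath (k u) +++ ?a +++ k w"
  have uw: "u \<in> V" "w \<in> V" using edge_ends[OF assms] by auto
  note a = edge_arc[OF assms]
  show "path ?f" using uw a arc_k start_k by (auto simp: arc_imp_path)
  show "pathstart ?f = y u" "pathfinish ?f = y w" by auto
  show "path_image ?f = arm u \<union> line {u, w} \<union> arm w"
    using uw a start_k by (auto simp: path_image_join)
qed

lemma interleaved_edges_meet:
  assumes u: "u \<in> V" and e: "{a, c} \<in> E" and f: "{b, d} \<in> E"
    and less: "angle u a < angle u b" "angle u b < angle u c" "angle u c < angle u d"
  shows "line {a, c} \<inter> line {b, d} \<noteq> {}"
proof -
  have V: "a \<in> V" "b \<in> V" "c \<in> V" "d \<in> V" using edge_ends[OF e] edge_ends[OF f] by auto
  obtain p where p: "path p" "pathstart p = y a" "pathfinish p = y c"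
    "path_image p = arm a \<union> line {a, c} \<union> arm c"
    using chord[OF e] by blast
  obtain q where q: "path q" "pathstart q = y b" "pathfinish q = y d"
    "path_image q = arm b \<union> line {b, d} \<union> arm d"
    using chord[OF f] by blast
  \<comment> \<open>The circle point to be sent to infinity must avoid all four ends. As
    \<open>a\<close> may be \<open>u\<close>, it cannot be \<open>y u\<close>; it is placed before
    \<open>y u\<close> by half the gap that follows \<open>d\<close>.\<close>
  define \<beta> where "\<beta> = (2 * pi - angle u d) / 2"
  have \<beta>: "0 < \<beta>" "angle u d + \<beta> < 2 * pi"
    using angle_bounds[of u d] by (auto simp: \<beta>_def field_simps)
  define z where "z = y u * cis (- \<beta>)"
  have nz: "norm z = R" using finish_k[OF u] by (simp add: z_def norm_mult)
  have yz: "y v = z * cis (angle u v + \<beta>)" if "v \<in> V" for v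
    using y_angle[OF u that] by (simp add: z_def mult.assoc cis_mult)
  have ne: "y v \<noteq> z" if "v \<in> V" "angle u v + \<beta> < 2 * pi" for v
  proof
    assume "y v = z"
    then have "cis (angle u v + \<beta>) = 1" using yz[OF that(1)] nz R(1) by auto
    then have "Arg2pi (exp (\<i> * of_real (angle u v + \<beta>))) = 0"
      unfolding cis_conv_exp by (simp add: Arg2pi_of_real[of 1, simplified])
    then show False using Arg2pi_exp[of "\<i> * of_real (angle u v + \<beta>)"] that angle_bounds(1)[of u v] \<beta> by simp
  qed
  have nek: "arm v \<subseteq> cball 0 R - {z}" if "v \<in> V" "angle u v + \<beta> < 2 * pi" for v
    using path_image_k[OF that(1)] ne[OF that] nz by auto
  have neE: "line e \<subseteq> cball 0 R - {z}" if "e \<in> E" for e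
    using edge_in_ball[OF that] nz by (force simp: subset_iff)
  have "path_image p \<inter> path_image q \<noteq> {}"
  proof (rule chords_interlaced_meet[OF p(1) q(1) nz R(1)])
    show "path_image p \<subseteq> cball 0 R - {z}"
      using nek[of a] nek[of c] neE[OF e] V less \<beta> unfolding p(4) by (intro Un_least) auto
    show "path_image q \<subseteq> cball 0 R - {z}"
      using nek[of b] nek[of d] neE[OF f] V less \<beta> unfolding q(4) by (intro Un_least) auto
    show "pathstart p = z * cis (angle u a + \<beta>)" "pathstart q = z * cis (angle u b + \<beta>)"
      "pathfinish p = z * cis (angle u c + \<beta>)" "pathfinish q = z * cis (angle u d + \<beta>)"
      using p q yz V by auto
  qed (use less \<beta> angle_bounds(1)[of u a] in auto)
  moreover have ne4: "a \<noteq> b" "a \<noteq> d" "c \<noteq> b" "c \<noteq> d" using less by auto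
  \<comment> \<open>Each chord has three pieces. Of the nine pairs of pieces all are disjoint except
    the two edges, so the chords meet where the edges do.\<close>
  have "arm a \<inter> arm b = {}" "arm a \<inter> arm d = {}"
    "arm c \<inter> arm b = {}" "arm c \<inter> arm d = {}"
    "arm a \<inter> line {b, d} = {}" "arm c \<inter> line {b, d} = {}"
    "line {a, c} \<inter> arm b = {}" "line {a, c} \<inter> arm d = {}"
    using disjoint_k[of a b] disjoint_k[of a d] disjoint_k[of c b] disjoint_k[of c d]
      avoid_k[OF V(1) f] avoid_k[OF V(3) f] avoid_k[OF V(2) e] avoid_k[OF V(4) e] V ne4
    by (simp_all add: Int_commute)
  then have "path_image p \<inter> path_image q = line {a, c} \<inter> line {b, d}"
    unfolding p(4) q(4) by (simp add: Int_Un_distrib Int_Un_distrib2)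
  ultimately show ?thesis by simp
qed

text \<open>A vertex at the common point would be an end of both edges, but interleaved edges have
  no common end.\<close>

lemma interleaved_edges_cross:
  assumes u: "u \<in> V" and e: "e \<in> E" and f: "f \<in> E" and il: "interleaved (angle u) e f"
  shows "\<exists>p. (f, p) \<in> crossings V E pos \<gamma> e"
proof -
  obtain a b c d where abcd: "angle u a < angle u b" "angle u b < angle u c" "angle u c < angle u d"
    "e = {a, c} \<and> f = {b, d} \<or> e = {b, d} \<and> f = {a, c}"
    using il unfolding interleaved_def by blast
  have disj: "e \<inter> f = {}" "e \<noteq> f" using abcd by auto
  have "line {a, c} \<inter> line {b, d} \<noteq> {}"
    using interleaved_edges_meet[OF u _ _ abcd(1-3)] abcd(4) e f by auto
  then obtain p where p: "p \<in> line e" "p \<in> line f" using abcd(4) by auto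
  have "p \<notin> pos ` V" using pos_on_edge e f p disj by blast
  then show ?thesis using p f disj unfolding crossings_def by auto
qed

lemma at_most_one_interleaved:
  assumes "u \<in> V" "e \<in> E" and one: "\<exists>\<^sub>\<le>\<^sub>1x. x \<in> crossings V E pos \<gamma> e"
  shows "\<exists>\<^sub>\<le>\<^sub>1f. f \<in> E \<and> interleaved (angle u) e f"
proof (rule Uniq_I)
  fix f f' assume "f \<in> E \<and> interleaved (angle u) e f" "f' \<in> E \<and> interleaved (angle u) e f'"
  then obtain p p' where "(f, p) \<in> crossings V E pos \<gamma> e" "(f', p') \<in> crossings V E pos \<gamma> e"
    using interleaved_edges_cross[OF assms(1,2)] by blast
  then show "f = f'" using Uniq_D[OF one] by blast
qed

end

section \<open>Arms that start in small balls around the vertices\<close>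

definition separates :: "'a set \<Rightarrow> 'a set set \<Rightarrow> ('a \<Rightarrow> complex) \<Rightarrow> ('a set \<Rightarrow> real \<Rightarrow> complex) \<Rightarrow> real \<Rightarrow> bool" where
  "separates V E pos \<gamma> \<epsilon> \<longleftrightarrow>
     (\<forall>v\<in>V. (\<forall>w\<in>V. v \<noteq> w \<longrightarrow> ball (pos v) \<epsilon> \<inter> ball (pos w) \<epsilon> = {}) \<and>
       (\<forall>e\<in>E. v \<notin> e \<longrightarrow> ball (pos v) \<epsilon> \<inter> path_image (\<gamma> e) = {}))"

lemma vertices_separated:
  assumes "drawing V E pos \<gamma>"
  obtains \<epsilon> where "\<epsilon> > 0" "separates V E pos \<gamma> \<epsilon>"
proof -
  have fin: "finite V" "E \<subseteq> Pow V" "finite E" and inj: "inj_on pos V"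
    using assms finite_subset[of E "Pow V"] by (auto simp: drawing_def simple_graph_def)
  have 1: "\<exists>d>0. v \<noteq> w \<longrightarrow> ball (pos v) d \<inter> ball (pos w) d = {}" if "v \<in> V" "w \<in> V" for v w
  proof (cases "v = w")
    case False
    then have "dist (pos v) (pos w) > 0" using inj that by (auto simp: inj_on_def)
    moreover have "ball (pos v) (dist (pos v) (pos w) / 2) \<inter> ball (pos w) (dist (pos v) (pos w) / 2) = {}"
      by (intro disjoint_ballI) simp
    ultimately show ?thesis by (meson half_gt_zero)
  qed (auto intro: exI[of _ 1])
  have 2: "\<exists>d>0. v \<notin> e \<longrightarrow> ball (pos v) d \<inter> path_image (\<gamma> e) = {}" if "v \<in> V" "e \<in> E" for v e
  proof (cases "v \<in> e")
    case False
    then have "pos v \<notin> path_image (\<gamma> e)" "closed (path_image (\<gamma> e))"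
      using assms that by (auto simp: drawing_def closed_arc_image)
    then show ?thesis
      by (metis separate_point_closed disjoint_iff mem_ball not_le)
  qed (auto intro: exI[of _ 1])
  obtain d1 where d1: "\<And>v w. v \<in> V \<Longrightarrow> w \<in> V \<Longrightarrow> d1 v w > 0 \<and> (v \<noteq> w \<longrightarrow> ball (pos v) (d1 v w) \<inter> ball (pos w) (d1 v w) = {})"
    using 1 by metis
  obtain d2 where d2: "\<And>v e. v \<in> V \<Longrightarrow> e \<in> E \<Longrightarrow> d2 v e > 0 \<and> (v \<notin> e \<longrightarrow> ball (pos v) (d2 v e) \<inter> path_image (\<gamma> e) = {})"
    using 2 by metis
  \<comment> \<open>The element 1 makes the minimum meaningful when there are no vertices.\<close>
  define S where "S = insert 1 ((\<lambda>(v, w). d1 v w) ` (V \<times> V) \<union> (\<lambda>(v, e). d2 v e) ` (V \<times> E))"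
  have S: "finite S" "S \<noteq> {}" using fin by (auto simp: S_def)
  have le1: "Min S \<le> d1 v w" if "v \<in> V" "w \<in> V" for v w
    using that S by (intro Min_le) (auto simp: S_def)
  have le2: "Min S \<le> d2 v w" if "v \<in> V" "w \<in> E" for v w
    using that S by (intro Min_le) (auto simp: S_def)
  have "Min S > 0" using S d1 d2 by (subst Min_gr_iff) (auto simp: S_def)
  moreover have "ball (pos v) (Min S) \<inter> ball (pos w) (Min S) = {}" if "v \<in> V" "w \<in> V" "v \<noteq> w" for v w
    using d1[OF that(1,2)] subset_ball[OF le1[OF that(1,2)], of "pos v"]
      subset_ball[OF le1[OF that(1,2)], of "pos w"] that(3) by blast
  moreover have "ball (pos v) (Min S) \<inter> path_image (\<gamma> e) = {}" if "v \<in> V" "e \<in> E" "v \<notin> e" for v e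
    using d2[OF that(1,2)] subset_ball[OF le2[OF that(1,2)], of "pos v"] that(3) by blast
  ultimately show ?thesis using that by (simp add: separates_def)
qed

text \<open>The arms go far away from their vertices, but they meet the drawing only where the short
  arcs do. Those stay in small balls, which no edge at another vertex enters.\<close>

lemma circle_access_from_arcs:
  assumes dr: "drawing V E pos \<gamma>"
    and sep: "separates V E pos \<gamma> \<epsilon>"
    and s: "\<And>v. v \<in> V \<Longrightarrow> arc (s v)" "\<And>v. v \<in> V \<Longrightarrow> pathstart (s v) = pos v"
      "\<And>v. v \<in> V \<Longrightarrow> pathfinish (s v) \<in> outside (drawn_set V E pos \<gamma>)"
      "\<And>v. v \<in> V \<Longrightarrow> path_image (s v) \<subseteq> ball (pos v) \<epsilon>"
  obtains R k where "circle_access V E pos \<gamma> R k" "\<And>v. v \<in> V \<Longrightarrow> same_germ (s v) (k v)"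
    "\<And>v. v \<in> V \<Longrightarrow> path_image (k v) \<inter> drawn_set V E pos \<gamma> \<subseteq> path_image (s v)"
proof -
  have V: "finite V" using dr by (auto simp: drawing_def simple_graph_def)
  have st: "\<And>v. v \<in> V \<Longrightarrow> pathstart (s v) \<in> drawn_set V E pos \<gamma>" using s(2) by (auto simp: drawn_set_def)
  have dj: "path_image (s v) \<inter> path_image (s w) = {}" if "v \<in> V" "w \<in> V" "v \<noteq> w" for v w
  proof -
    have "ball (pos v) \<epsilon> \<inter> ball (pos w) \<epsilon> = {}" using sep that by (simp add: separates_def)
    then show ?thesis using s(4)[OF that(1)] s(4)[OF that(2)] by blast
  qed
  obtain R k where k: "R > 0" "drawn_set V E pos \<gamma> \<subseteq> ball 0 R"
    "\<And>v. v \<in> V \<Longrightarrow> arc (k v)" "\<And>v. v \<in> V \<Longrightarrow> pathstart (k v) = pathstart (s v)"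
    "\<And>v. v \<in> V \<Longrightarrow> norm (pathfinish (k v)) = R"
    "\<And>v t. v \<in> V \<Longrightarrow> t \<in> {0..<1} \<Longrightarrow> norm (k v t) < R"
    "\<And>v. v \<in> V \<Longrightarrow> path_image (k v) \<inter> drawn_set V E pos \<gamma> \<subseteq> path_image (s v)"
    "\<And>v. v \<in> V \<Longrightarrow> same_germ (s v) (k v)"
    "\<And>v w. v \<in> V \<Longrightarrow> w \<in> V \<Longrightarrow> v \<noteq> w \<Longrightarrow> path_image (k v) \<inter> path_image (k w) = {}"
  proof (rule access_arcs_to_circle[OF V drawn_set_compact[OF dr], of s])
    show "arc (s v)" "pathstart (s v) \<in> drawn_set V E pos \<gamma>"
      "pathfinish (s v) \<in> outside (drawn_set V E pos \<gamma>)" if "v \<in> V" for v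
      using s st that by auto
    show "path_image (s v) \<inter> path_image (s w) = {}" if "v \<in> V" "w \<in> V" "v \<noteq> w" for v w
      by (rule dj[OF that])
  qed (rule that)
  have "circle_access V E pos \<gamma> R k"
  proof
    show "drawing V E pos \<gamma>" by (fact dr)
    show "R > 0" "drawn_set V E pos \<gamma> \<subseteq> ball 0 R" by (fact k)+
    fix v assume v: "v \<in> V"
    show "arc (k v)" "norm (pathfinish (k v)) = R" using k(3,5) v by auto
    show "pathstart (k v) = pos v" using k(4) s(2) v by simp
    show "norm (k v t) < R" if "t \<in> {0..<1}" for t by (rule k(6)[OF v that])
    show "path_image (k v) \<inter> path_image (k w) = {}" if "w \<in> V" "v \<noteq> w" for w by (rule k(9)[OF v that])
    show "path_image (k v) \<inter> path_image (\<gamma> e) = {}" if "e \<in> E" "v \<notin> e" for e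
    proof -
      have "ball (pos v) \<epsilon> \<inter> path_image (\<gamma> e) = {}" using sep v that by (simp add: separates_def)
      then show ?thesis using k(7)[OF v] s(4)[OF v] that(1) by (auto simp: drawn_set_def)
    qed
  qed
  then show ?thesis using that k by blast
qed

text \<open>The frontier condition yields only points of the outer face close to each vertex. The
  straight segment to such a point may cross edges at the vertex, which \<open>circle_access\<close>
  tolerates.\<close>

lemma outer_1_plane_circle_access:
  assumes "outer_1_plane V E pos \<gamma>"
  obtains R k where "circle_access V E pos \<gamma> R k"
proof -
  let ?D = "drawn_set V E pos \<gamma>"
  have dr: "drawing V E pos \<gamma>" and fr: "\<And>v. v \<in> V \<Longrightarrow> pos v \<in> frontier (outside ?D)"
    using assms by (auto simp: outer_1_plane_def)
  obtain \<epsilon> where \<epsilon>: "\<epsilon> > 0" "separates V E pos \<gamma> \<epsilon>"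
    using vertices_separated[OF dr] by blast
  have "\<exists>q. q \<in> outside ?D \<and> dist (pos v) q < \<epsilon>" if "v \<in> V" for v
  proof -
    have "pos v \<in> closure (outside ?D)" using fr[OF that] by (simp add: frontier_def)
    then show ?thesis using \<epsilon>(1) unfolding closure_approachable by (metis dist_commute)
  qed
  then obtain q where q: "\<And>v. v \<in> V \<Longrightarrow> q v \<in> outside ?D" "\<And>v. v \<in> V \<Longrightarrow> dist (pos v) (q v) < \<epsilon>"
    by metis
  have ne: "pos v \<noteq> q v" if "v \<in> V" for v
  proof
    assume "pos v = q v"
    then have "q v \<in> ?D" using that unfolding drawn_set_def by (metis UnI1 imageI)
    then show False using q(1)[OF that] outside_no_overlap[of ?D] by blast
  qed
  have "closed_segment (pos v) (q v) \<subseteq> ball (pos v) \<epsilon>" if "v \<in> V" for v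
    using q(2)[OF that] \<epsilon>(1) by (intro closed_segment_subset) auto
  then have seg: "\<And>v. v \<in> V \<Longrightarrow> path_image (linepath (pos v) (q v)) \<subseteq> ball (pos v) \<epsilon>" by simp
  obtain R k where "circle_access V E pos \<gamma> R k"
  proof (rule circle_access_from_arcs[where V = V and E = E and pos = pos and \<gamma> = \<gamma> and \<epsilon> = \<epsilon>
        and s = "\<lambda>v. linepath (pos v) (q v)"])
    show "drawing V E pos \<gamma>" by (fact dr)
    show "separates V E pos \<gamma> \<epsilon>" by (fact \<epsilon>)
    show "arc (linepath (pos v) (q v))" if "v \<in> V" for v using ne[OF that] by simp
    show "pathfinish (linepath (pos v) (q v)) \<in> outside ?D" if "v \<in> V" for v using q(1)[OF that] by simp
    show "pathstart (linepath (pos v) (q v)) = pos v" for v by simp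
    show "path_image (linepath (pos v) (q v)) \<subseteq> ball (pos v) \<epsilon>" if "v \<in> V" for v by (rule seg[OF that])
  qed (rule that)
  then show ?thesis by (rule that)
qed

section \<open>Neighbours on the outer face of a maximal graph\<close>

lemma cis_eq_iff_bounded:
  assumes "cis a = cis b" "0 \<le> a" "a < 2 * pi" "0 \<le> b" "b < 2 * pi"
  shows "a = b"
proof -
  have "Arg2pi (cis t) = t" if "0 \<le> t" "t < 2 * pi" for t
    using that by (intro Arg2pi_unique[of 1]) (auto simp: cis_conv_exp)
  then show ?thesis using assms by metis
qed

text \<open>The stronger arms serve two purposes: a new edge can be drawn along them without
  crossing anything, and an arm can be placed among the edges in the cyclic order at its
  vertex.\<close>

locale outer_access = circle_access +
  assumes outside_k: "v \<in> V \<Longrightarrow> path_image (k v) - {pos v} \<subseteq> outside (drawn_set V E pos \<gamma>)"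
    and maximal: "maximal_outer_1_plane V E pos \<gamma>"
begin

abbreviation "D \<equiv> drawn_set V E pos \<gamma>"

lemma pos_in_D: "v \<in> V \<Longrightarrow> pos v \<in> D"
  by (auto simp: drawn_set_def)

lemma edge_in_D: "e \<in> E \<Longrightarrow> line e \<subseteq> D"
  by (auto simp: drawn_set_def)

lemma far_outside: "norm z \<ge> R \<Longrightarrow> z \<in> outside D"
  using outside_subset_convex[OF convex_ball R(2)] by auto

lemma pos_k: "v \<in> V \<Longrightarrow> k v 0 = pos v"
  using start_k by (simp add: pathstart_def)

lemma k_inner_ne: "v \<in> V \<Longrightarrow> t \<in> {0<..1} \<Longrightarrow> k v t \<noteq> pos v"
  using arc_k[of v] pos_k[of v] by (auto simp: arc_def dest: inj_onD[of "k v" _ t 0])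

text \<open>The arm of \<open>x\<close> without its start, continued by the ray from
  \<open>y x\<close> away from the origin, is connected, unbounded, and disjoint from the drawing
  and from \<open>g\<close>. So it lies in the outer face that remains, and \<open>pos x\<close> is
  in its closure.\<close>

lemma vertex_escapes:
  assumes g: "path g" "path_image g \<subseteq> cball 0 R" and x: "x \<in> V"
    and disj: "path_image g \<inter> arm x = {}"
  shows "pos x \<in> closure (outside (D \<union> path_image g))"
proof -
  let ?C = "D \<union> path_image g"
  define K where "K = k x ` {0<..1}"
  define L where "L = (\<lambda>s. of_real s * y x) ` {1..}"
  have cK: "connected K"
    unfolding K_def using arc_k[OF x]
    by (intro connected_continuous_image) (auto simp: arc_def path_def intro: continuous_on_subset)
  have cL: "connected L"
    unfolding L_def by (intro connected_continuous_image continuous_intros) auto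
  have "y x \<in> K" "y x \<in> L" unfolding K_def L_def pathfinish_def by (force intro: image_eqI[of _ _ 1])+
  then have conn: "connected (K \<union> L)" using cK cL by (intro connected_Un) auto
  have "K \<inter> D = {}"
  proof -
    have "K \<subseteq> arm x - {pos x}"
      using k_inner_ne[OF x] by (auto simp: K_def path_image_def)
    then show ?thesis using outside_k[OF x] outside_no_overlap[of D] by blast
  qed
  moreover have "L \<inter> D = {}"
  proof -
    have "norm z \<ge> R" if "z \<in> L" for z
    proof -
      obtain s where "1 \<le> s" "z = of_real s * y x" using \<open>z \<in> L\<close> by (auto simp: L_def)
      then show ?thesis using finish_k[OF x] R(1) by (simp add: norm_mult mult_le_cancel_right1)
    qed
    then show ?thesis using R(2) by fastforce
  qed
  moreover have "K \<inter> path_image g = {}"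
  proof -
    have "K \<subseteq> arm x" by (auto simp: K_def path_image_def)
    then show ?thesis using disj by blast
  qed
  moreover have "L \<inter> path_image g = {}"
  proof -
    have "z \<notin> path_image g" if "z \<in> L" for z
    proof
      assume "z \<in> path_image g"
      then have "norm z \<le> R" using g by auto
      obtain s where s: "1 \<le> s" "z = of_real s * y x" using \<open>z \<in> L\<close> by (auto simp: L_def)
      \<comment> \<open>The ray leaves the disc at once; its only point in the disc is
        \<open>y x\<close>, which is on the arm.\<close>
      then have "s = 1" using \<open>norm z \<le> R\<close> finish_k[OF x] R(1) by (simp add: norm_mult)
      then show False using s disj \<open>z \<in> path_image g\<close> pathfinish_in_path_image[of "k x"] by auto
    qed
    then show ?thesis by auto
  qed
  ultimately have sub: "K \<union> L \<subseteq> - ?C" by blast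
  have unb: "\<not> bounded L"
  proof
    assume "bounded L"
    then obtain B where B: "\<And>z. z \<in> L \<Longrightarrow> norm z \<le> B" unfolding bounded_iff by blast
    define s where "s = max 1 ((B + 1) / R)"
    have "norm (of_real s * y x) \<le> B" by (rule B) (auto simp: L_def s_def)
    then have "s * R \<le> B" using finish_k[OF x] by (simp add: norm_mult s_def)
    moreover have "(B + 1) / R * R \<le> s * R" using R(1) by (intro mult_right_mono) (auto simp: s_def)
    ultimately show False using R(1) by simp
  qed
  have "K \<union> L \<subseteq> outside ?C"
  proof
    fix z assume z: "z \<in> K \<union> L"
    have "K \<union> L \<subseteq> connected_component_set (- ?C) z"
      using connected_component_maximal[OF z conn sub] .
    then have "\<not> bounded (connected_component_set (- ?C) z)"
      using unb bounded_subset by blast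
    then show "z \<in> outside ?C" using z sub by (auto simp: outside_def)
  qed
  moreover have "pos x \<in> closure K"
  proof -
    have "k x ` closure {0<..1} \<subseteq> closure K"
      using arc_k[OF x]
      by (intro image_closure_subset) (auto simp: K_def arc_def path_def closure_subset)
    moreover have "(0::real) \<in> closure {0<..1}" by simp
    ultimately show ?thesis using pos_k[OF x] by (metis image_subset_iff)
  qed
  ultimately show ?thesis using closure_mono[of K] by blast
qed

text \<open>An edge could be added along the access arcs of two consecutive vertices and the circle.\<close>

lemma consecutive_adjacent:
  assumes u: "u \<in> V" and v: "v \<in> V" and w: "w \<in> V" and vw: "angle u v < angle u w"
    and no: "\<And>x. x \<in> V \<Longrightarrow> \<not> (angle u v < angle u x \<and> angle u x < angle u w)"
  shows "{v, w} \<in> E"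
proof (rule ccontr)
  assume new: "{v, w} \<notin> E"
  have ne: "v \<noteq> w" using vw by auto
  \<comment> \<open>The counterclockwise piece of the circle from \<open>y v\<close> to
    \<open>y w\<close>. By the choice of \<open>v\<close> and \<open>w\<close> no other arm ends on
    it.\<close>
  define c where "c t = y u * cis ((1 - t) * angle u v + t * angle u w)" for t
  have pc: "path c" unfolding path_def c_def by (intro continuous_intros)
  have c01: "c 0 = y v" "c 1 = y w" using y_angle[OF u] v w by (auto simp: c_def)
  have c_norm: "norm (c t) = R" for t using finish_k[OF u] by (simp add: c_def norm_mult)
  have c_y: "x = v \<or> x = w" if x: "x \<in> V" "y x \<in> path_image c" for x
  proof -
    obtain t where t: "t \<in> {0..1}" "y x = c t" using x by (auto simp: path_image_def)
    define s where "s = (1 - t) * angle u v + t * angle u w"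
    have s: "angle u v \<le> s" "s \<le> angle u w"
    proof -
      have "s = angle u v + t * (angle u w - angle u v)" by (simp add: s_def algebra_simps)
      moreover have "0 \<le> t * (angle u w - angle u v)" "t * (angle u w - angle u v) \<le> 1 * (angle u w - angle u v)"
        using t vw by (auto intro!: mult_right_mono mult_nonneg_nonneg)
      ultimately show "angle u v \<le> s" "s \<le> angle u w" by auto
    qed
    have "cis (angle u x) = cis s"
      using t y_angle[OF u x(1)] y_nonzero[OF u] by (simp add: c_def s_def)
    then have "angle u x = s"
      using s angle_bounds[of u v] angle_bounds[of u w] angle_bounds[of u x]
      by (intro cis_eq_iff_bounded) auto
    then show ?thesis using s no[OF x(1)] angle_inj[OF u x(1)] v w by force
  qed
  define p where "p = k v +++ c +++ reversepath (k w)"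
  have p: "path p" "pathstart p = pos v" "pathfinish p = pos w"
    "path_image p = arm v \<union> path_image c \<union> arm w"
    unfolding p_def using pc c01 arc_k v w start_k
    by (auto simp: arc_imp_path pathstart_def[of c] pathfinish_def[of c] path_image_join)
  \<comment> \<open>Extracting an arc from the path avoids a proof that the concatenation is
    simple.\<close>
  obtain g where g: "arc g" "path_image g \<subseteq> path_image p" "pathstart g = pos v" "pathfinish g = pos w"
    using path_contains_arc[OF p(1-3)] pos_inj[OF v w] ne by metis
  have c_out: "path_image c \<subseteq> outside D"
    using c_norm far_outside by (auto simp: path_image_def)
  have g_out: "path_image g - {pos v, pos w} \<subseteq> outside D"
    using g(2) p(4) outside_k[OF v] outside_k[OF w] c_out by blast
  then have g_D: "path_image g \<inter> D = {pos v, pos w}"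
  proof -
    have "pos v \<in> path_image g" "pos w \<in> path_image g"
      using g(3,4) pathstart_in_path_image[of g] pathfinish_in_path_image[of g] by auto
    with g_out show ?thesis using outside_no_overlap[of D] pos_in_D[OF v] pos_in_D[OF w] by blast
  qed
  have g_R: "path_image g \<subseteq> cball 0 R"
  proof -
    have "path_image c \<subseteq> cball 0 R" using c_norm by (auto simp: path_image_def)
    moreover have "arm v \<subseteq> cball 0 R" "arm w \<subseteq> cball 0 R"
      using path_image_k[OF v] path_image_k[OF w] by auto
    ultimately show ?thesis using g(2) p(4) by blast
  qed
  have g_k: "path_image g \<inter> arm x = {}" if x: "x \<in> V" "x \<noteq> v" "x \<noteq> w" for x
  proof -
    have "z \<notin> arm x" if "z \<in> path_image c" for z
    proof
      assume "z \<in> arm x"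
      moreover have "norm z = R" using that c_norm by (auto simp: path_image_def)
      ultimately have "z = y x" using path_image_k[OF x(1)] by blast
      then show False using c_y[OF x(1)] that x by auto
    qed
    then show ?thesis
      using g(2) p(4) disjoint_k[OF v x(1)] disjoint_k[OF w x(1)] x by blast
  qed
  let ?O = "outside (D \<union> path_image g)"
  let ?E = "insert {v, w} E" and ?\<gamma> = "\<gamma>({v, w} := g)"
  have \<gamma>_old: "?\<gamma> e = \<gamma> e" if "e \<in> E" for e using that new by auto
  have D': "drawn_set V ?E pos ?\<gamma> = D \<union> path_image g"
    using \<gamma>_old by (auto simp: drawn_set_def)
  have cross_old: "crossing_ccw pos ?\<gamma> q a b c d = crossing_ccw pos \<gamma> q a b c d"
    if "{a, c} \<in> E" "{b, d} \<in> E" for q a b c d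
    using \<gamma>_old[OF that(1)] \<gamma>_old[OF that(2)] by (simp only: crossing_ccw_def)
  have g_edge: "q \<in> pos ` ({v, w} \<inter> e)" if "e \<in> E" "q \<in> path_image g" "q \<in> line e" for e q
  proof -
    have "q = pos v \<or> q = pos w" using that edge_in_D g_D by blast
    then show ?thesis using pos_on_edge[OF v that(1)] pos_on_edge[OF w that(1)] that(3) by blast
  qed
  have g_pos: "x \<in> {v, w}" if "x \<in> V" "pos x \<in> path_image g" for x
    using g_D pos_in_D[OF that(1)] that pos_inj[OF that(1)] v w by blast
  have out1: "outer_1_plane V E pos \<gamma>" using maximal by (simp add: maximal_outer_1_plane_def)
  have dr: "drawing V ?E pos ?\<gamma>"
    unfolding drawing_def
  proof (intro conjI ballI impI)
    show "simple_graph V ?E"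
      using drawing v w ne by (auto simp: drawing_def simple_graph_def)
    show "inj_on pos V" using drawing by (simp add: drawing_def)
  next
    fix e assume e: "e \<in> ?E"
    show "arc (?\<gamma> e)" using g(1) drawing e by (auto simp: drawing_def)
    show "{pathstart (?\<gamma> e), pathfinish (?\<gamma> e)} = pos ` e"
      using g(3,4) drawing e by (auto simp: drawing_def)
    fix x assume x: "x \<in> V" "pos x \<in> path_image (?\<gamma> e)"
    show "x \<in> e"
    proof (cases "e = {v, w}")
      case True
      then show ?thesis using g_pos x by simp
    next
      case False
      then show ?thesis using pos_on_edge[OF x(1), of e] x(2) e by simp
    qed
  next
    fix e f q assume ef: "e \<in> ?E" "f \<in> ?E" "e \<noteq> f" and q: "q \<in> path_image (?\<gamma> e) \<inter> path_image (?\<gamma> f)"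
    consider "e \<in> E" "f \<in> E" | "e = {v, w}" "f \<in> E" | "f = {v, w}" "e \<in> E" using ef by auto
    then show "q \<in> pos ` (e \<inter> f) \<or>
        (e \<inter> f = {} \<and> (\<exists>a b c d. e = {a, c} \<and> f = {b, d} \<and> crossing_ccw pos ?\<gamma> q a b c d))"
    proof cases
      case 1
      then have "q \<in> line e \<inter> line f" using q \<gamma>_old by simp
      then have "q \<in> pos ` (e \<inter> f) \<or>
        (e \<inter> f = {} \<and> (\<exists>a b c d. e = {a, c} \<and> f = {b, d} \<and> crossing_ccw pos \<gamma> q a b c d))"
        using drawing 1 ef(3) unfolding drawing_def by blast
      then show ?thesis using cross_old 1 by metis
    next
      case 2
      then show ?thesis using g_edge[of f q] q \<gamma>_old[of f] by simp
    next
      case 3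
      then show ?thesis using g_edge[of e q] q \<gamma>_old[of e] by (simp add: Int_commute)
    qed
  qed
  have "pos x \<in> frontier ?O" if x: "x \<in> V" for x
  proof -
    have "pos x \<in> closure ?O"
    \<comment> \<open>The ends of the new edge lie on the arc and are reached by
      \<open>arc_in_outside_accessible\<close>; every other vertex still escapes along its own
      arm.\<close>
    proof (cases "x = v \<or> x = w")
      case True
      have "path_image g \<subseteq> closure ?O"
      proof (rule arc_in_outside_accessible)
        show "compact D" by (rule drawn_set_compact[OF drawing])
        show "g 0 \<in> D" "g 1 \<in> D" using g(3,4) pos_in_D v w by (auto simp: pathstart_def pathfinish_def)
        show "g t \<in> outside D" if t: "t \<in> {0<..<1}" for t
        proof -
          have "g t \<noteq> g 0" "g t \<noteq> g 1"
            using g(1) t by (auto simp: arc_def dest!: inj_onD[of g _ t])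
          then show ?thesis using g_out g(3,4) t
            by (auto simp: path_image_def pathstart_def pathfinish_def subset_iff)
        qed
      qed (rule g(1))
      then show ?thesis
        using True g(3,4) pathstart_in_path_image[of g] pathfinish_in_path_image[of g] by auto
    next
      case False
      then show ?thesis
        using vertex_escapes[OF arc_imp_path[OF g(1)] g_R x] g_k[OF x] by blast
    qed
    moreover have "pos x \<notin> ?O"
      using pos_in_D[OF x] outside_no_overlap[of "D \<union> path_image g"] by blast
    moreover have "interior ?O \<subseteq> ?O"
      by (rule interior_subset)
    ultimately show ?thesis by (auto simp: frontier_def)
  qed
  moreover have "\<exists>\<^sub>\<le>\<^sub>1x. x \<in> crossings V ?E pos ?\<gamma> e" if e: "e \<in> ?E" for e
  proof -
    \<comment> \<open>The new edge meets old ones only at vertices, so no edge gains a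
      crossing.\<close>
    have no_new: "q \<in> pos ` V" if "f \<in> E" "q \<in> path_image g" "q \<in> line f" for f q
      using g_edge[OF that] v w by auto
    show ?thesis
    proof (cases "e = {v, w}")
      case True
      then have "crossings V ?E pos ?\<gamma> e = {}"
        using no_new \<gamma>_old by (auto simp: crossings_def)
      then show ?thesis by (simp add: Uniq_def)
    next
      case False
      then have "e \<in> E" using e by auto
      then have "crossings V ?E pos ?\<gamma> e \<subseteq> crossings V E pos \<gamma> e"
        using no_new \<gamma>_old by (auto simp: crossings_def)
      moreover have "\<exists>\<^sub>\<le>\<^sub>1x. x \<in> crossings V E pos \<gamma> e"
        using out1 \<open>e \<in> E\<close> by (auto simp: outer_1_plane_def)
      ultimately show ?thesis unfolding Uniq_def by blast
    qed
  qed
  ultimately have "outer_1_plane V ?E pos ?\<gamma>"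
    using dr by (simp add: outer_1_plane_def D')
  then show False using maximal v w ne new unfolding maximal_outer_1_plane_def by blast
qed

end

text \<open>Moving the viewpoint along a ray, the directions never coincide, so their order stays the same.\<close>

lemma order_on_circle_from_inside:
  fixes a b c u :: complex
  assumes R: "norm a = R" "norm b = R" "norm c = R" "norm u < R" and ne: "a \<noteq> b" "a \<noteq> c" "b \<noteq> c"
    and less: "Arg2pi ((b - u) / (a - u)) < Arg2pi ((c - u) / (a - u))"
  shows "Arg2pi (b / a) < Arg2pi (c / a)"
proof -
  have su: "norm (of_real s * u) < R" if "s \<in> {0..1}" for s :: real
  proof -
    have "norm (of_real s * u) \<le> 1 * norm u"
      using that mult_right_mono[of s 1 "norm u"] by (simp add: norm_mult)
    then show ?thesis using R by simp
  qed
  \<comment> \<open>A ray from an inner point \<open>q\<close> meets the circle only once. Of two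
    such points the nearer one would be a proper convex combination of \<open>q\<close> and the
    other, of norm less than \<open>R\<close>.\<close>
  have dir: "x = z" if "norm x = R" "norm z = R" "norm q < R" "0 < r" "x - q = of_real r * (z - q)"
    for x z q :: complex and r :: real
  proof -
    have inner: "False" if xz: "norm x = R" "norm z = R" "x - q = of_real r * (z - q)" "r < 1" "0 < r" for x z r
    proof -
      have "x = of_real (1 - r) * q + of_real r * z" using xz(3) by (simp add: algebra_simps)
      then have "norm x \<le> norm (of_real (1 - r) * q) + norm (of_real r * z)" by (metis norm_triangle_ineq)
      also have "\<dots> = (1 - r) * norm q + r * R" using xz by (simp add: norm_mult del: of_real_diff)
      also have "\<dots> < (1 - r) * R + r * R" using xz \<open>norm q < R\<close> by simp
      finally show False using xz by (simp add: algebra_simps)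
    qed
    have "z - q = of_real (1/r) * (x - q)" using that by simp
    then have "r = 1"
      using inner[of x z r] inner[of z x "1/r"] that by (cases r "1::real" rule: linorder_cases) auto
    then show ?thesis using that by simp
  qed
  have ne_s: "x - of_real s * u \<noteq> 0" if "norm x = R" "s \<in> {0..1}" for x and s :: real
    using su[OF that(2)] that by auto
  define f where "f s x = (x - of_real s * u) / (a - of_real s * u)" for s x
  \<comment> \<open>The nonnegative reals are where \<open>Arg2pi\<close> is discontinuous; avoiding
    them makes the angles continuous in \<open>s\<close>.\<close>
  have f_not: "f s x \<notin> \<real>\<^sub>\<ge>\<^sub>0" if "norm x = R" "x \<noteq> a" "s \<in> {0..1}" for s x
  proof
    assume "f s x \<in> \<real>\<^sub>\<ge>\<^sub>0"
    then obtain r where r: "r \<ge> 0" "f s x = of_real r" by (auto simp: nonneg_Reals_def)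
    then have "x - of_real s * u = of_real r * (a - of_real s * u)"
      using ne_s[OF R(1) that(3)] by (simp add: f_def field_simps)
    moreover from this have "r \<noteq> 0" using ne_s[OF that(1,3)] by auto
    ultimately show False using dir[of x a "of_real s * u" r] that R(1) su r by auto
  qed
  \<comment> \<open>The difference of the two angles seen from \<open>s\<close> times
    \<open>u\<close>. It is continuous and never 0, so its sign at \<open>s = 1\<close> persists to
    \<open>s = 0\<close>, the view from the origin.\<close>
  define h where "h s = Arg2pi (f s c) - Arg2pi (f s b)" for s
  have cont: "continuous_on {0..1} (\<lambda>s. Arg2pi (f s x))" if "norm x = R" "x \<noteq> a" for x
  proof -
    have cf: "continuous_on {0..1} (\<lambda>s. f s x)"
      unfolding f_def using ne_s[OF R(1)] by (intro continuous_intros) auto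
    have "isCont Arg2pi (f s x)" if "s \<in> {0..1}" for s
      using f_not \<open>norm x = R\<close> \<open>x \<noteq> a\<close> that by (intro continuous_at_Arg2pi) auto
    then have "continuous_on ((\<lambda>s. f s x) ` {0..1}) Arg2pi"
      by (intro continuous_at_imp_continuous_on) blast
    from continuous_on_compose2[OF this cf] show ?thesis by simp
  qed
  have ch: "continuous_on {0..1} h"
    unfolding h_def using cont[of c] cont[of b] R ne by (intro continuous_intros) auto
  have h_ne: "h s \<noteq> 0" if s: "s \<in> {0..1}" for s
  proof
    assume "h s = 0"
    then have "Arg2pi (f s c) = Arg2pi (f s b)" by (simp add: h_def)
    moreover have "f s c \<noteq> 0" "f s b \<noteq> 0" using ne_s s R by (auto simp: f_def)
    ultimately obtain r where r: "0 < r" "f s c = of_real r * f s b"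
      using Arg2pi_eq_iff by blast
    then have "c - of_real s * u = of_real r * (b - of_real s * u)"
      using ne_s[OF R(1) s] by (simp add: f_def field_simps)
    then show False using dir[of c b "of_real s * u" r] R su[OF s] r ne by auto
  qed
  have "h 1 > 0" using less by (simp add: h_def f_def)
  have "h 0 > 0"
  proof (rule ccontr)
    assume "\<not> h 0 > 0"
    then obtain s where "s \<in> {0..1}" "h s = 0"
      using IVT'[of h 0 0 1] \<open>h 1 > 0\<close> ch by force
    then show False using h_ne by blast
  qed
  then show ?thesis by (simp add: h_def f_def)
qed

section \<open>From the cyclic order at a vertex to the order on the circle\<close>

context outer_access
begin

text \<open>\<open>cyclic_order_at_centre_eq_at_ends\<close> wants the ends on a circle around the
  common start \<open>pos v\<close>, while the arms end on a circle around 0. Each arc is prolonged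
  straight away from \<open>pos v\<close>; the bound on \<rho> makes the disc around
  \<open>pos v\<close> contain the old one. By convexity the prolongation never returns to the old
  disc.\<close>

lemma ray_arc:
  assumes v: "v \<in> V"
    and b: "arc b" "pathstart b = pos v" "pathfinish b = y x" "x \<in> V"
      "path_image b \<subseteq> cball 0 R" "path_image b \<inter> sphere 0 R = {y x}"
    and \<rho>: "R + norm (pos v) < \<rho>"
  defines "z \<equiv> pos v + of_real (\<rho> / norm (y x - pos v)) * (y x - pos v)"
  shows "arc (b +++ linepath (y x) z)"
    "path_image (b +++ linepath (y x) z) = path_image b \<union> closed_segment (y x) z"
    "\<And>q. q \<in> closed_segment (y x) z \<Longrightarrow> \<exists>s\<ge>1. q = pos v + of_real s * (y x - pos v) \<and> norm (q - pos v) \<le> \<rho>"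
    "norm (z - pos v) = \<rho>" "\<And>q. q \<in> closed_segment (y x) z \<Longrightarrow> q \<noteq> y x \<Longrightarrow> R < norm q"
    "\<exists>s>0. z - pos v = of_real s * (y x - pos v)"
proof -
  have pv: "norm (pos v) < R" using pos_in_D[OF v] R(2) by auto
  have nx: "norm (y x) = R" using finish_k b(4) by auto
  define d where "d = norm (y x - pos v)"
  have d: "0 < d" "d < \<rho>"
  proof -
    show "0 < d" using pv nx by (auto simp: d_def)
    have "d \<le> R + norm (pos v)" using norm_triangle_ineq4[of "y x" "pos v"] nx by (simp add: d_def)
    then show "d < \<rho>" using \<rho> by simp
  qed
  define c where "c = \<rho> / d"
  have z: "z = pos v + of_real c * (y x - pos v)" by (simp add: z_def d_def c_def)
  have rd: "1 < c" using d by (simp add: c_def)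
  show "norm (z - pos v) = \<rho>" using d by (simp add: z norm_mult norm_divide c_def flip: d_def)
  show "\<exists>s>0. z - pos v = of_real s * (y x - pos v)" using d rd by (intro exI[of _ "c"]) (auto simp: z)
  have seg: "\<exists>s. 1 \<le> s \<and> s \<le> c \<and> q = pos v + of_real s * (y x - pos v)"
    if q: "q \<in> closed_segment (y x) z" for q
  proof -
    obtain t where t: "0 \<le> t" "t \<le> 1" "q = (1 - t) *\<^sub>R y x + t *\<^sub>R z" using q by (auto simp: closed_segment_def)
    have "q = pos v + of_real (1 + t * (c - 1)) * (y x - pos v)"
      unfolding t(3) z by (simp add: scaleR_conv_of_real algebra_simps)
    moreover have "0 \<le> t * (c - 1)" "t * (c - 1) \<le> 1 * (c - 1)"
      using t rd by (auto intro!: mult_right_mono mult_nonneg_nonneg)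
    ultimately show ?thesis by (intro exI[of _ "1 + t * (c - 1)"]) auto
  qed
  show seg2: "\<exists>s\<ge>1. q = pos v + of_real s * (y x - pos v) \<and> norm (q - pos v) \<le> \<rho>"
    if q: "q \<in> closed_segment (y x) z" for q
  proof -
    obtain s where s: "1 \<le> s" "s \<le> c" "q = pos v + of_real s * (y x - pos v)" using seg[OF q] by blast
    have "s * d \<le> \<rho>" using s d by (simp add: c_def field_simps)
    then show ?thesis using s by (intro exI[of _ s]) (auto simp: norm_mult simp flip: d_def)
  qed
  show far: "R < norm q" if q: "q \<in> closed_segment (y x) z" "q \<noteq> y x" for q
  proof (rule ccontr)
    assume "\<not> R < norm q"
    obtain s where s: "1 \<le> s" "q = pos v + of_real s * (y x - pos v)" using seg2[OF q(1)] by blast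
    have "s \<noteq> 1" using s q by auto
    then have s1: "1 < s" using s by simp
    have "of_real s * y x = of_real (s - 1) * pos v + q" using s by (simp add: algebra_simps)
    then have "s * R = norm (of_real (s - 1) * pos v + q)" using s1 nx by (metis norm_mult norm_of_real abs_of_pos less_trans zero_less_one)
    also have "\<dots> \<le> (s - 1) * norm (pos v) + norm q" 
      using norm_triangle_ineq[of "of_real (s - 1) * pos v" q] s1 by (simp add: norm_mult del: of_real_diff)
    also have "\<dots> < (s - 1) * R + R" using \<open>\<not> R < norm q\<close> pv s1 
      by (intro add_less_le_mono mult_strict_left_mono) auto
    finally show False by (simp add: algebra_simps)
  qed
  have "z \<noteq> y x" using \<open>norm (z - pos v) = \<rho>\<close> d by (auto simp: d_def)
  moreover have "path_image b \<inter> closed_segment (y x) z \<subseteq> {y x}"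
    using far b(5) by fastforce
  ultimately show "arc (b +++ linepath (y x) z)" using b by (intro arc_join) auto
  show "path_image (b +++ linepath (y x) z) = path_image b \<union> closed_segment (y x) z"
    using b by (simp add: path_image_join)
qed

text \<open>If the rays met, the two circle points would lie in the same direction from
  \<open>pos v\<close>. The nearer one would then be a proper convex combination of
  \<open>pos v\<close> and the other, of norm less than \<open>R\<close>.\<close>

lemma rays_disjoint:
  assumes v: "v \<in> V" and x: "x \<in> V" and x': "x' \<in> V" and ne: "x \<noteq> x'" 
    and s: "1 \<le> s" "1 \<le> s'" 
  shows "pos v + of_real s * (y x - pos v) \<noteq> pos v + of_real s' * (y x' - pos v)"
proof
  assume eq: "pos v + of_real s * (y x - pos v) = pos v + of_real s' * (y x' - pos v)"
  have pv: "norm (pos v) < R" using pos_in_D[OF v] R(2) by auto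
  have *: False if "a \<in> V" "b \<in> V" "a \<noteq> b" "y a - pos v = of_real r * (y b - pos v)" "0 < r" "r \<le> 1" for a b r
  proof -
    have "r \<noteq> 1" using that y_inj[of a b] by auto
    then have r: "r < 1" using that by simp
    have "y a = of_real (1 - r) * pos v + of_real r * y b" using that(4) by (simp add: algebra_simps)
    then have "norm (y a) \<le> norm (of_real (1 - r) * pos v) + norm (of_real r * y b)" by (metis norm_triangle_ineq)
    also have "\<dots> = (1 - r) * norm (pos v) + r * R" using that r finish_k by (simp add: norm_mult del: of_real_diff)
    also have "\<dots> < (1 - r) * R + r * R" using r pv by simp
    finally show False using finish_k[OF that(1)] by (simp add: algebra_simps)
  qed
  have "y x - pos v = of_real (s' / s) * (y x' - pos v)" "y x' - pos v = of_real (s / s') * (y x - pos v)"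
    using eq s by (auto simp: field_simps)
  then show False
    using *[OF x x' ne, of "s' / s"] *[OF x' x ne[symmetric], of "s / s'"] s
    by (cases "s' \<le> s") (auto simp: field_simps)
qed

text \<open>Three curves from \<open>pos v\<close> are compared: \<open>P\<close> follows the arm of
  \<open>v\<close>, and \<open>Q x\<close> follows the edge to \<open>x\<close> and then the arm of
  \<open>x\<close>, each prolonged by a ray. Their order at \<open>pos v\<close> is that of the
  given list, as germs agree; it is also the order of their far ends, hence of the directions from
  \<open>pos v\<close> to the points \<open>y x\<close>. Moving the viewpoint to the origin turns
  these into the angles on the circle.\<close>

lemma first_neighbour_least:
  assumes v: "v \<in> V" and \<delta>: "arc \<delta>" "pathstart \<delta> = pos v" "same_germ \<delta> (k v)"
    and z: "{v, z} \<in> E" and w: "{v, w} \<in> E" "z \<noteq> w"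
    and ccw: "ccw_at (pos v) (\<delta> # map (\<lambda>w. along (\<gamma> {v, w}) (pos v) (pos w)) (z # zs))"
    and w_in: "w \<in> set zs"
  shows "angle v z < angle v w"
proof -
  have V: "z \<in> V" "w \<in> V" "v \<noteq> z" "v \<noteq> w" using edge_ends[OF z] edge_ends[OF w(1)] by auto
  have pv: "norm (pos v) < R" using pos_in_D[OF v] R(2) by auto
  define \<rho> where "\<rho> = R + norm (pos v) + 1"
  have \<rho>: "R + norm (pos v) < \<rho>" by (simp add: \<rho>_def)
  define A where "A x = along (\<gamma> {v, x}) (pos v) (pos x)" for x
  define far where "far x = pos v + of_real (\<rho> / norm (y x - pos v)) * (y x - pos v)" for x
  define S where "S x = closed_segment (y x) (far x)" for x
  define P where "P = k v +++ linepath (y v) (far v)"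
  define Q where "Q x = (A x +++ k x) +++ linepath (y x) (far x)" for x
  have k_sphere: "arm x \<inter> sphere 0 R = {y x}" if "x \<in> V" for x
  proof -
    have "y x \<in> arm x \<inter> sphere 0 R"
      using finish_k[OF that] pathfinish_in_path_image[of "k x"] by simp
    moreover have "z = y x" if "z \<in> arm x \<inter> sphere 0 R" for z
      using path_image_k[OF \<open>x \<in> V\<close>, of z] that by simp
    ultimately show ?thesis by blast
  qed
  have k_cball: "arm x \<subseteq> cball 0 R" if "x \<in> V" for x
    using path_image_k[OF that] by auto
  have k_D: "arm x \<inter> D = {pos x}" if "x \<in> V" for x
  proof -
    have "pos x \<in> arm x" using start_k[OF that] pathstart_in_path_image[of "k x"] by simp
    then show ?thesis using outside_k[OF that] outside_no_overlap[of D] pos_in_D[OF that] by blast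
  qed
  have bx: "arc (A x +++ k x)" "pathstart (A x +++ k x) = pos v" "pathfinish (A x +++ k x) = y x"
    "path_image (A x +++ k x) = line {v, x} \<union> arm x"
    "path_image (A x +++ k x) \<subseteq> cball 0 R" "path_image (A x +++ k x) \<inter> sphere 0 R = {y x}"
    if x: "{v, x} \<in> E" for x
  proof -
    have xV: "x \<in> V" using edge_ends[OF x] by auto
    note e = edge_arc[OF x, folded A_def]
    show "arc (A x +++ k x)"
      using e arc_k[OF xV] start_k[OF xV] k_D[OF xV] edge_in_D[OF x] by (intro arc_join) auto
    show "pathstart (A x +++ k x) = pos v" "pathfinish (A x +++ k x) = y x" using e by auto
    show im: "path_image (A x +++ k x) = line {v, x} \<union> arm x"
      using e start_k[OF xV] by (simp add: path_image_join)
    show "path_image (A x +++ k x) \<subseteq> cball 0 R"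
      unfolding im using k_cball[OF xV] edge_in_ball[OF x] ball_subset_cball by blast
    have "line {v, x} \<inter> sphere 0 R = {}" using edge_in_ball[OF x] by fastforce
    then show "path_image (A x +++ k x) \<inter> sphere 0 R = {y x}"
      unfolding im using k_sphere[OF xV] by blast
  qed
  note rP = ray_arc[OF v arc_k[OF v] start_k[OF v] refl v k_cball[OF v] k_sphere[OF v] \<rho>, folded far_def, folded P_def S_def]
  have rQ: "arc (Q x)" "path_image (Q x) = line {v, x} \<union> arm x \<union> S x"
    "\<And>q. q \<in> S x \<Longrightarrow> \<exists>s\<ge>1. q = pos v + of_real s * (y x - pos v) \<and> norm (q - pos v) \<le> \<rho>"
    "norm (far x - pos v) = \<rho>" "\<And>q. q \<in> S x \<Longrightarrow> q \<noteq> y x \<Longrightarrow> R < norm q"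
    "\<exists>s>0. far x - pos v = of_real s * (y x - pos v)"
    if x: "{v, x} \<in> E" for x
    using ray_arc[OF v bx(1-3)[OF x] _ bx(5,6)[OF x] \<rho>, folded far_def, folded Q_def S_def] bx(4)[OF x] edge_ends[OF x]
    by auto
  have seg_disj: "S a \<inter> S b = {}"
    if "a \<in> V" "b \<in> V" "a \<noteq> b" "a = v \<or> {v, a} \<in> E" "b = v \<or> {v, b} \<in> E" for a b
  proof -
    have "\<exists>s\<ge>1. q = pos v + of_real s * (y a - pos v)" if "q \<in> S a" for q
      using \<open>a = v \<or> {v, a} \<in> E\<close> rP(3) rQ(3)[of a] that by blast
    moreover have "\<exists>s\<ge>1. q = pos v + of_real s * (y b - pos v)" if "q \<in> S b" for q
      using \<open>b = v \<or> {v, b} \<in> E\<close> rP(3) rQ(3)[of b] that by blast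
    ultimately show ?thesis using rays_disjoint[OF v that(1-3)] by blast
  qed
  have seg_in: "S a \<inter> cball 0 R \<subseteq> {y a}" if "a = v \<or> {v, a} \<in> E" for a
    using that rP(5) rQ(5)[of a] by fastforce
  have seg_k: "S a \<inter> arm b = {}"
    if "a \<in> V" "b \<in> V" "a \<noteq> b" "a = v \<or> {v, a} \<in> E" for a b
  proof -
    have "y a \<notin> arm b"
      using path_image_k[OF that(2)] finish_k[OF that(1)] y_inj[OF that(1,2)] that(3) by blast
    then show ?thesis using seg_in[OF that(4)] k_cball[OF that(2)] by blast
  qed
  have seg_e: "S a \<inter> line e = {}"
    if "e \<in> E" "a \<in> V" "a = v \<or> {v, a} \<in> E" for a e
  proof -
    have "y a \<notin> line e" using edge_in_ball[OF that(1)] finish_k[OF that(2)] by force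
    then show ?thesis using seg_in[OF that(3)] edge_in_ball[OF that(1)] ball_subset_cball by blast
  qed
  have k_e: "arm a \<inter> line e \<subseteq> {pos a}" if "e \<in> E" "a \<in> V" for a e
    using k_D[OF that(2)] edge_in_D[OF that(1)] by blast
  have PQ: "path_image P \<inter> path_image (Q x) \<subseteq> {pos v}" if x: "{v, x} \<in> E" for x
  proof -
    have xV: "x \<in> V" "v \<noteq> x" using edge_ends[OF x] by auto
    note d = k_e[OF x v] disjoint_k[OF v xV] seg_k[OF xV(1) v xV(2)[symmetric] disjI2[OF x]]
      seg_e[OF x v disjI1[OF refl]] seg_k[OF v xV disjI1[OF refl]] 
      seg_disj[OF v xV disjI1[OF refl] disjI2[OF x]]
    show ?thesis unfolding rP(2) rQ(2)[OF x] using d by blast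
  qed
  \<comment> \<open>The two edges share the end \<open>v\<close>, so the conventions for drawings
    allow no other common point.\<close>
  have QQ: "path_image (Q z) \<inter> path_image (Q w) \<subseteq> {pos v}"
  proof -
    have "{v, z} \<noteq> {v, w}" using w(2) by (auto simp: doubleton_eq_iff)
    moreover have "\<forall>e\<in>E. \<forall>f\<in>E. e \<noteq> f \<longrightarrow> (\<forall>p \<in> line e \<inter> line f.
        p \<in> pos ` (e \<inter> f) \<or>
        (e \<inter> f = {} \<and> (\<exists>a b c d. e = {a, c} \<and> f = {b, d} \<and> crossing_ccw pos \<gamma> p a b c d)))"
      using drawing unfolding drawing_def by (elim conjE)
    ultimately have "p \<in> pos ` ({v, z} \<inter> {v, w}) \<or> {v, z} \<inter> {v, w} = {}"
      if "p \<in> line {v, z} \<inter> line {v, w}" for p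
      using z w(1) that by fast
    then have "line {v, z} \<inter> line {v, w} \<subseteq> pos ` ({v, z} \<inter> {v, w})"
      by fast
    then have ee: "line {v, z} \<inter> line {v, w} \<subseteq> {pos v}" using w(2) V by auto
    have "arm z \<inter> line {v, w} = {}" "arm w \<inter> line {v, z} = {}"
      using avoid_k[OF V(1) w(1)] avoid_k[OF V(2) z] V w(2) by auto
    note d = this ee disjoint_k[OF V(1,2) w(2)] seg_k[OF V(1,2) w(2) disjI2[OF z]]
       seg_k[OF V(2,1) w(2)[symmetric] disjI2[OF w(1)]] seg_e[OF w(1) V(1) disjI2[OF z]]
       seg_e[OF z V(2) disjI2[OF w(1)]] seg_disj[OF V(1,2) w(2) disjI2[OF z] disjI2[OF w(1)]]
    have "line {v, z} \<inter> arm w = {}"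
      "line {v, z} \<inter> S w = {}"
      "arm z \<inter> S w = {}"
      using d by (simp_all add: Int_commute)
    then show ?thesis unfolding rQ(2)[OF z] rQ(2)[OF w(1)]
      using d by (simp add: Int_Un_distrib Int_Un_distrib2)
  qed
  have in_ball: "dist (pos v) q \<le> \<rho>" if "norm q \<le> R" for q
    using norm_triangle_ineq4[of "pos v" q] that by (simp add: dist_norm \<rho>_def)
  have P_ball: "dist (pos v) q \<le> \<rho>" if "q \<in> path_image P" for q
  proof (cases "q \<in> arm v")
    case True
    then show ?thesis using in_ball[of q] k_cball[OF v] by auto
  next
    case False
    then have "norm (q - pos v) \<le> \<rho>" using that rP(3)[of q] unfolding rP(2) by blast
    then show ?thesis by (simp add: dist_norm norm_minus_commute)
  qed
  have Q_ball: "dist (pos v) q \<le> \<rho>" if "{v, x} \<in> E" "q \<in> path_image (Q x)" for x q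
  proof (cases "q \<in> path_image (A x +++ k x)")
    case True
    then show ?thesis using in_ball[of q] bx(5)[OF that(1)] by auto
  next
    case False
    then have "norm (q - pos v) \<le> \<rho>"
      using that(2) rQ(3)[OF that(1), of q] unfolding rQ(2)[OF that(1)] bx(4)[OF that(1)] by blast
    then show ?thesis by (simp add: dist_norm norm_minus_commute)
  qed
  have P0: "P 0 = pos v" and P1: "P 1 = far v"
    using pos_k[OF v] by (auto simp: P_def joinpaths_def linepath_def)
  have Q0: "Q x 0 = pos v" and Q1: "Q x 1 = far x" if "{v, x} \<in> E" for x
    using edge_arc(2)[OF that] by (auto simp: Q_def A_def joinpaths_def linepath_def pathstart_def)
  have arc_ne: "X t \<noteq> X 0" if "arc X" "t \<in> {0<..1}" for X :: "real \<Rightarrow> complex" and t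
    using that by (auto simp: arc_def dest: inj_onD[of X _ t 0])
  have in_im: "X t \<in> path_image X" if "t \<in> {0<..1}" for X :: "real \<Rightarrow> complex" and t
    using that by (auto simp: path_image_def)
  have germP: "same_germ \<delta> P"
    unfolding P_def by (rule same_germ_trans[OF \<delta>(3) same_germ_join])
  have germQ: "same_germ (A x) (Q x)" for x
    unfolding Q_def by (rule same_germ_trans[OF same_germ_join same_germ_join])
  have d0: "\<delta> 0 = pos v" using \<delta>(2) by (simp add: pathstart_def)
  have A0: "A x 0 = pos v" "arc (A x)" if "{v, x} \<in> E" for x
    using edge_arc[OF that] by (auto simp: A_def pathstart_def)
  let ?f = "first_hit (pos v)"
  let ?h = "\<lambda>r g. Arg2pi ((?f r g - pos v) / (?f r \<delta> - pos v))"
  have "eventually (\<lambda>r. ?f r P = ?f r \<delta>) (at_right 0)"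
    using first_hit_same_germ[OF \<delta>(1) arc_imp_path[OF rP(1)] germP] d0 by simp
  moreover have "eventually (\<lambda>r. ?f r (Q z) = ?f r (A z)) (at_right 0)"
    using first_hit_same_germ[OF A0(2)[OF z] arc_imp_path[OF rQ(1)[OF z]] germQ] A0(1)[OF z] by simp
  moreover have "eventually (\<lambda>r. ?f r (Q w) = ?f r (A w)) (at_right 0)"
    using first_hit_same_germ[OF A0(2)[OF w(1)] arc_imp_path[OF rQ(1)[OF w(1)]] germQ] A0(1)[OF w(1)] by simp
  moreover have "eventually (\<lambda>r. r \<in> {0<..<\<rho>}) (at_right 0)"
    using \<rho> R(1) norm_ge_zero[of "pos v"] by (intro eventually_at_right_real) linarith
  moreover have "eventually (\<lambda>r. 
      0 < ?h r (A z) \<and>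
      ?h r (A z) <
      ?h r (A w)) (at_right 0)"
    using ccw unfolding ccw_at_def
  proof (rule eventually_mono)
    fix r
    assume "sorted_wrt (<) (map (\<lambda>g. Arg2pi ((?f r g - pos v) /
         (?f r (hd (\<delta> # map (\<lambda>w. along (\<gamma> {v, w}) (pos v) (pos w)) (z # zs))) - pos v)))
         (\<delta> # map (\<lambda>w. along (\<gamma> {v, w}) (pos v) (pos w)) (z # zs)))"
    \<comment> \<open>The list is sorted strictly by angle and its first angle is nonnegative, which
      makes the angle of \<open>A z\<close> positive.\<close>
    then have "?h r \<delta> < ?h r (A z)" "?h r (A z) < ?h r (A w)" using w_in by (auto simp: A_def)
    moreover have "?h r \<delta> \<ge> 0" by (rule Arg2pi_ge_0)
    ultimately show "0 < ?h r (A z) \<and> ?h r (A z) < ?h r (A w)" by linarith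
  qed
  ultimately have "eventually (\<lambda>r. ?f r P = ?f r \<delta> \<and> ?f r (Q z) = ?f r (A z) \<and>
      ?f r (Q w) = ?f r (A w) \<and> r \<in> {0<..<\<rho>} \<and> 0 < ?h r (A z) \<and> ?h r (A z) < ?h r (A w)) (at_right 0)"
    by eventually_elim blast
  then obtain r where r: "?f r P = ?f r \<delta>" "?f r (Q z) = ?f r (A z)" "?f r (Q w) = ?f r (A w)"
      "r \<in> {0<..<\<rho>}" "0 < ?h r (A z)" "?h r (A z) < ?h r (A w)"
    using eventually_happens'[OF trivial_limit_at_right_real] by blast
  have "Arg2pi ((Q z 1 - pos v) / (P 1 - pos v)) < Arg2pi ((Q w 1 - pos v) / (P 1 - pos v))"
  proof (rule cyclic_order_at_centre_eq_at_ends[where \<rho> = \<rho> and r = r])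
    show "path P" "path (Q z)" "path (Q w)" using rP(1) rQ(1)[OF z] rQ(1)[OF w(1)] by (auto simp: arc_imp_path)
    show "P 0 = pos v" "Q z 0 = pos v" "Q w 0 = pos v" using P0 Q0 z w by auto
    show "P t \<noteq> pos v \<and> Q z t \<noteq> pos v \<and> Q w t \<noteq> pos v" if "t \<in> {0<..1}" for t
      using arc_ne[OF rP(1) that] arc_ne[OF rQ(1)[OF z] that] arc_ne[OF rQ(1)[OF w(1)] that] P0 Q0 z w by auto
    show "dist (pos v) (P t) \<le> \<rho> \<and> dist (pos v) (Q z t) \<le> \<rho> \<and> dist (pos v) (Q w t) \<le> \<rho>" if "t \<in> {0<..1}" for t
      using P_ball Q_ball[OF z] Q_ball[OF w(1)] in_im[OF that] by blast
    show "dist (pos v) (P 1) = \<rho>" "dist (pos v) (Q z 1) = \<rho>" "dist (pos v) (Q w 1) = \<rho>"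
      using rP(4) rQ(4)[OF z] rQ(4)[OF w(1)] P1 Q1[OF z] Q1[OF w(1)] by (auto simp: dist_norm norm_minus_commute)
    show "P s \<noteq> Q z t \<and> P s \<noteq> Q w t \<and> Q z s \<noteq> Q w t" if "s \<in> {0<..1}" "t \<in> {0<..1}" for s t
    proof -
      have "P s \<noteq> pos v" "Q z s \<noteq> pos v" using arc_ne[OF rP(1) that(1)] arc_ne[OF rQ(1)[OF z] that(1)] P0 Q0[OF z] by auto
      then show ?thesis using PQ[OF z] PQ[OF w(1)] QQ in_im[OF that(1)] in_im[OF that(2)]
        by (metis (no_types, lifting) IntI singletonD subsetD)
    qed
  qed (use r in auto)
  \<comment> \<open>\<open>far x\<close> lies on the ray from \<open>pos v\<close> through
    \<open>y x\<close>, and positive factors do not change \<open>Arg2pi\<close>.\<close>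
  moreover have far_dir: "Arg2pi ((far x - pos v) / (far v - pos v)) = Arg2pi ((y x - pos v) / (y v - pos v))"
    if x: "{v, x} \<in> E" for x
  proof -
    obtain s t where st: "0 < s" "far x - pos v = of_real s * (y x - pos v)"
      "0 < t" "far v - pos v = of_real t * (y v - pos v)" using rQ(6)[OF x] rP(6) by blast
    have "(far x - pos v) / (far v - pos v) = of_real (s / t) * ((y x - pos v) / (y v - pos v))"
      using st by simp
    then show ?thesis
      using Arg2pi_times_of_real[of "s / t" "(y x - pos v) / (y v - pos v)"] st(1,3)
      by (metis divide_pos_pos)
  qed
  ultimately have "Arg2pi ((y z - pos v) / (y v - pos v)) < Arg2pi ((y w - pos v) / (y v - pos v))"
    using P1 Q1[OF z] Q1[OF w(1)] z w by simp
  then show ?thesis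
    unfolding angle_def
  proof (rule order_on_circle_from_inside[rotated -1])
    show "norm (y v) = R" "norm (y z) = R" "norm (y w) = R" using finish_k v V by auto
    show "y v \<noteq> y z" "y v \<noteq> y w" "y z \<noteq> y w"
      using y_inj[OF v V(1)] y_inj[OF v V(2)] y_inj[OF V(1,2)] V w(2) by auto
  qed (rule pv)
qed

text \<open>The successor \<open>w\<close> is adjacent to \<open>v\<close>, so it is in the list. A
  different head \<open>z\<close> would precede \<open>w\<close> on the circle as seen from
  \<open>v\<close>, and hence lie strictly between \<open>v\<close> and \<open>w\<close>.\<close>

lemma first_neighbour_next:
  assumes u: "u \<in> V" and v: "v \<in> V" and \<delta>: "arc \<delta>" "pathstart \<delta> = pos v" "same_germ \<delta> (k v)"
    and nb: "set ws = {w. {v, w} \<in> E}"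
    and ccw: "ccw_at (pos v) (\<delta> # map (\<lambda>w. along (\<gamma> {v, w}) (pos v) (pos w)) ws)"
    and w: "w \<in> V" "angle u v < angle u w"
    and no: "\<And>x. x \<in> V \<Longrightarrow> \<not> (angle u v < angle u x \<and> angle u x < angle u w)"
  shows "ws \<noteq> [] \<and> hd ws = w"
proof -
  have e: "{v, w} \<in> E" by (rule consecutive_adjacent[OF u v w no])
  then have win: "w \<in> set ws" using nb by auto
  then obtain z zs where ws: "ws = z # zs" by (cases ws) auto
  have "z = w"
  proof (rule ccontr)
    assume "z \<noteq> w"
    have z: "{v, z} \<in> E" using nb ws by auto
    have zV: "z \<in> V" "v \<noteq> z" using edge_ends[OF z] by auto
    have less: "angle v z < angle v w"
      using first_neighbour_least[OF v \<delta> z e \<open>z \<noteq> w\<close>] ccw win ws \<open>z \<noteq> w\<close> by auto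
    \<comment> \<open>Changing the base point from \<open>u\<close> to \<open>v\<close> is a
      rotation. Points before \<open>v\<close> gain a full turn and so come after \<open>w\<close>,
      whose angle from \<open>u\<close> is less than a full turn.\<close>
    have rel: "angle v x = (if angle u v \<le> angle u x then angle u x - angle u v else angle u x - angle u v + 2 * pi)"
      if "x \<in> V" for x
    proof -
      have "y x / y u / (y v / y u) = y x / y v" using y_nonzero[OF u] by simp
      then show ?thesis
        using Arg2pi_diff[of "y x / y u" "y v / y u"] y_nonzero[OF u] y_nonzero[OF v] y_nonzero[OF that]
        by (auto simp: angle_def split: if_splits)
    qed
    show False
      using less rel[OF w(1)] rel[OF zV(1)] w(2) no[OF zV(1)] angle_inj[OF u v zV(1)] zV(2)
        angle_bounds[of u z] angle_bounds[of u w] by (auto split: if_splits)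
  qed
  then show ?thesis using ws by simp
qed

end

section \<open>Bars from a vertex order\<close>

definition order_rank :: "'a set \<Rightarrow> ('a \<Rightarrow> real) \<Rightarrow> 'a \<Rightarrow> nat" where
  "order_rank V \<theta> v = card {w \<in> V. \<theta> w < \<theta> v}"

lemma rank_mono: "finite V \<Longrightarrow> \<theta> v \<le> \<theta> w \<Longrightarrow> order_rank V \<theta> v \<le> order_rank V \<theta> w"
  unfolding order_rank_def by (intro card_mono) auto

lemma rank_strict_mono: "finite V \<Longrightarrow> v \<in> V \<Longrightarrow> \<theta> v < \<theta> w \<Longrightarrow> order_rank V \<theta> v < order_rank V \<theta> w"
  unfolding order_rank_def by (intro psubset_card_mono) auto

lemma rank_less_iff: "finite V \<Longrightarrow> v \<in> V \<Longrightarrow> order_rank V \<theta> v < order_rank V \<theta> w \<longleftrightarrow> \<theta> v < \<theta> w"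
  using rank_strict_mono rank_mono by (metis linorder_not_less)

lemma rank_bij:
  assumes "finite V" "inj_on \<theta> V"
  shows "bij_betw (order_rank V \<theta>) V {..<card V}"
proof -
  have inj: "inj_on (order_rank V \<theta>) V"
  proof (rule inj_onI)
    fix v w assume vw: "v \<in> V" "w \<in> V" "order_rank V \<theta> v = order_rank V \<theta> w"
    then have "\<theta> v = \<theta> w"
      using rank_less_iff[OF assms(1) vw(1), of \<theta> w] rank_less_iff[OF assms(1) vw(2), of \<theta> v] by auto
    then show "v = w" using assms(2) vw by (simp add: inj_on_def)
  qed
  have "order_rank V \<theta> v < card V" if "v \<in> V" for v
    unfolding order_rank_def using assms(1) that by (intro psubset_card_mono) auto
  then have "order_rank V \<theta> ` V \<subseteq> {..<card V}" by auto
  moreover have "card (order_rank V \<theta> ` V) = card {..<card V}" using inj by (simp add: card_image)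
  ultimately have "order_rank V \<theta> ` V = {..<card V}" by (intro card_subset_eq) auto
  then show ?thesis using inj by (simp add: bij_betw_def)
qed

definition almost_noncrossing :: "'a set set \<Rightarrow> ('a \<Rightarrow> 'b::linorder) \<Rightarrow> bool" where
  "almost_noncrossing E \<rho> \<longleftrightarrow> (\<forall>e\<in>E. \<exists>\<^sub>\<le>\<^sub>1f. f \<in> E \<and> interleaved \<rho> e f)"

lemma almost_noncrossing_rank:
  assumes V: "finite V" and E: "\<And>e. e \<in> E \<Longrightarrow> e \<subseteq> V" and nc: "almost_noncrossing E \<theta>"
  shows "almost_noncrossing E (order_rank V \<theta>)"
proof -
  have "interleaved \<theta> e f" if ef: "e \<in> E" "f \<in> E" "interleaved (order_rank V \<theta>) e f" for e f
  proof -
    obtain a b c d where "order_rank V \<theta> a < order_rank V \<theta> b" "order_rank V \<theta> b < order_rank V \<theta> c" "order_rank V \<theta> c < order_rank V \<theta> d"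
      "e = {a, c} \<and> f = {b, d} \<or> e = {b, d} \<and> f = {a, c}"
      using ef(3) unfolding interleaved_def by blast
    moreover from this have "a \<in> V" "b \<in> V" "c \<in> V" using E[OF ef(1)] E[OF ef(2)] by auto
    ultimately show ?thesis unfolding interleaved_def using rank_less_iff[OF V] by metis
  qed
  then show ?thesis using nc unfolding almost_noncrossing_def Uniq_def by blast
qed

text \<open>The absolute difference of ranks, written with truncated subtraction as the program
  computes it.\<close>

definition gap :: "('a \<Rightarrow> nat) \<Rightarrow> 'a \<Rightarrow> 'a \<Rightarrow> nat" where
  "gap \<rho> u v = (\<rho> u - \<rho> v) + (\<rho> v - \<rho> u)"

lemma gap_commute: "gap \<rho> u v = gap \<rho> v u"
  by (simp add: gap_def)

text \<open>A drawing asks for an abscissa per edge as a set; the symmetry of \<open>gap\<close>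
  makes the value independent of how the set is written.\<close>

lemma gap_on_edges:
  obtains x :: "'a set \<Rightarrow> real" where "\<And>u v. x {u, v} = real (gap \<rho> u v)"
proof
  show "real (THE d. \<exists>a b. {u, v} = {a, b} \<and> d = gap \<rho> a b) = real (gap \<rho> u v)" for u v
    by (rule arg_cong[of _ _ real], rule the_equality) (auto simp: doubleton_eq_iff gap_commute)
qed

text \<open>A bar \<open>w\<close> met by the edge \<open>{u, v}\<close> is long enough only because of an edge at \<open>w\<close> that is
  interleaved with \<open>{u, v}\<close>.\<close>

lemma bar_1_visibility_drawing_rank:
  assumes G: "simple_graph V E" and inj: "inj_on \<rho> V" and nc: "almost_noncrossing E \<rho>"
    and r1: "\<And>v. v \<in> V \<Longrightarrow> 1 \<le> r v"
    and r: "\<And>v w. {v, w} \<in> E \<Longrightarrow> gap \<rho> v w \<le> r v"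
    and r': "\<And>v. v \<in> V \<Longrightarrow> r v = 1 \<or> (\<exists>w. {v, w} \<in> E \<and> r v = gap \<rho> v w)"
    and x: "\<And>u v. {u, v} \<in> E \<Longrightarrow> x {u, v} = real (gap \<rho> u v)"
  shows "bar_1_visibility_drawing V E (\<lambda>v. real (\<rho> v)) (\<lambda>_. 0) (\<lambda>v. real (r v)) x"
  unfolding bar_1_visibility_drawing_def
proof (intro conjI allI impI ballI)
  let ?bar = "bar (\<lambda>v. real (\<rho> v)) (\<lambda>_. 0) (\<lambda>v. real (r v))"
  let ?seg = "\<lambda>u v. closed_segment (Complex (x {u, v}) (real (\<rho> u))) (Complex (x {u, v}) (real (\<rho> v)))"
  have bar: "z \<in> ?bar v \<longleftrightarrow>
      Im z = real (\<rho> v) \<and> 0 \<le> Re z \<and> Re z \<le> real (r v)" for z v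
    by (auto simp: bar_def closed_segment_same_Im closed_segment_eq_real_ivl)
  show "0 < real (r v)" if "v \<in> V" for v using r1[OF that] by simp
  show "?bar u \<inter> ?bar v = {}"
    if "u \<in> V" "v \<in> V" "u \<noteq> v" for u v
    using that inj by (auto simp: bar inj_on_def)
  fix u v assume e: "{u, v} \<in> E"
  have e': "{v, u} \<in> E" using e by (simp add: insert_commute)
  show "Complex (x {u, v}) (real (\<rho> u)) \<in> ?bar u"
    using r[OF e] x[OF e] by (simp add: bar)
  show "Complex (x {u, v}) (real (\<rho> v)) \<in> ?bar v"
    using r[OF e'] x[OF e] by (simp add: bar gap_commute[of \<rho> u v])
  have met: "\<exists>f\<in>E. interleaved \<rho> {u, v} f \<and> w \<in> f \<and> (\<forall>z\<in>f. z \<noteq> w \<longrightarrow> \<rho> z < min (\<rho> u) (\<rho> v) \<or> max (\<rho> u) (\<rho> v) < \<rho> z)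
      \<and> min (\<rho> u) (\<rho> v) < \<rho> w \<and> \<rho> w < max (\<rho> u) (\<rho> v)"
    if w: "w \<in> V - {u, v}" and ne: "?seg u v \<inter>
      ?bar w \<noteq> {}" for w
  proof -
    have V: "u \<in> V" "v \<in> V" using G e by (auto simp: simple_graph_def)
    obtain z where z: "Re z = x {u, v}" "Im z \<in> closed_segment (real (\<rho> u)) (real (\<rho> v))"
      "Im z = real (\<rho> w)" "Re z \<le> real (r w)"
      using ne by (auto simp: bar closed_segment_same_Re)
    have "\<rho> w \<noteq> \<rho> u" "\<rho> w \<noteq> \<rho> v" using w V inj by (auto simp: inj_on_def)
    then have btw: "min (\<rho> u) (\<rho> v) < \<rho> w" "\<rho> w < max (\<rho> u) (\<rho> v)"
      using z(2,3) by (auto simp: closed_segment_eq_real_ivl split: if_splits)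
    have long: "gap \<rho> u v \<le> r w" using z x[OF e] by simp
    \<comment> \<open>Since \<open>w\<close> is strictly between the ends, their gap is at least 2,
      and a bar of the default length 1 is too short.\<close>
    then have "r w \<noteq> 1" using btw by (auto simp: gap_def min_def max_def split: if_splits)
    then obtain q where q: "{w, q} \<in> E" "r w = gap \<rho> w q" using r' w by blast
    \<comment> \<open>From a rank strictly between two others, a step of at least their difference
      leads beyond one of them.\<close>
    have out: "\<rho> q < min (\<rho> u) (\<rho> v) \<or> max (\<rho> u) (\<rho> v) < \<rho> q"
      using long q(2) btw by (auto simp: gap_def min_def max_def split: if_splits)
    have "interleaved \<rho> {u, v} {w, q}"
    proof -
      define a b where "a = (if \<rho> u \<le> \<rho> v then u else v)" and "b = (if \<rho> u \<le> \<rho> v then v else u)"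
      have ab: "{u, v} = {a, b}" "min (\<rho> u) (\<rho> v) = \<rho> a" "max (\<rho> u) (\<rho> v) = \<rho> b"
        by (auto simp: a_def b_def)
      show ?thesis unfolding interleaved_def ab(1)
        using out btw unfolding ab(2,3)
        by (metis insert_commute)
    qed
    then show ?thesis using q(1) out btw by (intro bexI[of _ "{w, q}"]) auto
  qed
  show "\<exists>\<^sub>\<le>\<^sub>1w. w \<in> V - {u, v} \<and> ?seg u v \<inter>
      ?bar w \<noteq> {}"
  proof (rule Uniq_I, elim conjE)
    fix w w'
    assume w: "w \<in> V - {u, v}" "?seg u v \<inter>
        ?bar w \<noteq> {}"
      and w': "w' \<in> V - {u, v}" "?seg u v \<inter>
        ?bar w' \<noteq> {}"
    obtain f where f: "f \<in> E" "interleaved \<rho> {u, v} f" "w \<in> f" 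
      "\<forall>z\<in>f. z \<noteq> w \<longrightarrow> \<rho> z < min (\<rho> u) (\<rho> v) \<or> max (\<rho> u) (\<rho> v) < \<rho> z" using met[OF w] by blast
    obtain f' where f': "f' \<in> E" "interleaved \<rho> {u, v} f'" "w' \<in> f'"
      "min (\<rho> u) (\<rho> v) < \<rho> w'" "\<rho> w' < max (\<rho> u) (\<rho> v)" using met[OF w'] by blast
    \<comment> \<open>The other end of \<open>f\<close> is not between \<open>u\<close> and
      \<open>v\<close>, while \<open>w'\<close> is an end of \<open>f\<close> that is; so
      \<open>w'\<close> is \<open>w\<close>.\<close>
    have "f = f'" using nc e f f' unfolding almost_noncrossing_def Uniq_def by blast
    then show "w = w'" using f f' by force
  qed
qed

lemma bar_1_visible_rank:
  fixes \<rho> :: "'a \<Rightarrow> nat"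
  assumes G: "simple_graph V E" and inj: "inj_on \<rho> V" and nc: "almost_noncrossing E \<rho>"
  shows "bar_1_visible V E"
proof -
  have V: "finite V" using G by (simp add: simple_graph_def)
  \<comment> \<open>The element 1 gives a bar of positive length to a vertex without edges.\<close>
  define N where "N v = insert 1 (gap \<rho> v ` {w \<in> V. {v, w} \<in> E})" for v
  define r where "r v = Max (N v)" for v
  have N: "finite (N v)" "N v \<noteq> {}" for v using V by (auto simp: N_def)
  have edge_V: "w \<in> V" if "{v, w} \<in> E" for v w using G that by (auto simp: simple_graph_def)
  obtain x where x: "\<And>u v. x {u, v} = real (gap \<rho> u v)" using gap_on_edges[of \<rho>] by blast
  have "bar_1_visibility_drawing V E (\<lambda>v. real (\<rho> v)) (\<lambda>_. 0) (\<lambda>v. real (r v)) x"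
  proof (rule bar_1_visibility_drawing_rank[OF G inj nc])
    show "1 \<le> r v" for v unfolding r_def using N by (intro Max_ge) (auto simp: N_def)
    show "gap \<rho> v w \<le> r v" if "{v, w} \<in> E" for v w
      unfolding r_def using N edge_V[OF that] that by (intro Max_ge) (auto simp: N_def)
    show "r v = 1 \<or> (\<exists>w. {v, w} \<in> E \<and> r v = gap \<rho> v w)" for v
      using Max_in[OF N(1,2), of v] unfolding r_def[symmetric] by (auto simp: N_def)
  qed (rule x)
  then show ?thesis unfolding bar_1_visible_def by blast
qed

text \<open>Of the edges at \<open>i\<close> to higher vertices, all but two kinds are charged to \<open>i\<close>: such an edge \<open>(i, j)\<close>
  lies below the longest edge \<open>(i, m)\<close> and below some \<open>(i', j)\<close>, and only one edge is interleaved
  with \<open>(i, m)\<close>.\<close>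

lemma card_oriented_edges:
  fixes \<rho> :: "'a \<Rightarrow> nat"
  assumes G: "simple_graph V E" and inj: "inj_on \<rho> V" and nc: "almost_noncrossing E \<rho>"
  defines "P \<equiv> {(v, w). {v, w} \<in> E \<and> \<rho> v < \<rho> w}"
  shows "finite P" "card P \<le> 3 * card V"
proof -
  have V: "finite V" using G by (simp add: simple_graph_def)
  have PV: "P \<subseteq> V \<times> V" using G by (auto simp: P_def simple_graph_def)
  then show fin: "finite P" using V by (meson finite_SigmaI finite_subset)
  \<comment> \<open>\<open>A\<close> takes the edge from each vertex to its highest upper neighbour,
    \<open>B\<close> the one to its lowest lower neighbour. With the remaining edges there are three
    classes, each with at most one edge per vertex; hence the factor 3.\<close>
  define A where "A = {(v, w) \<in> P. \<forall>w'. (v, w') \<in> P \<longrightarrow> \<rho> w' \<le> \<rho> w}"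
  define B where "B = {(v, w) \<in> P. \<forall>v'. (v', w) \<in> P \<longrightarrow> \<rho> v \<le> \<rho> v'}"
  have sub: "A \<subseteq> P" "B \<subseteq> P" by (auto simp: A_def B_def)
  have cA: "card A \<le> card V"
  proof (rule card_inj_on_le[of fst])
    show "inj_on fst A"
    proof (rule inj_onI)
      fix p q assume pq: "p \<in> A" "q \<in> A" "fst p = fst q"
      then obtain i j j' where ij: "p = (i, j)" "q = (i, j')" by (cases p, cases q) auto
      have "\<rho> j = \<rho> j'" "j \<in> V" "j' \<in> V" using pq PV unfolding ij A_def by (auto intro: antisym)
      then show "p = q" using inj ij by (simp add: inj_on_def)
    qed
  qed (use sub PV V in auto)
  have cB: "card B \<le> card V"
  proof (rule card_inj_on_le[of snd])
    show "inj_on snd B"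
    proof (rule inj_onI)
      fix p q assume pq: "p \<in> B" "q \<in> B" "snd p = snd q"
      then obtain i j j' where ij: "p = (j, i)" "q = (j', i)" by (cases p, cases q) auto
      have "\<rho> j = \<rho> j'" "j \<in> V" "j' \<in> V" using pq PV unfolding ij B_def by (auto intro: antisym)
      then show "p = q" using inj ij by (simp add: inj_on_def)
    qed
  qed (use sub PV V in auto)
  have cC: "card (P - A - B) \<le> card V"
  proof (rule card_inj_on_le[of fst])
    show "inj_on fst (P - A - B)"
    proof (rule inj_onI)
      fix p q assume pq: "p \<in> P - A - B" "q \<in> P - A - B" "fst p = fst q"
      then obtain i j1 j2 where ij: "p = (i, j1)" "q = (i, j2)" by (cases p, cases q) auto
      define S where "S = {w. (i, w) \<in> P}"
      have S: "S \<subseteq> V" "S \<noteq> {}" using PV pq ij by (auto simp: S_def)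
      have "finite S" using finite_subset[OF S(1) V] .
      moreover from this have "Max (\<rho> ` S) \<in> \<rho> ` S" using S(2) by (intro Max_in) auto
      ultimately obtain m where "m \<in> S" "\<rho> m = Max (\<rho> ` S)" "finite S" by (metis imageE)
      then have m: "(i, m) \<in> P" "\<And>w. (i, w) \<in> P \<Longrightarrow> \<rho> w \<le> \<rho> m" by (auto simp: S_def)
      have charge: "\<exists>i'. {i', j} \<in> E \<and> \<rho> i' < \<rho> i \<and> \<rho> i < \<rho> j \<and> interleaved \<rho> {i, m} {i', j}"
        if j: "(i, j) \<in> P - A - B" for j
      proof -
        obtain i' where i': "(i', j) \<in> P" "\<rho> i' < \<rho> i" using j by (auto simp: B_def not_le)
        obtain w where "(i, w) \<in> P" "\<rho> j < \<rho> w" using j by (auto simp: A_def not_le)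
        then have "\<rho> j < \<rho> m" using m(2) by fastforce
        moreover have "\<rho> i < \<rho> j" using j by (auto simp: P_def)
        ultimately have "interleaved \<rho> {i, m} {i', j}" unfolding interleaved_def using i'(2) by blast
        then show ?thesis using i' \<open>\<rho> i < \<rho> j\<close> by (auto simp: P_def)
      qed
      obtain i1 where i1: "{i1, j1} \<in> E" "\<rho> i1 < \<rho> i" "\<rho> i < \<rho> j1" "interleaved \<rho> {i, m} {i1, j1}"
        using charge pq ij by blast
      obtain i2 where i2: "{i2, j2} \<in> E" "\<rho> i2 < \<rho> i" "\<rho> i < \<rho> j2" "interleaved \<rho> {i, m} {i2, j2}"
        using charge pq ij by blast
      have "{i, m} \<in> E" using m by (simp add: P_def)
      then have "{i1, j1} = {i2, j2}"
        using nc i1 i2 unfolding almost_noncrossing_def Uniq_def by blast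
      \<comment> \<open>\<open>i1\<close> and \<open>i2\<close> rank below \<open>i\<close>,
        \<open>j1\<close> and \<open>j2\<close> above it, so equal edges have equal upper
        ends.\<close>
      then have "j1 = j2" using i1 i2 by (auto simp: doubleton_eq_iff)
      then show "p = q" using ij by simp
    qed
  qed (use PV V in auto)
  have "P = A \<union> B \<union> (P - A - B)" using sub by auto
  then have "card P \<le> card (A \<union> B) + card (P - A - B)" by (metis card_Un_le)
  also have "card (A \<union> B) \<le> card A + card B" by (rule card_Un_le)
  finally show "card P \<le> 3 * card V" using cA cB cC by simp
qed

section \<open>The vertex order given by a drawing\<close>

context circle_access
begin

lemma angle_almost_noncrossing:
  assumes "outer_1_plane V E pos \<gamma>" "u \<in> V"
  shows "almost_noncrossing E (angle u)"
  unfolding almost_noncrossing_def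
  using at_most_one_interleaved[OF assms(2)] assms(1) by (auto simp: outer_1_plane_def)

end

lemma outer_1_plane_bar_1_visible:
  assumes "outer_1_plane V E pos \<gamma>"
  shows "bar_1_visible V E"
proof -
  have G: "simple_graph V E" using assms by (auto simp: outer_1_plane_def drawing_def)
  have V: "finite V" and EV: "\<And>e. e \<in> E \<Longrightarrow> e \<subseteq> V" using G by (auto simp: simple_graph_def)
  obtain R k where "circle_access V E pos \<gamma> R k" using outer_1_plane_circle_access[OF assms] by blast
  then interpret circle_access V E pos \<gamma> R k .
  obtain \<theta> :: "'a \<Rightarrow> real" where \<theta>: "inj_on \<theta> V" "almost_noncrossing E \<theta>"
  proof (cases "V = {}")
    case True
    then have "almost_noncrossing E (\<lambda>_. 0::real)" by (auto simp: almost_noncrossing_def interleaved_def Uniq_def)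
    then show ?thesis using that[of "\<lambda>_. 0"] True by auto
  next
    case False
    then obtain u where u: "u \<in> V" by blast
    then show ?thesis
      using that[of "angle u"] angle_almost_noncrossing[OF assms u] angle_inj[OF u] by (auto simp: inj_on_def)
  qed
  show ?thesis
    using bar_1_visible_rank[OF G _ almost_noncrossing_rank[OF V EV \<theta>(2)]] rank_bij[OF V \<theta>(1)]
    by (auto simp: bij_betw_def)
qed

text \<open>The arcs \<delta> are shortened into small balls before they are extended to the circle.
  The resulting arm meets the drawing only at its vertex; the rest of it is connected and ends far
  away, so it lies in the outer face.\<close>

lemma outer_access_from_description:
  fixes n :: nat
  assumes max: "maximal_outer_1_plane {..<n} E pos \<gamma>" and desc: "describes adj cr n E pos \<gamma>"
  obtains R k \<delta> where "outer_access {..<n} E pos \<gamma> R k"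
    "\<And>v. v < n \<Longrightarrow> arc (\<delta> v)" "\<And>v. v < n \<Longrightarrow> pathstart (\<delta> v) = pos v"
    "\<And>v. v < n \<Longrightarrow> same_germ (\<delta> v) (k v)"
    "\<And>v. v < n \<Longrightarrow> ccw_at (pos v) (\<delta> v # map (\<lambda>w. along (\<gamma> {v, w}) (pos v) (pos w)) (adj ! v))"
proof -
  let ?D = "drawn_set {..<n} E pos \<gamma>"
  have dr: "drawing {..<n} E pos \<gamma>" using max by (auto simp: maximal_outer_1_plane_def outer_1_plane_def)
  obtain \<epsilon> where \<epsilon>: "\<epsilon> > 0" "separates {..<n} E pos \<gamma> \<epsilon>"
    using vertices_separated[OF dr] by blast
  let ?access = "\<lambda>v d. arc d \<and> pathstart d = pos v \<and> path_image d - {pos v} \<subseteq> outside ?D \<and>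
      ccw_at (pos v) (d # map (\<lambda>w. along (\<gamma> {v, w}) (pos v) (pos w)) (adj ! v))"
  have "\<exists>\<delta>. \<forall>v. v < n \<longrightarrow> ?access v (\<delta> v)"
    using desc unfolding describes_def by (intro choice) blast
  then obtain \<delta> where \<delta>': "\<forall>v. v < n \<longrightarrow> ?access v (\<delta> v)" ..
  have \<delta>: "arc (\<delta> v)" "pathstart (\<delta> v) = pos v" "path_image (\<delta> v) - {pos v} \<subseteq> outside ?D"
    "ccw_at (pos v) (\<delta> v # map (\<lambda>w. along (\<gamma> {v, w}) (pos v) (pos w)) (adj ! v))" if "v < n" for v
    using \<delta>'[rule_format, OF that] by blast+
  have "\<exists>t. 0 < t \<and> t \<le> 1 \<and> (\<forall>s\<in>{0..t}. dist (\<delta> v s) (pos v) < \<epsilon>)" if v: "v < n" for v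
  proof -
    have "continuous (at 0 within {0..1}) (\<delta> v)"
      using \<delta>(1)[OF v] by (auto simp: arc_def path_def continuous_on_eq_continuous_within)
    then obtain d where d: "d > 0" "\<And>s. s \<in> {0..1} \<Longrightarrow> dist s 0 < d \<Longrightarrow> dist (\<delta> v s) (\<delta> v 0) < \<epsilon>"
      using \<epsilon>(1) unfolding continuous_within_eps_delta by metis
    have "\<delta> v 0 = pos v" using \<delta>(2)[OF v] by (simp add: pathstart_def)
    then show ?thesis using d by (intro exI[of _ "min 1 (d/2)"]) (auto simp: dist_real_def)
  qed
  then obtain t where t: "\<And>v. v < n \<Longrightarrow> 0 < t v" "\<And>v. v < n \<Longrightarrow> t v \<le> 1"
    "\<And>v s. v < n \<Longrightarrow> s \<in> {0..t v} \<Longrightarrow> dist (\<delta> v s) (pos v) < \<epsilon>" by metis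
  define s where "s v = subpath 0 (t v) (\<delta> v)" for v
  have s_im: "path_image (s v) = \<delta> v ` {0..t v}" if "v < n" for v
    unfolding s_def using t(1)[OF that] by (simp add: path_image_subpath)
  have s_sub: "path_image (s v) \<subseteq> path_image (\<delta> v)" if "v < n" for v
    unfolding s_im[OF that] using t(2)[OF that] by (auto simp: path_image_def)
  have s: "arc (s v)" "pathstart (s v) = pos v" "path_image (s v) \<subseteq> ball (pos v) \<epsilon>"
    "pathfinish (s v) \<in> outside ?D" "same_germ (\<delta> v) (s v)" if v: "v < n" for v
  proof -
    show "arc (s v)" unfolding s_def using \<delta>(1)[OF v] t(1,2)[OF v] by (intro arc_subpath_arc) auto
    show "pathstart (s v) = pos v" using \<delta>(2)[OF v] by (simp add: s_def pathstart_def subpath_def)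
    show "path_image (s v) \<subseteq> ball (pos v) \<epsilon>" unfolding s_im[OF v] using t(3)[OF v] by (auto simp: dist_commute)
    show "same_germ (\<delta> v) (s v)" unfolding s_def using t[OF v] by (intro same_germ_subpath) auto
    have "\<delta> v (t v) \<noteq> pos v"
      using \<delta>(1,2)[OF v] t(1,2)[OF v] by (auto simp: arc_def pathstart_def dest: inj_onD[of "\<delta> v" _ "t v" 0])
    moreover have "\<delta> v (t v) \<in> path_image (\<delta> v)" using t(1,2)[OF v] by (auto simp: path_image_def)
    ultimately show "pathfinish (s v) \<in> outside ?D" using \<delta>(3)[OF v] by (auto simp: s_def pathfinish_def subpath_def)
  qed
  obtain R k where k: "circle_access {..<n} E pos \<gamma> R k" "\<And>v. v \<in> {..<n} \<Longrightarrow> same_germ (s v) (k v)"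
    "\<And>v. v \<in> {..<n} \<Longrightarrow> path_image (k v) \<inter> ?D \<subseteq> path_image (s v)"
  proof (rule circle_access_from_arcs[where V = "{..<n}" and E = E and pos = pos and \<gamma> = \<gamma> and \<epsilon> = \<epsilon> and s = s])
    show "drawing {..<n} E pos \<gamma>" by (fact dr)
    show "separates {..<n} E pos \<gamma> \<epsilon>" by (fact \<epsilon>)
    show "arc (s v)" "pathstart (s v) = pos v" "path_image (s v) \<subseteq> ball (pos v) \<epsilon>"
      "pathfinish (s v) \<in> outside ?D" if "v \<in> {..<n}" for v using s[of v] that by auto
  qed (rule that)
  interpret circle_access "{..<n}" E pos \<gamma> R k by (rule k(1))
  have "outer_access {..<n} E pos \<gamma> R k"
  proof
    show "maximal_outer_1_plane {..<n} E pos \<gamma>" by (rule max)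
    fix v assume v: "v \<in> {..<n}"
    have vD: "pos v \<in> ?D" using v by (auto simp: drawn_set_def)
    have "path_image (k v) \<inter> ?D \<subseteq> {pos v}"
      using k(3)[OF v] s_sub[of v] \<delta>(3)[of v] v outside_no_overlap[of ?D] by blast
    moreover have "k v t \<noteq> pos v" if "t \<in> {0<..1}" for t
      using arc_k[OF v] start_k[OF v] that by (auto simp: arc_def pathstart_def dest: inj_onD[of "k v" _ t 0])
    moreover have "k v ` {0<..1} \<subseteq> path_image (k v)" by (auto simp: path_image_def)
    ultimately have disj: "(k v ` {0<..1}) \<inter> ?D = {}" by blast
    have conn: "connected (k v ` {0<..1})"
      using arc_k[OF v] by (intro connected_continuous_image) (auto simp: arc_def path_def intro: continuous_on_subset)
    have fin: "pathfinish (k v) \<in> k v ` {0<..1}" by (auto simp: pathfinish_def)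
    have out: "pathfinish (k v) \<in> outside ?D"
      using outside_subset_convex[OF convex_ball R(2)] finish_k[OF v] by auto
    have "k v ` {0<..1} \<subseteq> outside ?D"
    proof
      fix z assume "z \<in> k v ` {0<..1}"
      then have "connected_component (- ?D) (pathfinish (k v)) z"
        unfolding connected_component_def using conn disj fin by blast
      then show "z \<in> outside ?D" using out by (rule outside_same_component)
    qed
    moreover have "path_image (k v) - {pos v} \<subseteq> k v ` {0<..1}"
    proof
      fix z assume "z \<in> path_image (k v) - {pos v}"
      then obtain a where "a \<in> {0..1}" "z = k v a" "z \<noteq> k v 0"
        using start_k[OF v] by (auto simp: path_image_def pathstart_def)
      then show "z \<in> k v ` {0<..1}" by (cases "a = 0") auto
    qed
    ultimately show "path_image (k v) - {pos v} \<subseteq> outside ?D" by blast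
  qed
  moreover have "same_germ (\<delta> v) (k v)" if "v < n" for v
    using same_germ_trans[OF s(5)[OF that] k(2)] that by auto
  ultimately show ?thesis using that \<delta> by blast
qed

text \<open>The circle is cut at vertex 0, where the program starts its walk. Consecutive ranks mean
  that no vertex lies between on the circle, so \<open>first_neighbour_next\<close> applies to all
  vertices but the last.\<close>

lemma boundary_order:
  assumes max: "maximal_outer_1_plane {..<n} E pos \<gamma>" and desc: "describes adj cr n E pos \<gamma>" and n: "0 < n"
  obtains \<rho> :: "nat \<Rightarrow> nat" where "bij_betw \<rho> {..<n} {..<n}" "\<rho> 0 = 0" "almost_noncrossing E \<rho>"
    "\<And>v. v < n \<Longrightarrow> \<rho> v + 1 < n \<Longrightarrow> adj ! v \<noteq> [] \<and> \<rho> (hd (adj ! v)) = \<rho> v + 1"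
proof -
  have op: "outer_1_plane {..<n} E pos \<gamma>" using max by (simp add: maximal_outer_1_plane_def)
  obtain R k \<delta> where acc: "outer_access {..<n} E pos \<gamma> R k"
    and \<delta>: "\<And>v. v < n \<Longrightarrow> arc (\<delta> v)" "\<And>v. v < n \<Longrightarrow> pathstart (\<delta> v) = pos v"
    "\<And>v. v < n \<Longrightarrow> same_germ (\<delta> v) (k v)"
    "\<And>v. v < n \<Longrightarrow> ccw_at (pos v) (\<delta> v # map (\<lambda>w. along (\<gamma> {v, w}) (pos v) (pos w)) (adj ! v))"
    by (rule outer_access_from_description[OF max desc]) (rule that)
  interpret outer_access "{..<n}" E pos \<gamma> R k by (rule acc)
  have V0: "0 \<in> {..<n}" using n by simp
  have inj: "inj_on (angle 0) {..<n}" using angle_inj[OF V0] by (auto simp: inj_on_def)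
  define \<rho> where "\<rho> = order_rank {..<n} (angle 0)"
  have bij: "bij_betw \<rho> {..<n} {..<n}" using rank_bij[OF _ inj] by (simp add: \<rho>_def)
  have less: "\<rho> v < \<rho> w \<longleftrightarrow> angle 0 v < angle 0 w" if "v < n" for v w
    unfolding \<rho>_def using that by (intro rank_less_iff) auto
  have "\<rho> 0 = card {w \<in> {..<n}. angle 0 w < 0}" by (simp add: \<rho>_def order_rank_def angle_self[OF V0])
  also have "{w \<in> {..<n}. angle 0 w < 0} = {}" using angle_bounds(1) by (auto simp: not_less)
  finally have "\<rho> 0 = 0" by simp
  moreover have "almost_noncrossing E \<rho>"
    unfolding \<rho>_def using angle_almost_noncrossing[OF op V0] edge_subset by (intro almost_noncrossing_rank) auto
  moreover have "adj ! v \<noteq> [] \<and> \<rho> (hd (adj ! v)) = \<rho> v + 1" if v: "v < n" "\<rho> v + 1 < n" for v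
  proof -
    have "\<rho> v + 1 \<in> \<rho> ` {..<n}" using bij v(2) by (auto simp: bij_betw_def)
    then obtain w where w: "w < n" "\<rho> w = \<rho> v + 1" by auto
    have "adj ! v \<noteq> [] \<and> hd (adj ! v) = w"
    proof (rule first_neighbour_next[OF V0])
      show "set (adj ! v) = {w. {v, w} \<in> E}" using desc v(1) unfolding describes_def by blast
      show "angle 0 v < angle 0 w" using less[OF v(1), of w] w by simp
      show "\<not> (angle 0 v < angle 0 x \<and> angle 0 x < angle 0 w)" if "x \<in> {..<n}" for x
        using less[OF v(1), of x] less[of x w] that w by auto
    qed (use v w \<delta> in auto)
    then show ?thesis using w by simp
  qed
  ultimately show ?thesis using that bij by blast
qed

section \<open>The program\<close>

text \<open>Weakest preconditions for loop-free code, evaluated by simplification. A loop gets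
  \<open>False\<close> so that \<open>runs_wp\<close> remains sound; loops are treated by
  \<open>runs_While\<close>.\<close>

fun wp :: "nat \<Rightarrow> com \<Rightarrow> (state \<Rightarrow> bool) \<Rightarrow> state \<Rightarrow> bool" where
  "wp B Skip Q s = Q s"
| "wp B (Assign i a) Q s = (aval a s \<le> B \<and> Q ((fst s)(i := aval a s), snd s))"
| "wp B (Store p a) Q s = (aval p s \<le> B \<and> aval a s \<le> B \<and> Q (fst s, (snd s)(aval p s := aval a s)))"
| "wp B (Seq c d) Q s = wp B c (wp B d Q) s"
| "wp B (Cond b c d) Q s = (if bval b s then wp B c Q s else wp B d Q s)"
| "wp B (While b c) Q s = False"

fun steps :: "com \<Rightarrow> nat" where
  "steps Skip = 1"
| "steps (Assign i a) = 1"
| "steps (Store p a) = 1"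
| "steps (Seq c d) = steps c + steps d"
| "steps (Cond b c d) = 1 + max (steps c) (steps d)"
| "steps (While b c) = 0"

definition runs :: "nat \<Rightarrow> com \<Rightarrow> state \<Rightarrow> nat \<Rightarrow> (state \<Rightarrow> bool) \<Rightarrow> bool" where
  "runs B c s T Q \<longleftrightarrow> (\<exists>t s'. exec B c s t s' \<and> t \<le> T \<and> Q s')"

lemma runs_wp: "wp B c Q s \<Longrightarrow> runs B c s (steps c) Q"
proof (induction c arbitrary: Q s)
  case (Seq c d)
  then have "runs B c s (steps c) (wp B d Q)" by simp
  then obtain t s' where 1: "exec B c s t s'" "t \<le> steps c" "wp B d Q s'"
    unfolding runs_def by blast
  then obtain t' s'' where 2: "exec B d s' t' s''" "t' \<le> steps d" "Q s''"
    using Seq.IH(2)[of Q s'] unfolding runs_def by blast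
  then show ?case
    using 1 exec.Seq[OF 1(1) 2(1)] unfolding runs_def by (intro exI[of _ "t + t'"] exI[of _ s'']) simp
next
  case (Cond b c d)
  show ?case
  proof (cases "bval b s")
    case True
    then have "runs B c s (steps c) Q" using Cond by simp
    then obtain t s' where "exec B c s t s'" "t \<le> steps c" "Q s'"
      unfolding runs_def by blast
    then show ?thesis using exec.Cond_True[OF True, of B c t s' d] unfolding runs_def
      by (intro exI[of _ "1 + t"] exI[of _ s']) simp
  next
    case False
    then have "runs B d s (steps d) Q" using Cond by simp
    then obtain t s' where "exec B d s t s'" "t \<le> steps d" "Q s'"
      unfolding runs_def by blast
    then show ?thesis using exec.Cond_False[OF False, of B d t s' c] unfolding runs_def
      by (intro exI[of _ "1 + t"] exI[of _ s']) simp
  qed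
next
  case (Store p a)
  then show ?case using exec.Store[of p s B a] unfolding runs_def
    by (intro exI[of _ 1] exI[of _ "(fst s, (snd s)(aval p s := aval a s))"]) simp
next
  case (Assign i a)
  then show ?case using exec.Assign[of a s B i] unfolding runs_def
    by (intro exI[of _ 1] exI[of _ "((fst s)(i := aval a s), snd s)"]) simp
next
  case Skip
  then show ?case using exec.Skip[of B s] unfolding runs_def by (intro exI[of _ 1] exI[of _ s]) simp
qed simp

lemma runs_mono: "runs B c s T Q \<Longrightarrow> T \<le> T' \<Longrightarrow> (\<And>s. Q s \<Longrightarrow> Q' s) \<Longrightarrow> runs B c s T' Q'"
  unfolding runs_def by (meson le_trans)

lemma runs_Seq:
  assumes "runs B c s T1 P" "\<And>s. P s \<Longrightarrow> runs B d s T2 Q"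
  shows "runs B (Seq c d) s (T1 + T2) Q"
  using assms unfolding runs_def by (meson add_mono exec.Seq)

text \<open>The invariant carries the number of completed rounds, and each round may have its own
  cost. The outer loop over the vertices can thus be charged with their degrees.\<close>

lemma runs_While:
  assumes "I 0 s"
    and body: "\<And>i s. i < N \<Longrightarrow> I i s \<Longrightarrow> bval b s \<and> runs B c s (f i) (I (Suc i))"
    and stop: "\<And>s. I N s \<Longrightarrow> \<not> bval b s"
  shows "runs B (While b c) s ((\<Sum>i<N. 1 + f i) + 1) (I N)"
proof -
  have "I i s \<Longrightarrow> i \<le> N \<Longrightarrow> runs B (While b c) s ((\<Sum>j=i..<N. 1 + f j) + 1) (I N)" for i s
  proof (induction "N - i" arbitrary: i s)
    case 0
    then have "i = N" by simp
    then show ?case using 0 stop[of s] exec.While_False[of b s B c]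
      unfolding runs_def by (intro exI[of _ 1] exI[of _ s]) simp
  next
    case (Suc k)
    then have i: "i < N" and k: "k = N - Suc i" by simp_all
    then obtain t1 s1 where 1: "bval b s" "exec B c s t1 s1" "t1 \<le> f i" "I (Suc i) s1"
      using body Suc.prems unfolding runs_def by blast
    moreover obtain t2 s2 where "exec B (While b c) s1 t2 s2" "t2 \<le> (\<Sum>j=Suc i..<N. 1 + f j) + 1" "I N s2"
      using Suc.hyps(1)[OF k 1(4)] i unfolding runs_def by fastforce
    moreover have "(\<Sum>j=i..<N. 1 + f j) = 1 + f i + (\<Sum>j=Suc i..<N. 1 + f j)"
      using i by (simp add: sum.atLeast_Suc_lessThan)
    ultimately show ?case
      unfolding runs_def using exec.While_True[of b s B c t1 s1 t2 s2]
      by (intro exI[of _ "1 + t1 + t2"] exI[of _ s2]) auto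
  qed
  from this[of 0 s] assms(1) show ?thesis by (simp add: atLeast0LessThan)
qed

definition stores :: "(nat \<Rightarrow> nat) \<Rightarrow> nat \<Rightarrow> nat list \<Rightarrow> bool" where
  "stores m a xs \<longleftrightarrow> (\<forall>i<length xs. m (a + i) = xs ! i)"

lemma stores_Nil [simp]: "stores m a []"
  by (simp add: stores_def)

lemma stores_Cons [simp]: "stores m a (x # xs) \<longleftrightarrow> m a = x \<and> stores m (Suc a) xs"
  by (auto simp: stores_def nth_Cons' gr0_conv_Suc less_Suc_eq_0_disj all_conj_distrib)

lemma stores_append [simp]:
  "stores m a (xs @ ys) \<longleftrightarrow> stores m a xs \<and> stores m (a + length xs) ys"
  by (induction xs arbitrary: a) auto

lemma stores_upd: "stores m a xs \<Longrightarrow> b < a \<or> a + length xs \<le> b \<Longrightarrow> stores (m(b := z)) a xs"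
  by (auto simp: stores_def)

lemma stores_triples:
  assumes "\<And>v. v < n \<Longrightarrow> m (a + 3 * v) = f v \<and> m (a + 3 * v + 1) = g v \<and> m (a + 3 * v + 2) = h v"
  shows "stores m a (concat (map (\<lambda>v. [f v, g v, h v]) [0..<n]))"
  using assms
proof (induction n)
  case (Suc n)
  have "length (concat (map (\<lambda>v. [f v, g v, h v]) [0..<n])) = 3 * n"
    by (induction n) auto
  then show ?case using Suc by (auto simp: numeral_eq_Suc)
qed simp

text \<open>Each edge occurs in the lists of both ends; the filter keeps it at the smaller
  one.\<close>

definition edge_triples :: "(nat \<Rightarrow> nat) \<Rightarrow> nat \<Rightarrow> nat list \<Rightarrow> (nat \<times> nat \<times> nat) list" where
  "edge_triples \<rho> v ws = map (\<lambda>w. (v, w, gap \<rho> v w)) (filter ((<) v) ws)"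

definition flatten :: "(nat \<times> nat \<times> nat) list \<Rightarrow> nat list" where
  "flatten es = concat (map (\<lambda>(u, v, x). [u, v, x]) es)"

lemma length_flatten: "length (flatten es) = 3 * length es"
  by (induction es) (auto simp: flatten_def)

lemma flatten_append: "flatten (es @ fs) = flatten es @ flatten fs"
  by (simp add: flatten_def)

abbreviation Then :: "com \<Rightarrow> com \<Rightarrow> com" (infixr ";;" 60) where
  "c ;; d \<equiv> Seq c d"

abbreviation Incr :: "nat \<Rightarrow> com" where "Incr i \<equiv> Assign i (Add (Reg i) (Const 1))"

abbreviation Next_list :: com where
  "Next_list \<equiv> Assign 2 (Add (Reg 2) (Add (Const 1) (Load (Reg 2))))"

text \<open>Register 1 holds the number \<open>n\<close> of vertices, register 4 the end \<open>F\<close> of the adjacency lists,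
  register 0 the address of the output, register 9 that of the number of edges in it, and registers
  10 and 11 the number of edges written so far and their end. The positions of the adjacency lists are
  stored from \<open>F\<close> on, over the crossings, and the output follows them.\<close>

abbreviation Entry :: "nat \<Rightarrow> nat \<Rightarrow> aexp" where
  "Entry i j \<equiv> Add (Reg 0) (Add (Add (Reg i) (Add (Reg i) (Reg i))) (Const j))"

text \<open>Register 3 is the current vertex and register 2 the reading position. Register 7
  receives the neighbour and register 6 the gap, one of the two truncated differences being
  0.\<close>

abbreviation Read_edge :: com where
  "Read_edge \<equiv>
   Incr 2 ;; Assign 7 (Load (Reg 2)) ;;
   Assign 6 (Add (Sub (Load (Entry 3 0)) (Load (Entry 7 0))) (Sub (Load (Entry 7 0)) (Load (Entry 3 0))))"

abbreviation Extend_bar :: com where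
  "Extend_bar \<equiv>
   Cond (Less (Load (Entry 3 2)) (Reg 6)) (Store (Entry 3 2) (Reg 6)) Skip"

abbreviation Append_edge :: com where
  "Append_edge \<equiv>
   Cond (Less (Reg 3) (Reg 7))
     (Store (Reg 11) (Reg 3) ;; Store (Add (Reg 11) (Const 1)) (Reg 7) ;;
      Store (Add (Reg 11) (Const 2)) (Reg 6) ;; Assign 11 (Add (Reg 11) (Const 3)) ;; Incr 10) Skip"

text \<open>The bars start with left end 0 and right end 1; ordinates are filled in by the walk.
  Register 9 advances by one entry per vertex and so ends at the address for the number of
  edges.\<close>

abbreviation Init_entry :: com where
  "Init_entry \<equiv>
   Store (Add (Reg 4) (Reg 3)) (Reg 2) ;;
   Store (Add (Reg 9) (Const 1)) (Const 0) ;;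
   Store (Add (Reg 9) (Const 2)) (Const 1) ;;
   Assign 9 (Add (Reg 9) (Const 3)) ;; Next_list ;; Incr 3"

text \<open>Register 5 is the current rank. The test stops the walk from looking for a successor of
  the last vertex, whose list may be empty.\<close>

abbreviation Visit :: com where
  "Visit \<equiv>
   Store (Entry 3 0) (Reg 5) ;; Incr 5 ;;
   Cond (Less (Reg 5) (Reg 1))
     (Assign 3 (Load (Add (Load (Add (Reg 4) (Reg 3))) (Const 1)))) Skip"

text \<open>The end of the adjacency lists is not part of the input and is found by stepping through
  them. They begin at address 2, after the two counts.\<close>

definition scan_input :: com where
  "scan_input =
     (Assign 1 (Load (Const 0)) ;; Assign 2 (Const 2) ;; Assign 3 (Const 0)) ;;
     While (Less (Reg 3) (Reg 1)) (Next_list ;; Incr 3)"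

definition init_output :: com where
  "init_output =
     (Assign 4 (Reg 2) ;; Assign 0 (Add (Reg 4) (Reg 1)) ;; Assign 9 (Reg 0) ;;
      Assign 2 (Const 2) ;; Assign 3 (Const 0)) ;;
     While (Less (Reg 3) (Reg 1)) Init_entry"

definition walk_boundary :: com where
  "walk_boundary =
     (Assign 3 (Const 0) ;; Assign 5 (Const 0)) ;;
     While (Less (Reg 5) (Reg 1)) Visit"

definition write_edge :: com where
  "write_edge = Read_edge ;; Extend_bar ;; Append_edge"

text \<open>Register 8 holds the address of the last entry of the current list. Reading advances
  register 2 beforehand, so the strict comparison is right, and one more increment leads to the next
  list.\<close>

definition write_edges :: com where
  "write_edges =
     (Assign 10 (Const 0) ;; Assign 11 (Add (Reg 9) (Const 1)) ;; Assign 2 (Const 2) ;; Assign 3 (Const 0)) ;;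
     While (Less (Reg 3) (Reg 1))
       (Assign 8 (Add (Reg 2) (Load (Reg 2))) ;;
        While (Less (Reg 2) (Reg 8)) write_edge ;;
        (Incr 2 ;; Incr 3)) ;;
     Store (Reg 9) (Reg 10)"

definition draw_program :: com where
  "draw_program = scan_input ;; init_output ;; walk_boundary ;; write_edges"

text \<open>The bound on \<open>B\<close> adds up the memory: 7 n + 2 cells up to the end of the
  lists, n for their positions, 3 n for the bars, one count, and 18 n for at most 6 n triples, with
  a little slack.\<close>

locale ordered_graph =
  fixes n :: nat and adj :: "nat list list" and E :: "nat set set" and \<rho> :: "nat \<Rightarrow> nat" and B :: nat
  assumes G: "simple_graph {..<n} E" and len_adj: "length adj = n"
    and adj: "v < n \<Longrightarrow> distinct (adj ! v)" "v < n \<Longrightarrow> set (adj ! v) = {w. {v, w} \<in> E}"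
    and bij: "bij_betw \<rho> {..<n} {..<n}" and \<rho>0: "\<rho> 0 = 0" and nc: "almost_noncrossing E \<rho>"
    and next_vertex: "v < n \<Longrightarrow> \<rho> v + 1 < n \<Longrightarrow> adj ! v \<noteq> [] \<and> \<rho> (hd (adj ! v)) = \<rho> v + 1"
    and B: "29 * n + 10 \<le> B"
begin

abbreviation "deg v \<equiv> length (adj ! v)"

definition off :: "nat \<Rightarrow> nat" where "off v = 2 + (\<Sum>u<v. 1 + deg u)"

definition "F = off n"
definition "OUT = F + n"
definition "EP = OUT + 3 * n + 1"

lemma off_0: "off 0 = 2" and off_Suc: "off (Suc v) = off v + 1 + deg v"
  by (simp_all add: off_def)

lemma off_mono: "v \<le> w \<Longrightarrow> off v \<le> off w"
  unfolding off_def by (intro add_left_mono sum_mono2) auto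

lemma off_F: "v < n \<Longrightarrow> off v + 1 + deg v \<le> F"
  using off_mono[of "Suc v" n] by (simp add: off_Suc F_def)

lemma adj_less: "v < n \<Longrightarrow> w \<in> set (adj ! v) \<Longrightarrow> w < n"
  using adj(2) G by (fastforce simp: simple_graph_def)

lemma edge_less: "{v, w} \<in> E \<Longrightarrow> v < n \<and> w < n \<and> v \<noteq> w"
  using G by (fastforce simp: simple_graph_def)

lemma \<rho>_inj: "inj_on \<rho> {..<n}" and \<rho>_less: "v < n \<Longrightarrow> \<rho> v < n"
  using bij by (auto simp: bij_betw_def)

lemma gap_less: "v < n \<Longrightarrow> w < n \<Longrightarrow> gap \<rho> v w < n"
  using \<rho>_less[of v] \<rho>_less[of w] by (auto simp: gap_def)

text \<open>Every edge is counted from both ends, and there are at most 3 n edges by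
  \<open>card_oriented_edges\<close>.\<close>

lemma sum_deg: "(\<Sum>v<n. deg v) \<le> 6 * n"
proof -
  let ?P = "{(v, w). {v, w} \<in> E \<and> \<rho> v < \<rho> w}"
  note P = card_oriented_edges[OF G \<rho>_inj nc]
  have "(\<Sum>v<n. deg v) = (\<Sum>v<n. card {w. {v, w} \<in> E})"
    by (intro sum.cong refl) (metis adj distinct_card lessThan_iff)
  also have "\<dots> = card (SIGMA v:{..<n}. {w. {v, w} \<in> E})"
  proof (rule card_SigmaI[symmetric])
    show "\<forall>v\<in>{..<n}. finite {w. {v, w} \<in> E}" using adj(2) by (metis List.finite_set lessThan_iff)
  qed simp
  also have "\<dots> \<le> card (?P \<union> prod.swap ` ?P)"
  proof (rule card_mono)
    show "(SIGMA v:{..<n}. {w. {v, w} \<in> E}) \<subseteq> ?P \<union> prod.swap ` ?P"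
    proof
      fix p assume "p \<in> (SIGMA v:{..<n}. {w. {v, w} \<in> E})"
      then obtain v w where p: "p = (v, w)" "{v, w} \<in> E" by auto
      then have "\<rho> v \<noteq> \<rho> w" using edge_less \<rho>_inj by (meson inj_onD lessThan_iff)
      then show "p \<in> ?P \<union> prod.swap ` ?P"
        using p by (cases "\<rho> v < \<rho> w") (auto simp: insert_commute image_iff)
    qed
  qed (use P in auto)
  also have "\<dots> \<le> card ?P + card (prod.swap ` ?P)" by (rule card_Un_le)
  also have "\<dots> \<le> 3 * n + 3 * n"
    using P card_image_le[OF P(1), of prod.swap] by (intro add_mono) auto
  finally show ?thesis by simp
qed

lemma F_bound: "F \<le> 7 * n + 2"
proof -
  have "(\<Sum>v<n. 1 + deg v) = n + (\<Sum>v<n. deg v)" by (simp only: sum.distrib) simp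
  then show ?thesis using sum_deg by (simp only: F_def off_def)
qed

definition input_ok :: "(nat \<Rightarrow> nat) \<Rightarrow> bool" where
  "input_ok m \<longleftrightarrow> m 0 = n \<and> (\<forall>v<n. m (off v) = deg v \<and> (\<forall>j<deg v. m (Suc (off v + j)) = adj ! v ! j))"

lemma input_ok_upd: "input_ok m \<Longrightarrow> F \<le> a \<Longrightarrow> input_ok (m(a := z))"
proof -
  assume m: "input_ok m" and a: "F \<le> a"
  have "0 < a" using a off_mono[of 0 n] by (simp add: off_0 F_def)
  moreover have "off v \<noteq> a" "j < deg v \<Longrightarrow> Suc (off v + j) \<noteq> a" if "v < n" for v j
    using off_F[OF that] a by auto
  ultimately show ?thesis using m by (simp add: input_ok_def)
qed

lemma input_ok_initial: "input_ok (snd (initial_state (encode_input adj cr)))"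
proof -
  define xs where "xs = encode_input adj cr"
  define g where "g ws = length ws # ws" for ws :: "nat list"
  define m where "m = snd (initial_state xs)"
  have "stores m 0 xs" by (simp add: m_def initial_state_def stores_def)
  then have m: "m 0 = n" "stores m 2 (concat (map g adj))"
    by (auto simp: xs_def encode_input_def len_adj g_def[abs_def] numeral_2_eq_2)
  have "stores m (off v) (g (adj ! v))" if "v < n" for v
  proof -
    \<comment> \<open>Splitting the input at the list of \<open>v\<close> shows that it starts after
      the blocks of the earlier vertices, which is \<open>off v\<close>.\<close>
    have "adj = take v adj @ adj ! v # drop (Suc v) adj" using that len_adj by (simp add: id_take_nth_drop)
    then have "stores m 2 (concat (map g (take v adj)) @ g (adj ! v) @ concat (map g (drop (Suc v) adj)))"
      using m(2) by (metis concat.simps(2) concat_append list.simps(9) map_append)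
    moreover have "2 + length (concat (map g (take v adj))) = off v"
    proof -
      have "length (concat (map g (take v adj))) = (\<Sum>ws\<leftarrow>take v adj. 1 + length ws)"
        by (simp add: length_concat g_def comp_def)
      also have "\<dots> = (\<Sum>u<v. 1 + deg u)"
        using that len_adj by (simp add: sum_list_sum_nth atLeast0LessThan)
      finally show ?thesis by (simp add: off_def)
    qed
    ultimately show ?thesis by simp
  qed
  then have "m (off v) = deg v" "stores m (Suc (off v)) (adj ! v)" if "v < n" for v
    using that by (auto simp: g_def)
  then have "input_ok m" using m(1) by (simp add: input_ok_def stores_def)
  then show ?thesis by (simp add: m_def xs_def)
qed

lemma runs_scan_input:
  assumes "input_ok (snd s)"
  shows "runs B scan_input s (4 + 3 * n) (\<lambda>s. input_ok (snd s) \<and> fst s 1 = n \<and> fst s 2 = F)"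
proof -
  define I where "I i s \<longleftrightarrow> input_ok (snd s) \<and> fst s 1 = n \<and> fst s 2 = off i \<and> fst s 3 = i" for i and s :: state
  have b: "off i \<le> B" if "i \<le> n" for i using off_mono[OF that] F_bound B unfolding F_def by linarith
  have "runs B scan_input s (3 + ((\<Sum>i<n. 1 + 2) + 1)) (I n)"
    unfolding scan_input_def
  proof (rule runs_Seq)
    show "runs B (Assign 1 (Load (Const 0)) ;; Assign 2 (Const 2) ;; Assign 3 (Const 0)) s 3 (I 0)"
      by (rule runs_mono[OF runs_wp[where Q = "I 0"]])
        (use assms B in \<open>auto simp: I_def input_ok_def off_0\<close>)
    fix s assume "I 0 s"
    then show "runs B (While (Less (Reg 3) (Reg 1)) (Next_list ;; Incr 3)) s ((\<Sum>i<n. 1 + 2) + 1) (I n)"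
    proof (rule runs_While)
      fix i s assume i: "i < n" "I i s"
      have mo: "snd s (off i) = deg i" using i by (simp add: I_def input_ok_def)
      have "wp B (Next_list ;; Incr 3) (I (Suc i)) s"
        using i mo b[of "Suc i"] B by (simp add: I_def off_Suc)
      from runs_wp[OF this] show "bval (Less (Reg 3) (Reg 1)) s \<and> runs B (Next_list ;; Incr 3) s 2 (I (Suc i))"
        using i by (simp add: I_def numeral_2_eq_2)
    qed (auto simp: I_def)
  qed
  then show ?thesis by (rule runs_mono) (auto simp: I_def F_def)
qed

lemma runs_init_output:
  assumes "input_ok (snd s)" "fst s 1 = n" "fst s 2 = F"
  shows "runs B init_output s (6 + 7 * n) (\<lambda>s. input_ok (snd s) \<and> fst s 1 = n \<and> fst s 0 = OUT \<and> fst s 4 = F \<and>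
    fst s 9 = OUT + 3 * n \<and> (\<forall>v<n. snd s (F + v) = off v \<and> snd s (OUT + 3 * v + 1) = 0 \<and> snd s (OUT + 3 * v + 2) = 1))"
proof -
  define I where "I i s \<longleftrightarrow> input_ok (snd s) \<and> fst s 1 = n \<and> fst s 0 = OUT \<and> fst s 4 = F \<and>
    fst s 9 = OUT + 3 * i \<and> fst s 2 = off i \<and> fst s 3 = i \<and>
    (\<forall>v<i. snd s (F + v) = off v \<and> snd s (OUT + 3 * v + 1) = 0 \<and> snd s (OUT + 3 * v + 2) = 1)" for i and s :: state
  define body where "body = Init_entry"
  have b: "off i \<le> B" if "i \<le> n" for i using off_mono[OF that] F_bound B unfolding F_def by linarith
  have OB: "OUT + 3 * n + 5 \<le> B" using F_bound B unfolding OUT_def by linarith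
  have "runs B init_output s (5 + ((\<Sum>i<n. 1 + 6) + 1)) (I n)"
    unfolding init_output_def body_def[symmetric]
  proof (rule runs_Seq)
    show "runs B (Assign 4 (Reg 2) ;; Assign 0 (Add (Reg 4) (Reg 1)) ;; Assign 9 (Reg 0) ;;
      Assign 2 (Const 2) ;; Assign 3 (Const 0)) s 5 (I 0)"
      by (rule runs_mono[OF runs_wp[where Q = "I 0"]])
        (use assms OB in \<open>auto simp: I_def off_0 OUT_def\<close>)
    fix s assume "I 0 s"
    then show "runs B (While (Less (Reg 3) (Reg 1)) body) s ((\<Sum>i<n. 1 + 6) + 1) (I n)"
    proof (rule runs_While)
      fix i s assume i: "i < n" "I i s"
      define m where "m = (snd s)(F + i := off i, OUT + 3 * i + 1 := 0, OUT + 3 * i + 2 := 1)"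
      have ok: "input_ok m" unfolding m_def using i by (intro input_ok_upd) (auto simp: I_def OUT_def)
      then have mo: "m (off i) = deg i" using i by (simp add: input_ok_def)
      have tab: "\<forall>v<Suc i. m (F + v) = off v \<and> m (OUT + 3 * v + 1) = 0 \<and> m (OUT + 3 * v + 2) = 1"
      proof (intro allI impI)
        fix v assume v: "v < Suc i"
        have "F + v \<noteq> OUT + 3 * i + 1" "F + v \<noteq> OUT + 3 * i + 2" "OUT + 3 * v + 1 \<noteq> F + i" "OUT + 3 * v + 2 \<noteq> F + i"
          using v i(1) by (simp_all add: OUT_def)
        \<comment> \<open>The fields of the entries are told apart modulo 3.\<close>
        moreover have "OUT + 3 * v + 1 \<noteq> OUT + 3 * i + 2" "OUT + 3 * v + 2 \<noteq> OUT + 3 * i + 1" by presburger+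
        moreover have "v \<noteq> i \<Longrightarrow> v < i" using v by simp
        ultimately show "m (F + v) = off v \<and> m (OUT + 3 * v + 1) = 0 \<and> m (OUT + 3 * v + 2) = 1"
          using i(2) unfolding m_def I_def by (cases "v = i") simp_all
      qed
      have "F + i \<le> B" using i(1) OB by (simp add: OUT_def)
      then have "wp B body (I (Suc i)) s"
        using i b[of i] b[of "Suc i"] OB mo ok tab unfolding body_def
        by (simp add: I_def off_Suc m_def)
      from runs_wp[OF this] show "bval (Less (Reg 3) (Reg 1)) s \<and> runs B body s 6 (I (Suc i))"
        using i by (simp add: I_def body_def numeral_eq_Suc)
    qed (auto simp: I_def)
  qed
  then show ?thesis by (rule runs_mono) (auto simp: I_def)
qed

lemma runs_walk_boundary:
  assumes "input_ok (snd s)" "fst s 1 = n" "fst s 0 = OUT" "fst s 4 = F" "fst s 9 = OUT + 3 * n"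
    "\<forall>v<n. snd s (F + v) = off v \<and> snd s (OUT + 3 * v + 1) = 0 \<and> snd s (OUT + 3 * v + 2) = 1"
  shows "runs B walk_boundary s (3 + 5 * n) (\<lambda>s. input_ok (snd s) \<and> fst s 1 = n \<and> fst s 0 = OUT \<and>
    fst s 9 = OUT + 3 * n \<and> (\<forall>v<n. snd s (OUT + 3 * v) = \<rho> v \<and> snd s (OUT + 3 * v + 1) = 0 \<and> snd s (OUT + 3 * v + 2) = 1))"
proof -
  \<comment> \<open>Register 3 is the vertex of rank \<open>i\<close> only while
    \<open>i < n\<close>; after the last round it is stale. Ordinates are claimed for ranks below
    \<open>i\<close>.\<close>
  define I where "I i s \<longleftrightarrow> input_ok (snd s) \<and> fst s 1 = n \<and> fst s 0 = OUT \<and> fst s 4 = F \<and>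
    fst s 9 = OUT + 3 * n \<and> fst s 5 = i \<and> (i < n \<longrightarrow> fst s 3 < n \<and> \<rho> (fst s 3) = i) \<and>
    (\<forall>v<n. snd s (F + v) = off v \<and> (\<rho> v < i \<longrightarrow> snd s (OUT + 3 * v) = \<rho> v) \<and>
       snd s (OUT + 3 * v + 1) = 0 \<and> snd s (OUT + 3 * v + 2) = 1)" for i and s :: state
  define body where "body = Visit"
  have OB: "OUT + 3 * n + 5 \<le> B" "n \<le> B" using F_bound B unfolding OUT_def by linarith+
  have "runs B walk_boundary s (2 + ((\<Sum>i<n. 1 + 4) + 1)) (I n)"
    unfolding walk_boundary_def body_def[symmetric]
  proof (rule runs_Seq)
    show "runs B (Assign 3 (Const 0) ;; Assign 5 (Const 0)) s 2 (I 0)"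
      by (rule runs_mono[OF runs_wp[where Q = "I 0"]])
        (use assms \<rho>0 in \<open>auto simp: I_def\<close>)
    fix s assume "I 0 s"
    then show "runs B (While (Less (Reg 5) (Reg 1)) body) s ((\<Sum>i<n. 1 + 4) + 1) (I n)"
    proof (rule runs_While)
      fix i s assume i: "i < n" "I i s"
      define v where "v = fst s 3"
      have v: "v < n" "\<rho> v = i" using i by (auto simp: I_def v_def)
      define m where "m = (snd s)(OUT + 3 * v := i)"
      have ok: "input_ok m" unfolding m_def using i by (intro input_ok_upd) (auto simp: I_def OUT_def)
      have tab: "m (F + w) = off w \<and> (\<rho> w < Suc i \<longrightarrow> m (OUT + 3 * w) = \<rho> w) \<and> m (OUT + 3 * w + 1) = 0 \<and> m (OUT + 3 * w + 2) = 1"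
        if w: "w < n" for w
      proof -
        have "F + w \<noteq> OUT + 3 * v" "OUT + 3 * w + 1 \<noteq> OUT + 3 * v" "OUT + 3 * w + 2 \<noteq> OUT + 3 * v"
          using w by (auto simp: OUT_def) presburger+
        moreover have "\<rho> w = i \<longleftrightarrow> w = v" using v w \<rho>_inj by (auto simp: inj_on_def)
        ultimately show ?thesis using i w v unfolding m_def I_def by (auto simp: less_Suc_eq)
      qed
      have hd: "m (Suc (m (F + v))) = hd (adj ! v) \<and> hd (adj ! v) < n \<and> \<rho> (hd (adj ! v)) = Suc i" if "Suc i < n"
      proof -
        have a: "adj ! v \<noteq> []" "\<rho> (hd (adj ! v)) = Suc i" using next_vertex[OF v(1)] that v by auto
        have "m (Suc (off v + 0)) = adj ! v ! 0" using ok v(1) a(1) unfolding input_ok_def by blast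
        then show ?thesis using a tab[OF v(1)] adj_less[OF v(1)] by (simp add: hd_conv_nth)
      qed
      have "wp B body (I (Suc i)) s"
      proof -
        have 1: "OUT + 3 * v \<le> B" "Suc i \<le> B" "i \<le> B" using v i OB by auto
        have 2: "hd (adj ! v) \<le> B" if "Suc i < n" using hd[OF that] OB(2) by linarith
        have e: "OUT + (v + (v + v)) = OUT + 3 * v" by simp
        show ?thesis
          using i 1 2 hd ok tab OB unfolding body_def
          by (simp add: I_def e m_def flip: v_def)
      qed
      from runs_wp[OF this] show "bval (Less (Reg 5) (Reg 1)) s \<and> runs B body s 4 (I (Suc i))"
        using i by (simp add: I_def body_def numeral_eq_Suc)
    qed (auto simp: I_def)
  qed
  then show ?thesis by (rule runs_mono) (auto simp: I_def \<rho>_less)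
qed

end

section \<open>Writing the edges and extending the bars\<close>

context ordered_graph
begin

text \<open>\<open>i\<close> and \<open>j\<close> describe the progress: the lists of the vertices
  before \<open>i\<close> and the first \<open>j\<close> entries of the list of \<open>i\<close>
  have been read.\<close>

definition seen :: "nat \<Rightarrow> nat \<Rightarrow> nat \<Rightarrow> nat list" where
  "seen i j v = take (if v < i then deg v else if v = i then j else 0) (adj ! v)"

definition extent :: "nat \<Rightarrow> nat \<Rightarrow> nat \<Rightarrow> nat" where
  "extent i j v = fold max (map (gap \<rho> v) (seen i j v)) 1"

definition written :: "nat \<Rightarrow> nat \<Rightarrow> (nat \<times> nat \<times> nat) list" where
  "written i j = concat (map (\<lambda>v. edge_triples \<rho> v (adj ! v)) [0..<i]) @ edge_triples \<rho> i (take j (adj ! i))"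

lemma extent_Suc_row: "extent (Suc i) 0 v = extent i (deg i) v"
  by (simp add: extent_def seen_def less_Suc_eq)

lemma written_Suc_row: "written (Suc i) 0 = written i (deg i)"
  by (simp add: written_def edge_triples_def)

lemma extent_Suc:
  "j < deg i \<Longrightarrow> extent i (Suc j) v = (if v = i then max (gap \<rho> i (adj ! i ! j)) (extent i j i) else extent i j v)"
  by (simp add: extent_def seen_def take_Suc_conv_app_nth)

lemma written_Suc:
  "j < deg i \<Longrightarrow> written i (Suc j) =
     written i j @ (if i < adj ! i ! j then [(i, adj ! i ! j, gap \<rho> i (adj ! i ! j))] else [])"
  by (simp add: written_def edge_triples_def take_Suc_conv_app_nth)

text \<open>At most one triple is written per list entry read, so the degree sum bounds their
  number.\<close>

lemma length_written: assumes "i \<le> n" "i < n \<Longrightarrow> j \<le> deg i" "i = n \<Longrightarrow> j = 0"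
  shows "length (written i j) \<le> 6 * n"
proof -
  have 1: "length (edge_triples \<rho> v ws) \<le> length ws" for v ws by (simp add: edge_triples_def)
  have "length (concat (map (\<lambda>v. edge_triples \<rho> v (adj ! v)) [0..<i])) \<le> (\<Sum>v<i. deg v)"
  proof (induction i)
    case (Suc i)
    then show ?case using 1[of i "adj ! i"] by simp
  qed simp
  moreover have "length (edge_triples \<rho> i (take j (adj ! i))) \<le> j"
    using 1[of i "take j (adj ! i)"] by simp
  ultimately have "length (written i j) \<le> (\<Sum>v<i. deg v) + j" by (simp add: written_def)
  also have "\<dots> \<le> (\<Sum>v<n. deg v)"
  proof (cases "i = n")
    case False
    then have "(\<Sum>v<i. deg v) + j \<le> (\<Sum>v<Suc i. deg v)" using assms by simp
    also have "\<dots> \<le> (\<Sum>v<n. deg v)" using assms(1) False by (intro sum_mono2) auto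
    finally show ?thesis .
  qed (use assms in simp)
  finally show ?thesis using sum_deg by linarith
qed

definition table :: "(nat \<Rightarrow> nat) \<Rightarrow> nat \<Rightarrow> nat \<Rightarrow> bool" where
  "table m i j \<longleftrightarrow> input_ok m \<and> stores m EP (flatten (written i j)) \<and>
     (\<forall>v<n. m (OUT + 3 * v) = \<rho> v \<and> m (OUT + 3 * v + 1) = 0 \<and> m (OUT + 3 * v + 2) = extent i j v)"

definition edges_at :: "nat \<Rightarrow> nat \<Rightarrow> state \<Rightarrow> bool" where
  "edges_at i j s \<longleftrightarrow> table (snd s) i j \<and> fst s 1 = n \<and> fst s 0 = OUT \<and> fst s 9 = OUT + 3 * n \<and> fst s 3 = i \<and>
     fst s 2 = off i + j \<and> fst s 10 = length (written i j) \<and> fst s 11 = EP + 3 * length (written i j)"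

lemma edges_at_Suc_row:
  "edges_at i (deg i) s \<Longrightarrow> edges_at (Suc i) 0 ((fst s)(2 := off (Suc i), 3 := Suc i), snd s)"
  by (simp add: edges_at_def table_def extent_Suc_row written_Suc_row)

text \<open>The bar entry lies below \<open>EP\<close> and the new triple behind those already
  written, so neither update disturbs what is stored elsewhere.\<close>

lemma table_step:
  fixes m :: "nat \<Rightarrow> nat"
  assumes t: "table m i j" and i: "i < n" and j: "j < deg i"
  defines "w \<equiv> adj ! i ! j"
  defines "m1 \<equiv> m(OUT + 3 * i + 2 := extent i (Suc j) i)"
  defines "q \<equiv> EP + 3 * length (written i j)"
  shows "table (if i < w then m1(q := i, q + 1 := w, q + 2 := gap \<rho> i w) else m1) i (Suc j)"
proof -
  let ?m = "if i < w then m1(q := i, q + 1 := w, q + 2 := gap \<rho> i w) else m1"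
  have FO: "F \<le> OUT + 3 * i + 2" "F \<le> q" by (simp_all add: OUT_def EP_def q_def)
  have low: "OUT + 3 * v + 2 < EP" if "v < n" for v using that by (simp add: EP_def)
  have ok: "input_ok ?m"
    unfolding m1_def using t FO by (auto simp: table_def intro!: input_ok_upd)
  have st1: "stores m1 EP (flatten (written i j))"
    unfolding m1_def using t low[OF i] by (intro stores_upd) (auto simp: table_def)
  have len: "EP + length (flatten (written i j)) = q" by (simp add: q_def length_flatten)
  have "stores ?m EP (flatten (written i (Suc j)))"
  proof (cases "i < w")
    case True
    have "stores ?m EP (flatten (written i j))"
      using True st1 len by (simp add: stores_upd)
    then show ?thesis
      using True j len by (simp add: written_Suc w_def flatten_append) (simp add: flatten_def)
  next
    case False
    then show ?thesis using st1 j by (simp add: written_Suc w_def)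
  qed
  moreover have "?m (OUT + 3 * v) = \<rho> v \<and> ?m (OUT + 3 * v + 1) = 0 \<and> ?m (OUT + 3 * v + 2) = extent i (Suc j) v"
    if v: "v < n" for v
  proof -
    have "m1 (OUT + 3 * v) = \<rho> v \<and> m1 (OUT + 3 * v + 1) = 0 \<and> m1 (OUT + 3 * v + 2) = extent i (Suc j) v"
    proof -
      have "3 * v \<noteq> 3 * i + 2" "3 * v + 1 \<noteq> 3 * i + 2" by presburger+
      then show ?thesis using t v j by (simp add: m1_def table_def extent_Suc)
    qed
    moreover have "?m a = m1 a" if "a < EP" for a using that by (simp add: q_def)
    ultimately show ?thesis using low[OF v] by simp
  qed
  ultimately show ?thesis using ok by (simp add: table_def)
qed

lemma runs_write_edge:
  assumes s: "edges_at i j s" and i: "i < n" and j: "j < deg i" and r8: "fst s 8 = off i + deg i"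
  shows "runs B write_edge s 11 (\<lambda>s. edges_at i (Suc j) s \<and> fst s 8 = off i + deg i)"
proof -
  define w where "w = adj ! i ! j"
  define g where "g = gap \<rho> i w"
  define m where "m = snd s"
  define m1 where "m1 = m(OUT + 3 * i + 2 := extent i (Suc j) i)"
  define q where "q = EP + 3 * length (written i j)"
  have t: "table m i j" and R: "fst s 1 = n" "fst s 0 = OUT" "fst s 9 = OUT + 3 * n" "fst s 3 = i"
     "fst s 2 = off i + j" "fst s 10 = length (written i j)" "fst s 11 = q"
    using s by (auto simp: edges_at_def m_def q_def)
  have w: "w < n" using adj_less[OF i] j by (simp add: w_def)
  have g: "g < n" using gap_less i w by (simp add: g_def)
  have mem: "m (Suc (off i + j)) = w" "m (OUT + 3 * i) = \<rho> i" "m (OUT + 3 * w) = \<rho> w"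
    "m (Suc (Suc (OUT + 3 * i))) = extent i j i"
    using t i j w by (auto simp: table_def input_ok_def w_def)
  have e: "OUT + (v + (v + v)) = OUT + 3 * v" for v by simp
  have len: "length (written i j) \<le> 6 * n" using i j by (intro length_written) auto
  have bnd: "Suc (off i + j) \<le> B" "q + 3 \<le> B" "OUT + 3 * n + 2 \<le> B" "w \<le> B" "g \<le> B" "i \<le> B" "length (written i j) + 1 \<le> B"
    using off_F[OF i] j F_bound B len w g i by (auto simp: q_def EP_def OUT_def)
  have "runs B write_edge s (3 + (2 + 6)) (\<lambda>s. edges_at i (Suc j) s \<and> fst s 8 = off i + deg i)"
    unfolding write_edge_def
  proof (rule runs_Seq[OF _ runs_Seq])
    let ?R = "(fst s)(2 := Suc (off i + j), 7 := w, 6 := g)"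
    show "runs B Read_edge s 3
      (\<lambda>s'. s' = (?R, m))"
      by (rule runs_mono[OF runs_wp[where Q = "\<lambda>s'. s' = (?R, m)"]])
        (use R mem bnd in \<open>simp_all add: e g_def gap_def flip: m_def\<close>)
    fix s1 assume s1: "s1 = (?R, m)"
    show "runs B Extend_bar s1 2
      (\<lambda>s'. s' = (?R, m1))"
    proof (rule runs_mono[OF runs_wp[where Q = "\<lambda>s'. s' = (?R, m1)"]])
      have ex: "extent i (Suc j) i = max g (extent i j i)" using j by (simp add: extent_Suc g_def w_def)
      have "Suc (Suc (OUT + 3 * i)) \<le> B" using bnd(3) i by simp
      \<comment> \<open>If the bar is already long enough nothing is stored; this agrees with
        storing the maximum, which is then the old value.\<close>
      moreover have "m(Suc (Suc (OUT + 3 * i)) := extent i j i) = m" using mem(4) by (metis fun_upd_triv)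
      ultimately show "wp B Extend_bar (\<lambda>s'. s' = (?R, m1)) s1"
        unfolding s1 m1_def ex using R mem bnd by (simp add: e)
    qed simp_all
    fix s2 assume s2: "s2 = (?R, m1)"
    have fin: "table (if i < w then m1(q := i, q + 1 := w, q + 2 := g) else m1) i (Suc j)"
      using table_step[OF t i j] by (simp only: m1_def q_def w_def g_def)
    have wr: "length (written i (Suc j)) = length (written i j) + (if i < w then 1 else 0)"
      using j by (simp add: written_Suc w_def)
    show "runs B Append_edge s2 6
       (\<lambda>s. edges_at i (Suc j) s \<and> fst s 8 = off i + deg i)"
      by (rule runs_mono[OF runs_wp[where Q = "\<lambda>s. edges_at i (Suc j) s \<and> fst s 8 = off i + deg i"]])
        (use R bnd fin wr r8 in \<open>auto simp: s2 edges_at_def q_def\<close>)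
  qed
  then show ?thesis by simp
qed

lemma runs_write_edges:
  assumes "input_ok (snd s)" "fst s 1 = n" "fst s 0 = OUT" "fst s 9 = OUT + 3 * n"
    "\<forall>v<n. snd s (OUT + 3 * v) = \<rho> v \<and> snd s (OUT + 3 * v + 1) = 0 \<and> snd s (OUT + 3 * v + 2) = 1"
  shows "runs B write_edges s (77 * n + 6) (\<lambda>s. fst s 0 = OUT \<and> table (snd s) n 0 \<and> snd s (OUT + 3 * n) = length (written n 0))"
proof -
  define inner where "inner = While (Less (Reg 2) (Reg 8)) write_edge"
  define body where "body = (Assign 8 (Add (Reg 2) (Load (Reg 2))) ;; inner ;; (Incr 2 ;; Incr 3))"
  have OB: "OUT + 3 * n + 2 \<le> B" using F_bound B by (simp add: OUT_def)
  have row: "bval (Less (Reg 3) (Reg 1)) s \<and> runs B body s (4 + 12 * deg i) (edges_at (Suc i) 0)"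
    if i: "i < n" and s: "edges_at i 0 s" for i s
  proof
    show "bval (Less (Reg 3) (Reg 1)) s" using i s by (simp add: edges_at_def)
    have mo: "snd s (off i) = deg i" using s i by (simp add: edges_at_def table_def input_ok_def)
    have ob: "off i + deg i + 1 \<le> B" using off_F[OF i] F_bound B by linarith
    let ?J = "\<lambda>j s. edges_at i j s \<and> fst s 8 = off i + deg i"
    have "runs B body s (1 + (((\<Sum>j<deg i. 1 + 11) + 1) + 2)) (edges_at (Suc i) 0)"
      unfolding body_def inner_def
    proof (rule runs_Seq[OF _ runs_Seq])
      show "runs B (Assign 8 (Add (Reg 2) (Load (Reg 2)))) s 1 (?J 0)"
        by (rule runs_mono[OF runs_wp[where Q = "?J 0"]]) (use s ob mo in \<open>simp_all add: edges_at_def\<close>)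
      show "runs B (While (Less (Reg 2) (Reg 8)) write_edge) s ((\<Sum>j<deg i. 1 + 11) + 1) (?J (deg i))"
        if "?J 0 s" for s
      proof (rule runs_While[of ?J])
        show "bval (Less (Reg 2) (Reg 8)) s \<and> runs B write_edge s 11 (?J (Suc j))"
          if "j < deg i" "?J j s" for j s
          using runs_write_edge[of i j s] that i by (simp add: edges_at_def)
      qed (use that in \<open>simp_all add: edges_at_def\<close>)
      fix s assume J: "?J (deg i) s"
      have "Suc (off i + deg i) = off (Suc i)" by (simp add: off_Suc)
      then have "wp B (Incr 2 ;; Incr 3) (edges_at (Suc i) 0) s"
        using J edges_at_Suc_row[of i s] ob OB i by (simp add: edges_at_def)
      from runs_wp[OF this] show "runs B (Incr 2 ;; Incr 3) s 2 (edges_at (Suc i) 0)"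
        by (simp add: numeral_2_eq_2)
    qed
    then show "runs B body s (4 + 12 * deg i) (edges_at (Suc i) 0)"
      by (rule runs_mono) simp_all
  qed
  \<comment> \<open>A list entry costs 12 steps including the loop test, and a vertex 5 more; with
    degree sum at most 6 n this is 5 n + 72 n.\<close>
  have sum: "(\<Sum>i<n. 1 + (4 + 12 * deg i)) \<le> 77 * n"
  proof -
    have "(\<Sum>i<n. 1 + (4 + 12 * deg i)) = 5 * n + 12 * (\<Sum>i<n. deg i)"
      by (simp add: sum.distrib sum_distrib_left)
    then show ?thesis using sum_deg by linarith
  qed
  have "runs B write_edges s (4 + (((\<Sum>i<n. 1 + (4 + 12 * deg i)) + 1) + 1))
    (\<lambda>s. fst s 0 = OUT \<and> table (snd s) n 0 \<and> snd s (OUT + 3 * n) = length (written n 0))"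
    unfolding write_edges_def inner_def[symmetric] body_def[symmetric]
  proof (rule runs_Seq[OF _ runs_Seq])
    have ex: "extent 0 0 v = 1" "written 0 0 = []" for v
      by (simp_all add: extent_def seen_def written_def edge_triples_def)
    show "runs B (Assign 10 (Const 0) ;; Assign 11 (Add (Reg 9) (Const 1)) ;; Assign 2 (Const 2) ;; Assign 3 (Const 0)) s 4
       (edges_at 0 0)"
      by (rule runs_mono[OF runs_wp[where Q = "edges_at 0 0"]])
        (use assms B OB in \<open>simp_all add: edges_at_def table_def ex flatten_def off_0 EP_def\<close>)
    show "runs B (While (Less (Reg 3) (Reg 1)) body) s ((\<Sum>i<n. 1 + (4 + 12 * deg i)) + 1) (edges_at n 0)"
      if "edges_at 0 0 s" for s
      by (rule runs_While[of "\<lambda>i. edges_at i 0"]) (use that row in \<open>auto simp: edges_at_def\<close>)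
    fix s assume s: "edges_at n 0 s"
    have len: "length (written n 0) \<le> B" using length_written[of n 0] B by simp
    have "input_ok ((snd s)(OUT + 3 * n := length (written n 0)))"
      using s by (intro input_ok_upd) (auto simp: edges_at_def table_def OUT_def)
    moreover have "stores ((snd s)(OUT + 3 * n := length (written n 0))) EP (flatten (written n 0))"
      using s by (intro stores_upd) (auto simp: edges_at_def table_def EP_def)
    moreover have "v < n \<Longrightarrow> 3 * v + 2 < 3 * n" for v by simp
    ultimately have "table ((snd s)(OUT + 3 * n := length (written n 0))) n 0"
      using s unfolding edges_at_def table_def by fastforce
    then have "wp B (Store (Reg 9) (Reg 10)) (\<lambda>s. fst s 0 = OUT \<and> table (snd s) n 0 \<and> snd s (OUT + 3 * n) = length (written n 0)) s"
      using s OB len by (simp add: edges_at_def)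
    from runs_wp[OF this] show "runs B (Store (Reg 9) (Reg 10)) s 1 (\<lambda>s. fst s 0 = OUT \<and> table (snd s) n 0 \<and> snd s (OUT + 3 * n) = length (written n 0))"
      by simp
  qed
  then show ?thesis by (rule runs_mono) (use sum in auto)
qed

text \<open>Triples from different lists differ in their first component, and those from one list in
  the second.\<close>

lemma written_edges:
  "set (written n 0) = {(v, w, gap \<rho> v w) |v w. {v, w} \<in> E \<and> v < w}"
  "distinct (written n 0)"
proof -
  have w: "written n 0 = concat (map (\<lambda>v. edge_triples \<rho> v (adj ! v)) [0..<n])"
    by (simp add: written_def edge_triples_def)
  have set1: "set (edge_triples \<rho> v (adj ! v)) = {(v, w, gap \<rho> v w) |w. {v, w} \<in> E \<and> v < w}" if "v < n" for v
    using adj(2)[OF that] by (auto simp: edge_triples_def)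
  show "set (written n 0) = {(v, w, gap \<rho> v w) |v w. {v, w} \<in> E \<and> v < w}"
    unfolding w using set1 edge_less by auto
  have "distinct (concat (map (\<lambda>v. edge_triples \<rho> v (adj ! v)) [0..<i]))" if "i \<le> n" for i
    using that
  proof (induction i)
    case (Suc i)
    have "distinct (edge_triples \<rho> i (adj ! i))"
      using adj(1)[of i] Suc.prems by (simp add: edge_triples_def distinct_map inj_on_def)
    then show ?case using Suc by (auto simp: edge_triples_def)
  qed simp
  then show "distinct (written n 0)" unfolding w by simp
qed

lemma output_correct:
  assumes s: "fst s 0 = OUT" "table (snd s) n 0" "snd s (OUT + 3 * n) = length (written n 0)"
  shows "outputs_bar_1_visibility_drawing s n E"
proof -
  define r where "r = extent n 0"
  define es where "es = written n 0"
  obtain x :: "nat set \<Rightarrow> real" where x: "\<And>u v. x {u, v} = real (gap \<rho> u v)" using gap_on_edges[of \<rho>] by blast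
  have r_eq: "r v = Max (insert 1 (gap \<rho> v ` {w. {v, w} \<in> E}))" if "v < n" for v
  proof -
    have "r v = fold max (map (gap \<rho> v) (adj ! v)) 1" using that by (simp add: r_def extent_def seen_def)
    also have "\<dots> = Max (set (1 # map (gap \<rho> v) (adj ! v)))" by (simp only: Max.set_eq_fold)
    finally show ?thesis using adj(2)[OF that] by simp
  qed
  have fin: "finite (insert 1 (gap \<rho> v ` {w. {v, w} \<in> E}))" if "v < n" for v
    using adj(2)[OF that] by (metis finite_imageI finite_insert List.finite_set)
  have draw: "bar_1_visibility_drawing {..<n} E (\<lambda>v. real (\<rho> v)) (\<lambda>_. 0) (\<lambda>v. real (r v)) x"
  proof (rule bar_1_visibility_drawing_rank[OF G \<rho>_inj nc])
    show "1 \<le> r v" if "v \<in> {..<n}" for v using r_eq fin that by simp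
    show "gap \<rho> v w \<le> r v" if "{v, w} \<in> E" for v w
      using r_eq[of v] fin[of v] edge_less[OF that] that by (auto intro!: Max_ge)
    show "r v = 1 \<or> (\<exists>w. {v, w} \<in> E \<and> r v = gap \<rho> v w)" if "v \<in> {..<n}" for v
    proof -
      have "Max (insert 1 (gap \<rho> v ` {w. {v, w} \<in> E})) \<in> insert 1 (gap \<rho> v ` {w. {v, w} \<in> E})"
        using fin that by (intro Max_in) auto
      then show ?thesis using r_eq[of v] that by auto
    qed
  qed (rule x)
  have "stores (snd s) OUT (encode_output n \<rho> (\<lambda>_. 0) r es)"
  proof -
    have "stores (snd s) OUT (concat (map (\<lambda>v. [\<rho> v, 0, r v]) [0..<n]))"
      using s(2) by (intro stores_triples) (simp add: table_def r_def)
    moreover have "length (concat (map (\<lambda>v. [\<rho> v, 0, r v]) [0..<n])) = 3 * n"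
      by (simp add: length_concat comp_def sum_list_triv)
    moreover have "stores (snd s) EP (flatten es)" using s(2) by (simp add: table_def es_def)
    ultimately show ?thesis using s(3) by (simp add: encode_output_def EP_def es_def flatten_def)
  qed
  then have "stored_at s (fst s 0) (encode_output n \<rho> (\<lambda>_. 0) r es)"
    by (simp add: s(1) stored_at_def stores_def)
  moreover have "distinct (map (\<lambda>(u, v, _). {u, v}) es)"
    using written_edges unfolding es_def distinct_map by (auto simp: inj_on_def doubleton_eq_iff)
  moreover have "(\<lambda>(u, v, _). {u, v}) ` set es = E"
  proof -
    have "\<exists>u v. e = {u, v} \<and> u < v" if e: "e \<in> E" for e
    proof -
      obtain a b where "e = {a, b}" "a \<noteq> b" using G e by (auto simp: simple_graph_def card_2_iff)
      then consider "a < b" | "b < a" by linarith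
      then show ?thesis using \<open>e = {a, b}\<close> insert_commute by cases blast+
    qed
    then show ?thesis unfolding es_def written_edges(1) by (force simp: image_iff)
  qed
  moreover have "\<forall>(u, v, d)\<in>set es. x {u, v} = real d"
    using x unfolding es_def written_edges(1) by auto
  ultimately show ?thesis
    unfolding outputs_bar_1_visibility_drawing_def using draw
    by (intro exI[of _ \<rho>] exI[of _ "\<lambda>_. 0"] exI[of _ r] exI[of _ es] exI[of _ x]) simp
qed

text \<open>The four phases cost 3 n, 7 n, 5 n and 77 n steps, up to constants that add up to
  19.\<close>

lemma draw_program_correct:
  "\<exists>t s. exec B draw_program (initial_state (encode_input adj cr)) t s \<and> t \<le> 92 * (n + 1) \<and>
     outputs_bar_1_visibility_drawing s n E"
proof -
  have "runs B draw_program (initial_state (encode_input adj cr))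
    ((4 + 3 * n) + ((6 + 7 * n) + ((3 + 5 * n) + (77 * n + 6)))) (\<lambda>s. outputs_bar_1_visibility_drawing s n E)"
    unfolding draw_program_def
    by (rule runs_Seq[OF runs_scan_input[OF input_ok_initial]], elim conjE,
        rule runs_Seq[OF runs_init_output], assumption+, elim conjE,
        rule runs_Seq[OF runs_walk_boundary], assumption+, elim conjE,
        rule runs_mono[OF runs_write_edges], assumption+, rule order_refl, elim conjE,
        rule output_correct, assumption+)
  then obtain t s where "exec B draw_program (initial_state (encode_input adj cr)) t s"
    "t \<le> (4 + 3 * n) + ((6 + 7 * n) + ((3 + 5 * n) + (77 * n + 6)))" "outputs_bar_1_visibility_drawing s n E"
    unfolding runs_def by blast
  then show ?thesis by (intro exI[of _ t] exI[of _ s]) simp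
qed

end

lemma draw_program_linear_time: "linear_time_bar_1_visibility_algorithm draw_program"
  unfolding linear_time_bar_1_visibility_algorithm_def
proof (rule exI[of _ 92], rule exI[of _ 6], intro allI impI, elim conjE)
  fix n E pos \<gamma> adj cr
  assume max: "maximal_outer_1_plane {..<n} E pos \<gamma>" and desc: "describes adj cr n E pos \<gamma>"
  have G: "simple_graph {..<n} E"
    using max by (simp add: maximal_outer_1_plane_def outer_1_plane_def drawing_def)
  obtain \<rho> :: "nat \<Rightarrow> nat" where \<rho>: "bij_betw \<rho> {..<n} {..<n}" "\<rho> 0 = 0" "almost_noncrossing E \<rho>"
    "\<And>v. v < n \<Longrightarrow> \<rho> v + 1 < n \<Longrightarrow> adj ! v \<noteq> [] \<and> \<rho> (hd (adj ! v)) = \<rho> v + 1"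
  proof (cases "n = 0")
    case True
    then have "E = {}" using G by (fastforce simp: simple_graph_def)
    then show ?thesis using that[of id] True by (auto simp: almost_noncrossing_def)
  next
    case False
    then have "0 < n" by simp
    show ?thesis by (rule boundary_order[OF max desc \<open>0 < n\<close>]) (rule that)
  qed
  \<comment> \<open>The exponent 6 works because 29 n + 10 is at most 32 (n + 2), and 32 is at most
    the fifth power of n + 2, even for n = 0.\<close>
  have "(2::nat) ^ 5 \<le> (n + 2) ^ 5" by (rule power_mono) simp_all
  then have "2 ^ 5 * (n + 2) \<le> (n + 2) ^ 5 * (n + 2)" by (rule mult_le_mono1)
  also have "\<dots> = (n + 2) ^ 6" using power_add[of "n + 2" 5 1] by simp
  finally have "2 ^ 5 * (n + 2) \<le> (n + 2) ^ 6" .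
  moreover have "29 * n + 10 \<le> 2 ^ 5 * (n + 2)" by simp
  ultimately have B: "29 * n + 10 \<le> (n + 2) ^ 6" by (rule order_trans[rotated])
  interpret ordered_graph n adj E \<rho> "(n + 2) ^ 6"
  proof
    show "length adj = n" using desc by (simp add: describes_def)
    show "distinct (adj ! v)" "set (adj ! v) = {w. {v, w} \<in> E}" if "v < n" for v
      using desc that by (auto simp: describes_def)
  qed (fact G \<rho> B)+
  show "\<exists>t s. exec ((n + 2) ^ 6) draw_program (initial_state (encode_input adj cr)) t s \<and>
      t \<le> 92 * (n + 1) \<and> outputs_bar_1_visibility_drawing s n E"
    by (rule draw_program_correct)
qed

theorem theorem3:
  shows "(\<exists>prog. linear_time_bar_1_visibility_algorithm prog) \<and>
    (\<forall>(V :: 'a set) E pos \<gamma>. maximal_outer_1_plane V E pos \<gamma> \<longrightarrow> bar_1_visible V E)"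
  using draw_program_linear_time outer_1_plane_bar_1_visible
  unfolding maximal_outer_1_plane_def by blast

end
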